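(* The Continuum Hypothesis is equivalent to the statement that all standard subcontinua of $[0,\infty)^*$ are homeomorphic (to one another).
   Context: For a Tychonoff space $Z$, $\beta Z$ is its Čech–Stone compactification and $Z^*=\beta Z\setminus Z$. Thus $\omega^*$ is the space of nonprincipal ultrafilters on $\omega$. The half line $[0,\infty)$ carries its usual topology. A sequence $\langle I_n\rangle_{n\in\omega}$ of closed intervals $I_n=[c_n,d_n]$ with $c_n<d_n$ in $[0,\infty)$ is discrete if every point of $[0,\infty)$ has a neighbourhood that meets $I_n$ for at most one $n$. A standard subcontinuum of $[0,\infty)^*$ is a set of the form $I_u=\bigcap_{U\in u}\mathrm{cl}\bigl(\bigcup_{n\in U}I_n\bigr)$, where $\langle I_n\rangle_{n\in\omega}$ is a discrete sequence of closed intervals in $[0,\infty)$, $u\in\omega^*$, and the closure is taken in $\beta[0,\infty)$. *)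

theory Defs
  imports "HOL-Analysis.Analysis"
begin

unbundle cardinal_syntax

text \<open>The Cech--Stone compactification of a Tychonoff space \<open>Z\<close>: the closure of the image of
  \<open>Z\<close> under the evaluation map into the cube \<open>[0,1]\<^sup>C\<close>, where \<open>C\<close> is the set of all continuous
  maps \<open>Z \<rightarrow> [0,1]\<close>. Members of \<open>C\<close> are taken \<open>extensional\<close>, so that distinct indices are
  distinct maps on \<open>topspace Z\<close>.\<close>

definition unit_maps :: "'a topology \<Rightarrow> ('a \<Rightarrow> real) set" where
  "unit_maps Z =
     {f \<in> extensional (topspace Z). continuous_map Z (top_of_set {0..1}) f}"

definition unit_cube :: "'a topology \<Rightarrow> (('a \<Rightarrow> real) \<Rightarrow> real) topology" where
  "unit_cube Z = product_topology (\<lambda>_. top_of_set {0..1}) (unit_maps Z)"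

definition stone_cech_map :: "'a topology \<Rightarrow> 'a \<Rightarrow> ('a \<Rightarrow> real) \<Rightarrow> real" where
  "stone_cech_map Z x = (\<lambda>f\<in>unit_maps Z. f x)"

definition stone_cech :: "'a topology \<Rightarrow> (('a \<Rightarrow> real) \<Rightarrow> real) topology" where
  "stone_cech Z =
     subtopology (unit_cube Z) (unit_cube Z closure_of (stone_cech_map Z ` topspace Z))"

definition ultrafilter :: "'a set set \<Rightarrow> bool" where
  "ultrafilter u \<longleftrightarrow>
     UNIV \<in> u \<and> {} \<notin> u \<and>
     (\<forall>A\<in>u. \<forall>B\<in>u. A \<inter> B \<in> u) \<and>
     (\<forall>A\<in>u. \<forall>B. A \<subseteq> B \<longrightarrow> B \<in> u) \<and>
     (\<forall>A. A \<in> u \<or> - A \<in> u)"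

definition nonprincipal_ultrafilter :: "'a set set \<Rightarrow> bool" where
  "nonprincipal_ultrafilter u \<longleftrightarrow> ultrafilter u \<and> (\<forall>a. {a} \<notin> u)"

abbreviation half_line :: "real topology" where
  "half_line \<equiv> top_of_set {0..}"

definition discrete_interval_sequence :: "(nat \<Rightarrow> real) \<Rightarrow> (nat \<Rightarrow> real) \<Rightarrow> bool" where
  "discrete_interval_sequence c d \<longleftrightarrow>
     (\<forall>n. 0 \<le> c n \<and> c n < d n) \<and>
     (\<forall>x\<in>topspace half_line. \<exists>W. openin half_line W \<and> x \<in> W \<and>
        (\<forall>m n. W \<inter> {c m..d m} \<noteq> {} \<and> W \<inter> {c n..d n} \<noteq> {} \<longrightarrow> m = n))"

definition interval_ultralimit ::
    "(nat \<Rightarrow> real) \<Rightarrow> (nat \<Rightarrow> real) \<Rightarrow> nat set set \<Rightarrow> (((real \<Rightarrow> real) \<Rightarrow> real) set)" where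
  "interval_ultralimit c d u =
     (\<Inter>U\<in>u. stone_cech half_line closure_of
        (stone_cech_map half_line ` (\<Union>n\<in>U. {c n..d n})))"

definition standard_subcontinuum :: "((real \<Rightarrow> real) \<Rightarrow> real) set \<Rightarrow> bool" where
  "standard_subcontinuum S \<longleftrightarrow>
     (\<exists>c d u. discrete_interval_sequence c d \<and> nonprincipal_ultrafilter u \<and>
        S = interval_ultralimit c d u)"

definition Continuum_Hypothesis :: bool where
  "Continuum_Hypothesis \<longleftrightarrow> ctwo ^c natLeq =o cardSuc natLeq"

end

theory Submission
  imports Defs "HOL-Library.Countable_Set_Type"
begin

text \<open>
  A point of the standard subcontinuum over an ultrafilter \<open>u\<close> is determined by the limits it gives to
  sequences of maps \<open>[0,1] \<rightarrow> [0,1]\<close>, and the systems of limits that occur are exactly those that are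
  finitely satisfiable modulo \<open>u\<close>. Hence the subcontinuum depends only on \<open>u\<close>, and in fact only on the
  ultrapower modulo \<open>u\<close> of the maps \<open>[0,1] \<rightarrow> [0,1]\<close>, equipped with the countably many relations
  ``some \<open>t\<close> satisfies \<open>|f\<^sub>i(t) - q\<^sub>i| < e\<close> for all \<open>i\<close>'' with rational \<open>q\<^sub>i\<close> and \<open>e\<close>. Under CH such ultrapowers
  are \<open>\<aleph>\<^sub>1\<close>-saturated of cardinality \<open>\<aleph>\<^sub>1\<close>, so a back-and-forth argument makes them isomorphic.

  If CH fails, there are ultrafilters \<open>u\<close> and \<open>v\<close> such that the infinite elements of \<open>\<omega>\<^sup>\<omega>/u\<close> have a
  coinitial set of size \<open>\<aleph>\<^sub>1\<close>, while every \<open>\<aleph>\<^sub>1\<close> infinite elements of \<open>\<omega>\<^sup>\<omega>/v\<close> have an infinite lower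
  bound. Both come from an independent family of functions indexed by a regular cardinal, \<open>\<omega>\<^sub>1\<close> or \<open>\<omega>\<^sub>2\<close>,
  by forcing the functions one after another to be infinite but smaller than all infinite functions
  decided before. In the subcontinuum over \<open>u\<close> the infinitesimals then produce an
  \<open>(\<omega>\<^sub>1, \<omega>\<^sup>*)\<close>-gap among the subcontinua containing a given end point, and over \<open>v\<close> there is no such
  gap. The end points are topologically distinguished, as the only pair of points between which the
  subcontinuum is irreducible.
\<close>

section \<open>Ultrafilters as filters\<close>

text \<open>The ultrapower itself is never formed: equality and truth in it are replaced by eventual
  statements about representing sequences. In the negative direction the obstacle is that the cut
  sets \<open>lower a\<close> are not given topologically. The invariant therefore speaks of
  arbitrary subcontinua at an end point and of open sets between them; whenever there is such an
  open set, a cut set can be interpolated, and this translates a gap back into the order of the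
  ultrapower. For the ultrafilters, the independent family alone says nothing about arbitrary
  subsets of \<nat>. A filter maximal among those meeting all cylinders makes the cylinders dense in
  the quotient, so that each set depends on countably many coordinates and each function is known at
  a bounded stage of the construction. Failure of CH enters as the room for \<omega>_2 independent
  functions indexed by reals.\<close>

definition free_ultra :: "nat filter \<Rightarrow> bool" where
  "free_ultra U \<longleftrightarrow> U \<noteq> bot \<and> U \<le> sequentially \<and>
     (\<forall>P. eventually P U \<or> eventually (\<lambda>n. \<not> P n) U)"

lemma free_ultra_not_iff:
  assumes "free_ultra U"
  shows "eventually (\<lambda>n. \<not> P n) U \<longleftrightarrow> \<not> eventually P U"
proof
  assume "eventually (\<lambda>n. \<not> P n) U"
  then show "\<not> eventually P U"
    using assms eventually_conj[of P U "\<lambda>n. \<not> P n"]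
    by (auto simp: free_ultra_def trivial_limit_def)
qed (use assms in \<open>auto simp: free_ultra_def\<close>)

lemma free_ultra_frequently_iff:
  "free_ultra U \<Longrightarrow> frequently P U \<longleftrightarrow> eventually P U"
  by (simp add: frequently_def free_ultra_not_iff)

lemma free_ultra_disj_iff:
  assumes "free_ultra U"
  shows "eventually (\<lambda>n. P n \<or> Q n) U \<longleftrightarrow> eventually P U \<or> eventually Q U"
  by (simp add: frequently_disj_iff assms flip: free_ultra_frequently_iff)

lemma free_ultra_ge: "free_ultra U \<Longrightarrow> eventually (\<lambda>n. k \<le> n) U"
  unfolding free_ultra_def using eventually_ge_at_top filter_leD by blast

lemma free_ultra_const: "free_ultra U \<Longrightarrow> eventually (\<lambda>n. P) U \<longleftrightarrow> P"
  by (auto simp: free_ultra_def eventually_const_iff)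

definition set_filter :: "nat set set \<Rightarrow> nat filter" where
  "set_filter u = Abs_filter (\<lambda>P. {n. P n} \<in> u)"

lemma eventually_set_filter:
  assumes "ultrafilter u"
  shows "eventually P (set_filter u) \<longleftrightarrow> {n. P n} \<in> u"
  unfolding set_filter_def
proof (rule eventually_Abs_filter, unfold_locales)
  show "{n. True} \<in> u" using assms by (simp add: ultrafilter_def)
next
  fix P Q assume "{n. P n} \<in> u" "{n. Q n} \<in> u"
  then have "{n. P n} \<inter> {n. Q n} \<in> u" using assms by (simp add: ultrafilter_def)
  then show "{n. P n \<and> Q n} \<in> u" by (simp add: Collect_conj_eq)
next
  fix P Q assume "\<forall>n. P n \<longrightarrow> Q n" "{n. P n} \<in> u"
  moreover have "{n. P n} \<subseteq> {n. Q n}" using calculation by auto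
  ultimately show "{n. Q n} \<in> u" using assms by (auto simp: ultrafilter_def)
qed

lemma free_ultra_set_filter:
  assumes "nonprincipal_ultrafilter u"
  shows "free_ultra (set_filter u)"
proof -
  have u: "ultrafilter u" and np: "\<And>a. {a} \<notin> u"
    using assms by (auto simp: nonprincipal_ultrafilter_def)
  have ne: "\<forall>\<^sub>F n in set_filter u. n \<noteq> a" for a
  proof -
    have "- {a} \<in> u" using u np unfolding ultrafilter_def by blast
    moreover have "- {a} = {n. n \<noteq> a}" by auto
    ultimately show ?thesis by (simp add: eventually_set_filter[OF u])
  qed
  have "\<forall>\<^sub>F n in set_filter u. k \<le> n" for k
  proof -
    have "\<forall>\<^sub>F n in set_filter u. \<forall>a\<in>{..<k}. n \<noteq> a"
      by (rule eventually_ball_finite) (auto intro: ne)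
    then show ?thesis by (rule eventually_mono) (metis lessThan_iff not_le_imp_less)
  qed
  then have "set_filter u \<le> sequentially"
    unfolding le_filter_def eventually_sequentially by (metis (mono_tags, lifting) eventually_mono)
  moreover have "set_filter u \<noteq> bot"
    using u by (auto simp: trivial_limit_def eventually_set_filter[OF u] ultrafilter_def)
  moreover have "eventually P (set_filter u) \<or> eventually (\<lambda>n. \<not> P n) (set_filter u)" for P
    using u by (auto simp: eventually_set_filter[OF u] ultrafilter_def Collect_neg_eq)
  ultimately show ?thesis by (simp add: free_ultra_def)
qed

section \<open>Back-and-forth between ultrapowers\<close>

text \<open>Variables are de Bruijn indices, and \<open>Ex\<close> binds index 0. Equality is absent
  and has to be supplied as one of the relations. Over countably many relation symbols there are
  countably many formulas, which is what lets a sequence over \<nat> realise a type.\<close>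

datatype 'i fm = Rel 'i "nat list" | Neg "'i fm" | Conj "'i fm" "'i fm" | Ex "'i fm"

instance fm :: (countable) countable
  by countable_datatype

primrec sat :: "('i \<Rightarrow> 'a list \<Rightarrow> bool) \<Rightarrow> 'i fm \<Rightarrow> (nat \<Rightarrow> 'a) \<Rightarrow> bool" where
  "sat R (Rel i xs) e \<longleftrightarrow> R i (map e xs)"
| "sat R (Neg p) e \<longleftrightarrow> \<not> sat R p e"
| "sat R (Conj p q) e \<longleftrightarrow> sat R p e \<and> sat R q e"
| "sat R (Ex p) e \<longleftrightarrow> (\<exists>a. sat R p (case_nat a e))"

primrec rename :: "'i fm \<Rightarrow> (nat \<Rightarrow> nat) \<Rightarrow> 'i fm" where
  "rename (Rel i xs) s = Rel i (map s xs)"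
| "rename (Neg p) s = Neg (rename p s)"
| "rename (Conj p q) s = Conj (rename p s) (rename q s)"
| "rename (Ex p) s = Ex (rename p (case_nat 0 (\<lambda>x. Suc (s x))))"

lemma sat_rename: "sat R (rename p s) e \<longleftrightarrow> sat R p (\<lambda>x. e (s x))"
proof (induction p arbitrary: s e)
  case (Ex p)
  have "(\<lambda>x. case_nat a e (case_nat 0 (\<lambda>x. Suc (s x)) x)) = case_nat a (\<lambda>x. e (s x))" for a
    by (auto simp: fun_eq_iff split: nat.splits)
  then show ?case using Ex by simp
qed (simp_all add: comp_def)

lemma sat_finite_support:
  "\<exists>m. \<forall>e e'. (\<forall>x<m. e x = e' x) \<longrightarrow> sat R p e = sat R p e'"
proof (induction p)
  case (Rel i xs)
  obtain m where m: "\<forall>x\<in>set xs. x < m"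
    using finite_nat_set_iff_bounded[of "set xs"] by auto
  show ?case
  proof (intro exI[of _ m] allI impI)
    fix e e' :: "nat \<Rightarrow> 'a" assume e: "\<forall>x<m. e x = e' x"
    have "map e xs = map e' xs" using e m by (intro map_cong) auto
    then show "sat R (Rel i xs) e = sat R (Rel i xs) e'" by (simp only: sat.simps)
  qed
next
  case (Neg p)
  then show ?case unfolding sat.simps by presburger
next
  case (Conj p q)
  obtain m where m: "\<forall>e e'. (\<forall>x<m. e x = e' x) \<longrightarrow> sat R p e = sat R p e'"
    using Conj by blast
  obtain n where n: "\<forall>e e'. (\<forall>x<n. e x = e' x) \<longrightarrow> sat R q e = sat R q e'"
    using Conj by blast
  show ?case
  proof (intro exI[of _ "max m n"] allI impI)
    fix e e' :: "nat \<Rightarrow> 'a" assume e: "\<forall>x<max m n. e x = e' x"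
    have "sat R p e = sat R p e'" "sat R q e = sat R q e'"
      by (rule m[rule_format], use e in simp, rule n[rule_format], use e in simp)
    then show "sat R (Conj p q) e = sat R (Conj p q) e'" by simp
  qed
next
  case (Ex p)
  obtain m where m: "\<forall>e e'. (\<forall>x<m. e x = e' x) \<longrightarrow> sat R p e = sat R p e'"
    using Ex by blast
  show ?case
  proof (intro exI[of _ m] allI impI)
    fix e e' :: "nat \<Rightarrow> 'a" assume e: "\<forall>x<m. e x = e' x"
    have "sat R p (case_nat a e) = sat R p (case_nat a e')" for a
      by (rule m[rule_format]) (use e in \<open>auto split: nat.splits\<close>)
    then show "sat R (Ex p) e = sat R (Ex p) e'" by simp
  qed
qed

text \<open>By Los's theorem truth almost everywhere is truth in the ultrapower, so this says that
  sending the class of each \<open>fst (p x)\<close> to that of \<open>snd (p x)\<close> is a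
  partial elementary map.\<close>

definition elem_seq ::
    "('i \<Rightarrow> 'a list \<Rightarrow> bool) \<Rightarrow> nat filter \<Rightarrow> nat filter \<Rightarrow>
      (nat \<Rightarrow> (nat \<Rightarrow> 'a) \<times> (nat \<Rightarrow> 'a)) \<Rightarrow> bool" where
  "elem_seq R U V p \<longleftrightarrow>
     (\<forall>\<phi>. (\<forall>\<^sub>F n in U. sat R \<phi> (\<lambda>x. fst (p x) n)) \<longleftrightarrow>
          (\<forall>\<^sub>F n in V. sat R \<phi> (\<lambda>x. snd (p x) n)))"

definition elementary ::
    "('i \<Rightarrow> 'a list \<Rightarrow> bool) \<Rightarrow> nat filter \<Rightarrow> nat filter \<Rightarrow>
      ((nat \<Rightarrow> 'a) \<times> (nat \<Rightarrow> 'a)) set \<Rightarrow> bool" where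
  "elementary R U V Q \<longleftrightarrow> (\<forall>p. range p \<subseteq> Q \<longrightarrow> elem_seq R U V p)"

text \<open>The substitution \<open>s\<close> may repeat or permute variables, so elementarity of a
  countable relation can be tested on a single enumeration of it.\<close>

lemma elem_seq_rename:
  assumes "elem_seq R U V p"
  shows "elem_seq R U V (\<lambda>x. p (s x))"
  unfolding elem_seq_def
proof
  fix \<phi>
  show "(\<forall>\<^sub>F n in U. sat R \<phi> (\<lambda>x. fst (p (s x)) n)) \<longleftrightarrow>
        (\<forall>\<^sub>F n in V. sat R \<phi> (\<lambda>x. snd (p (s x)) n))"
    using assms[unfolded elem_seq_def, rule_format, of "rename \<phi> s"] by (simp add: sat_rename)
qed

lemma elementary_range_iff: "elementary R U V (range p) \<longleftrightarrow> elem_seq R U V p"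
proof
  assume p: "elem_seq R U V p"
  show "elementary R U V (range p)"
    unfolding elementary_def
  proof (intro allI impI)
    fix q :: "nat \<Rightarrow> _" assume "range q \<subseteq> range p"
    then have "\<forall>x. \<exists>y. q x = p y" by blast
    then obtain s where "\<And>x. q x = p (s x)" by metis
    then show "elem_seq R U V q" using elem_seq_rename[OF p, of s] by presburger
  qed
qed (auto simp: elementary_def)

lemma elementary_mono: "elementary R U V Q \<Longrightarrow> P \<subseteq> Q \<Longrightarrow> elementary R U V P"
  by (auto simp: elementary_def)

text \<open>The step uses the \<open>\<aleph>\<^sub>1\<close>-saturation of ultrapowers over \<open>\<nat>\<close>: the countable type of
  the new element \<open>f\<close> is realised on the other side by diagonalising over its finite parts.\<close>

lemma elem_seq_extend:
  fixes R :: "'i::countable \<Rightarrow> 'a list \<Rightarrow> bool"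
  assumes U: "free_ultra U" and V: "free_ultra V" and p: "elem_seq R U V p"
  shows "\<exists>g. elem_seq R U V (case_nat (f, g) p)"
proof -
  define eu where "eu n = case_nat (f n) (\<lambda>x. fst (p x) n)" for n
  define ev where "ev a n = case_nat a (\<lambda>x. snd (p x) n)" for a n
  define T where "T = {\<phi>. \<forall>\<^sub>F n in U. sat R \<phi> (eu n)}"
  have eu: "(\<lambda>x. fst (case_nat (f, g) p x) n) = eu n" for g n
    by (auto simp: eu_def fun_eq_iff split: nat.splits)
  have ev: "(\<lambda>x. snd (case_nat (f, g) p x) n) = ev (g n) n" for g n
    by (auto simp: ev_def fun_eq_iff split: nat.splits)
  have Neg_T: "Neg \<phi> \<in> T \<longleftrightarrow> \<phi> \<notin> T" for \<phi>
    by (simp add: T_def free_ultra_not_iff[OF U])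
  define \<psi> where "\<psi> = from_nat_into T"
  have "T \<noteq> {}" using Neg_T by blast
  then have \<psi>: "range \<psi> = T" by (simp add: \<psi>_def)
  have fin: "\<forall>\<^sub>F n in V. \<exists>a. \<forall>i\<le>k. sat R (\<psi> i) (ev a n)" for k
  proof -
    define conj where "conj = rec_nat (\<psi> 0) (\<lambda>i q. Conj (\<psi> (Suc i)) q)"
    have conj_sat: "sat R (conj k) e \<longleftrightarrow> (\<forall>i\<le>k. sat R (\<psi> i) e)" for k e
      by (induction k) (auto simp: conj_def le_Suc_eq)
    have "\<forall>\<^sub>F n in U. \<forall>i\<in>{..k}. sat R (\<psi> i) (eu n)"
      using \<psi> by (intro eventually_ball_finite) (auto simp: T_def)
    then have "\<forall>\<^sub>F n in U. sat R (Ex (conj k)) (\<lambda>x. fst (p x) n)"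
      by (rule eventually_mono) (auto simp: conj_sat eu_def)
    then have "\<forall>\<^sub>F n in V. sat R (Ex (conj k)) (\<lambda>x. snd (p x) n)"
      by (rule p[unfolded elem_seq_def, rule_format, THEN iffD1])
    then show ?thesis by (simp add: conj_sat ev_def)
  qed
  define good where "good n a k \<longleftrightarrow> (\<forall>i\<le>k. sat R (\<psi> i) (ev a n))" for n a k
  have good_mono: "good n a j" if "good n a k" "j \<le> k" for n a j k
    using that unfolding good_def by (meson order_trans)
  \<comment> \<open>Being good for some \<open>k\<close> implies being good for all smaller ones, so
    a witness for the largest attainable \<open>k\<close> serves them all.\<close>
  have best: "\<exists>a. \<forall>k\<le>m. (\<exists>b. good n b k) \<longrightarrow> good n a k" for n m
  proof (induction m)
    case (Suc m)
    show ?case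
    proof (cases "\<exists>b. good n b (Suc m)")
      case True
      then obtain b where "good n b (Suc m)" by blast
      then have "good n b k" if "k \<le> Suc m" for k using good_mono that by blast
      then show ?thesis by blast
    next
      case False
      obtain a where "\<forall>k\<le>m. (\<exists>b. good n b k) \<longrightarrow> good n a k" using Suc by blast
      then show ?thesis using False by (intro exI[of _ a]) (auto simp: le_Suc_eq)
    qed
  next
    case 0
    then show ?case by (metis le_zero_eq)
  qed
  have "\<exists>g. \<forall>n. \<forall>k\<le>n. (\<exists>b. good n b k) \<longrightarrow> good n (g n) k"
    by (rule choice) (use best in blast)
  then obtain g where g: "\<And>n k. k \<le> n \<Longrightarrow> (\<exists>b. good n b k) \<Longrightarrow> good n (g n) k"
    by blast
  \<comment> \<open>One direction suffices: \<open>T\<close> contains \<open>Neg \<phi>\<close> for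
    each \<phi> outside it.\<close>
  have T_V: "\<forall>\<^sub>F n in V. sat R \<phi> (ev (g n) n)" if \<phi>: "\<phi> \<in> T" for \<phi>
  proof -
    obtain k where k: "\<phi> = \<psi> k" using \<phi> \<psi> by blast
    show ?thesis
      using fin[of k] free_ultra_ge[OF V, of k]
    proof eventually_elim
      case (elim n)
      then have "good n (g n) k" by (intro g) (auto simp: good_def)
      then show ?case by (auto simp: good_def k)
    qed
  qed
  have "(\<forall>\<^sub>F n in V. sat R \<phi> (ev (g n) n)) \<longleftrightarrow> \<phi> \<in> T" for \<phi>
    using T_V[of \<phi>] T_V[of "Neg \<phi>"] by (auto simp: Neg_T free_ultra_not_iff[OF V])
  then have "elem_seq R U V (case_nat (f, g) p)"
    unfolding elem_seq_def eu ev by (simp add: T_def)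
  then show ?thesis by blast
qed

lemma elementary_extend:
  fixes R :: "'i::countable \<Rightarrow> 'a list \<Rightarrow> bool"
  assumes U: "free_ultra U" and V: "free_ultra V"
    and Q: "elementary R U V Q" "countable Q" "Q \<noteq> {}"
  shows "\<exists>g. elementary R U V (insert (f, g) Q)"
proof -
  obtain p :: "nat \<Rightarrow> _" where p: "range p = Q"
    using range_from_nat_into[OF Q(3,2)] by metis
  then have "elem_seq R U V p" using Q(1) by (simp add: elementary_range_iff flip: p)
  then obtain g where g: "elem_seq R U V (case_nat (f, g) p)"
    using elem_seq_extend[OF U V] by blast
  have "insert (f, g) Q \<subseteq> range (case_nat (f, g) p)"
  proof
    fix q assume "q \<in> insert (f, g) Q"
    then consider "q = case_nat (f, g) p 0" | x where "q = case_nat (f, g) p (Suc x)"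
      using p by auto
    then show "q \<in> range (case_nat (f, g) p)" by cases blast+
  qed
  then have "elementary R U V (insert (f, g) Q)"
    using g by (intro elementary_mono[OF elementary_range_iff[THEN iffD2]])
  then show ?thesis by (intro exI[of _ g])
qed

lemma elementary_converse:
  assumes "elementary R U V Q" shows "elementary R V U (Q\<inverse>)"
  unfolding elementary_def
proof (intro allI impI)
  fix p :: "nat \<Rightarrow> _" assume p: "range p \<subseteq> Q\<inverse>"
  have "prod.swap (p x) \<in> Q" for x
  proof -
    have "p x \<in> Q\<inverse>" using p by blast
    then show ?thesis by (cases "p x") simp
  qed
  then have "range (\<lambda>x. prod.swap (p x)) \<subseteq> Q" by blast
  then have "elem_seq R U V (\<lambda>x. prod.swap (p x))"
    using assms unfolding elementary_def by blast
  then show "elem_seq R V U p"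
    unfolding elem_seq_def by simp
qed

lemma elementary_extend':
  fixes R :: "'i::countable \<Rightarrow> 'a list \<Rightarrow> bool"
  assumes U: "free_ultra U" and V: "free_ultra V"
    and Q: "elementary R U V Q" "countable Q" "Q \<noteq> {}"
  shows "\<exists>g. elementary R U V (insert (g, f) Q)"
proof -
  have "\<exists>g. elementary R V U (insert (f, g) (Q\<inverse>))"
  proof (intro elementary_extend[OF V U] elementary_converse Q)
    have "Q\<inverse> = prod.swap ` Q" by force
    then show "countable (Q\<inverse>)" using Q by simp
  qed (use Q in auto)
  then obtain g where "elementary R V U (insert (f, g) (Q\<inverse>))" ..
  then have "elementary R U V ((insert (f, g) (Q\<inverse>))\<inverse>)" by (rule elementary_converse)
  moreover have "(insert (f, g) (Q\<inverse>))\<inverse> = insert (g, f) Q" by auto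
  ultimately show ?thesis by auto
qed

text \<open>The truth of a formula depends on finitely many variables, so elementarity is a property
  of finite character and survives unions of increasing chains.\<close>

lemma elementary_finite_subsets:
  assumes "\<And>F. finite F \<Longrightarrow> F \<subseteq> Q \<Longrightarrow> F \<noteq> {} \<Longrightarrow> elementary R U V F"
  shows "elementary R U V Q"
  unfolding elementary_def
proof (intro allI impI)
  fix p :: "nat \<Rightarrow> _" assume p: "range p \<subseteq> Q"
  show "elem_seq R U V p"
    unfolding elem_seq_def
  proof
    fix \<phi>
    obtain m where m: "\<And>e e'. (\<forall>x<m. e x = e' x) \<Longrightarrow> sat R \<phi> e = sat R \<phi> e'"
      using sat_finite_support[of R \<phi>] by blast
    define p' where "p' x = (if x < m then p x else p 0)" for x
    have "range p' \<subseteq> p ` {..m}" by (auto simp: p'_def)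
    then have "finite (range p')" using finite_surj by blast
    moreover have "range p' \<subseteq> Q" using p by (auto simp: p'_def)
    ultimately have "elem_seq R U V p'" using assms by (simp flip: elementary_range_iff)
    moreover have "sat R \<phi> (\<lambda>x. fst (p x) n) = sat R \<phi> (\<lambda>x. fst (p' x) n)"
      "sat R \<phi> (\<lambda>x. snd (p x) n) = sat R \<phi> (\<lambda>x. snd (p' x) n)" for n
      by (auto intro!: m simp: p'_def)
    ultimately show "(\<forall>\<^sub>F n in U. sat R \<phi> (\<lambda>x. fst (p x) n)) \<longleftrightarrow>
          (\<forall>\<^sub>F n in V. sat R \<phi> (\<lambda>x. snd (p x) n))"
      by (simp add: elem_seq_def)
  qed
qed

text \<open>All sequences are listed in order type at most \<omega>_1, so every stage has a
  countable past and the one-step extensions apply on both sides. A stage treats its sequence once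
  as a first and once as a second component.\<close>

lemma back_and_forth:
  fixes R :: "'i::countable \<Rightarrow> 'a list \<Rightarrow> bool"
  assumes U: "free_ultra U" and V: "free_ultra V"
    and card: "|UNIV :: (nat \<Rightarrow> 'a) set| \<le>o cardSuc natLeq"
  obtains E where "elementary R U V E" "\<And>f. \<exists>g. (f, g) \<in> E" "\<And>g. \<exists>f. (f, g) \<in> E"
proof -
  define r where "r = |UNIV :: (nat \<Rightarrow> 'a) set|"
  have wo: "wo_rel r" by (simp add: r_def wo_rel_def card_of_Well_order)
  have wf: "wf (r - Id)" using wo by (rule wo_rel.WF)
  have Field: "Field r = UNIV" unfolding r_def by (rule Field_card_of)
  have count: "countable (underS r x)" for x
  proof -
    have "|underS r x| <o r"
      using Field unfolding r_def by (intro card_of_underS card_of_Card_order) simp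
    then have "|underS r x| <o cardSuc natLeq"
      using card unfolding r_def by (rule ordLess_ordLeq_trans)
    then have "|underS r x| \<le>o natLeq"
      by (rule cardSuc_ordLeq_ordLess[OF natLeq_Card_order card_of_Card_order, THEN iffD1])
    then show ?thesis by (rule countable_card_le_natLeq[THEN iffD2])
  qed
  \<comment> \<open>The extension step needs a nonempty relation to start from. Under a constant
    assignment a formula has the same truth value at every \<open>n\<close>, hence modulo
    \<open>U\<close> and modulo \<open>V\<close> alike.\<close>
  define k where "k = (\<lambda>n::nat. undefined :: 'a)"
  define W where "W N x = {(x, fst N), (snd N, x)}" for N :: "(nat \<Rightarrow> 'a) \<times> (nat \<Rightarrow> 'a)" and x
  define Q where "Q N x = insert (k, k) (\<Union>y\<in>underS r x. W (N y) y)" for N x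
  have Q_step: "Q N y \<union> W (N y) y \<subseteq> Q N z" if "y \<in> underS r z" for N y z
  proof -
    have "underS r y \<subseteq> underS r z"
      using that wo_rel.TRANS[OF wo] wo_rel.ANTISYM[OF wo]
      by (intro underS_incr) (auto simp: underS_def)
    then show ?thesis using that by (auto simp: Q_def)
  qed
  \<comment> \<open>Stages increase, so a finite part of their union already lies in one of
    them.\<close>
  have fin: "F \<subseteq> {(k, k)} \<or> (\<exists>y\<in>A. F \<subseteq> Q N y \<union> W (N y) y)"
    if "finite F" "F \<subseteq> insert (k, k) (\<Union>y\<in>A. W (N y) y)" for F A N
    using that
  proof (induction F)
    case (insert a F)
    then have IH: "F \<subseteq> {(k, k)} \<or> (\<exists>y\<in>A. F \<subseteq> Q N y \<union> W (N y) y)" by simp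
    have kQ: "(k, k) \<in> Q N y" for y by (simp add: Q_def)
    show ?case
    proof (cases "a = (k, k)")
      case True
      then show ?thesis using IH kQ by auto
    next
      case False
      then obtain z where z: "z \<in> A" "a \<in> W (N z) z" using insert by auto
      consider "F \<subseteq> {(k, k)}" | y where "y \<in> A" "F \<subseteq> Q N y \<union> W (N y) y" using IH by blast
      then show ?thesis
      proof cases
        case 1
        then show ?thesis using z kQ by (intro disjI2 bexI[of _ z]) auto
      next
        case (2 y)
        consider "y = z" | "y \<in> underS r z" | "z \<in> underS r y"
          using wo_rel.TOTAL[OF wo] Field by (auto simp: total_on_def underS_def)
        then show ?thesis
        proof cases
          case 1
          then show ?thesis using 2 z by auto
        next
          case 2
          then show ?thesis using Q_step[OF 2, of N] \<open>F \<subseteq> _\<close> z by (intro disjI2 bexI[of _ z]) auto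
        next
          case 3
          then show ?thesis using 2 z by (intro disjI2 bexI[of _ y]) (auto simp: Q_def)
        qed
      qed
    qed
  qed simp
  have seed: "elementary R U V {(k, k)}"
    unfolding elementary_def elem_seq_def
    by (simp add: image_subset_iff k_def free_ultra_const[OF U] free_ultra_const[OF V])
  have "\<exists>N. \<forall>x. elementary R U V (Q N x \<union> W (N x) x)"
  proof (rule dependent_wf_choice[OF wf])
    fix N N' :: "(nat \<Rightarrow> 'a) \<Rightarrow> (nat \<Rightarrow> 'a) \<times> (nat \<Rightarrow> 'a)" and x gh assume "\<And>z. (z, x) \<in> r - Id \<Longrightarrow> N z = N' z"
    then have "Q N x = Q N' x" by (auto simp: Q_def underS_def)
    then show "elementary R U V (Q N x \<union> W gh x) = elementary R U V (Q N' x \<union> W gh x)" by simp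
  next
    fix x and N :: "(nat \<Rightarrow> 'a) \<Rightarrow> (nat \<Rightarrow> 'a) \<times> (nat \<Rightarrow> 'a)"
    assume IH: "\<And>y. (y, x) \<in> r - Id \<Longrightarrow> elementary R U V (Q N y \<union> W (N y) y)"
    have el: "elementary R U V (Q N x)"
    proof (rule elementary_finite_subsets)
      fix F assume "finite F" "F \<subseteq> Q N x"
      then have "F \<subseteq> {(k, k)} \<or> (\<exists>y\<in>underS r x. F \<subseteq> Q N y \<union> W (N y) y)"
        unfolding Q_def[of N x] by (rule fin)
      then show "elementary R U V F"
        using IH seed by (auto simp: underS_def intro: elementary_mono)
    qed
    have cQ: "countable (Q N x)" "Q N x \<noteq> {}"
      using count[of x] by (auto simp: Q_def W_def)
    obtain g where g: "elementary R U V (insert (x, g) (Q N x))"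
      using elementary_extend[OF U V el cQ] by blast
    have cg: "countable (insert (x, g) (Q N x))" "insert (x, g) (Q N x) \<noteq> {}"
      using cQ by auto
    obtain h where "elementary R U V (insert (h, x) (insert (x, g) (Q N x)))"
      using elementary_extend'[OF U V g cg] by blast
    moreover have "insert (h, x) (insert (x, g) (Q N x)) = Q N x \<union> W (g, h) x"
      by (auto simp: W_def)
    ultimately show "\<exists>gh. elementary R U V (Q N x \<union> W gh x)" by auto
  qed
  then obtain N where N: "\<And>x. elementary R U V (Q N x \<union> W (N x) x)" by blast
  define E where "E = insert (k, k) (\<Union>x. W (N x) x)"
  show thesis
  proof
    show "elementary R U V E"
    proof (rule elementary_finite_subsets)
      fix F assume "finite F" "F \<subseteq> E"
      then have "F \<subseteq> {(k, k)} \<or> (\<exists>y\<in>UNIV. F \<subseteq> Q N y \<union> W (N y) y)"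
        unfolding E_def by (rule fin)
      then show "elementary R U V F" using seed elementary_mono[OF N] by (auto intro: elementary_mono)
    qed
    show "\<exists>g. (f, g) \<in> E" for f
      by (intro exI[of _ "fst (N f)"]) (auto simp: E_def W_def)
    show "\<exists>f. (f, g) \<in> E" for g
      by (intro exI[of _ "snd (N g)"]) (auto simp: E_def W_def)
  qed
qed

section \<open>Ultrafilters with prescribed coinitiality of the infinite functions\<close>

text \<open>\<open>S_max\<close> is maximality: adjoining \<open>A\<close> would produce a set
  missing some member of \<open>C\<close>. For \<open>C = {UNIV}\<close> these are the ultrafilters.
  Applied to a complement it says that every set whose complement is not in \<open>S\<close>
  contains a member of \<open>C\<close> modulo \<open>S\<close>, so \<open>C\<close> is dense in the
  quotient.\<close>

locale positive_filter =
  fixes C S :: "'a set set"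
  assumes S_UNIV: "UNIV \<in> S"
    and S_Int: "\<And>A B. A \<in> S \<Longrightarrow> B \<in> S \<Longrightarrow> A \<inter> B \<in> S"
    and S_pos: "\<And>A b. A \<in> S \<Longrightarrow> b \<in> C \<Longrightarrow> A \<inter> b \<noteq> {}"
    and S_max: "\<And>A. A \<notin> S \<Longrightarrow> \<exists>b\<in>C. \<exists>Z\<in>S. b \<inter> A \<inter> Z = {}"

lemma positive_filter_exists:
  fixes \<U> :: "'a set set"
  assumes ne: "\<U> \<noteq> {}" and Int: "\<And>A B. A \<in> \<U> \<Longrightarrow> B \<in> \<U> \<Longrightarrow> A \<inter> B \<in> \<U>"
    and pos: "\<And>A b. A \<in> \<U> \<Longrightarrow> b \<in> C \<Longrightarrow> A \<inter> b \<noteq> {}"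
  obtains S where "\<U> \<subseteq> S" "positive_filter C S"
proof -
  define \<F> where "\<F> = {S. \<U> \<subseteq> S \<and> UNIV \<in> S \<and> (\<forall>A\<in>S. \<forall>B\<in>S. A \<inter> B \<in> S) \<and>
     (\<forall>A\<in>S. \<forall>B. A \<subseteq> B \<longrightarrow> B \<in> S) \<and> (\<forall>A\<in>S. \<forall>b\<in>C. A \<inter> b \<noteq> {})}"
  have "\<exists>M\<in>\<F>. \<forall>X\<in>\<F>. M \<subseteq> X \<longrightarrow> X = M"
  proof (rule subset_Zorn_nonempty)
    define T where "T = {X. \<exists>A\<in>\<U>. A \<subseteq> X}"
    have "\<U> \<subseteq> T" "UNIV \<in> T" using ne by (auto simp: T_def)
    moreover have "A \<inter> B \<in> T" if AB: "A \<in> T" "B \<in> T" for A B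
    proof -
      obtain A' B' where "A' \<in> \<U>" "A' \<subseteq> A" "B' \<in> \<U>" "B' \<subseteq> B" using AB by (auto simp: T_def)
      then show ?thesis using Int[of A' B'] by (auto simp: T_def intro!: bexI[of _ "A' \<inter> B'"])
    qed
    moreover have "\<forall>A\<in>T. \<forall>B. A \<subseteq> B \<longrightarrow> B \<in> T" unfolding T_def by blast
    moreover have "\<forall>A\<in>T. \<forall>b\<in>C. A \<inter> b \<noteq> {}" unfolding T_def using pos by blast
    ultimately have "T \<in> \<F>" unfolding \<F>_def by blast
    then show "\<F> \<noteq> {}" by blast
  next
    fix \<C> assume C: "\<C> \<noteq> {}" "subset.chain \<F> \<C>"
    have sub: "\<And>S. S \<in> \<C> \<Longrightarrow> S \<in> \<F>" using C by (auto simp: subset.chain_def)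
    have tot: "\<And>S T. S \<in> \<C> \<Longrightarrow> T \<in> \<C> \<Longrightarrow> S \<subseteq> T \<or> T \<subseteq> S"
      using C by (auto simp: subset.chain_def)
    obtain S0 where S0: "S0 \<in> \<C>" using C by blast
    have "\<U> \<subseteq> \<Union>\<C>" "UNIV \<in> \<Union>\<C>" using S0 sub[of S0] by (auto simp: \<F>_def)
    moreover have "A \<inter> B \<in> \<Union>\<C>" if AB: "A \<in> \<Union>\<C>" "B \<in> \<Union>\<C>" for A B
    proof -
      obtain S T where ST: "S \<in> \<C>" "T \<in> \<C>" "A \<in> S" "B \<in> T" using AB by blast
      then have "A \<in> S \<union> T" "B \<in> S \<union> T" "S \<union> T \<in> \<C>"
        using tot[of S T] by (auto simp: sup.absorb1 sup.absorb2)
      moreover from this have "A \<inter> B \<in> S \<union> T" using sub[of "S \<union> T"] by (simp add: \<F>_def)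
      ultimately show ?thesis by blast
    qed
    moreover have "\<forall>A\<in>\<Union>\<C>. \<forall>B. A \<subseteq> B \<longrightarrow> B \<in> \<Union>\<C>"
    proof (intro ballI allI impI)
      fix A B assume "A \<in> \<Union>\<C>" "A \<subseteq> B"
      then obtain S where "S \<in> \<C>" "A \<in> S" by blast
      then have "B \<in> S" using sub[of S] \<open>A \<subseteq> B\<close> unfolding \<F>_def by blast
      then show "B \<in> \<Union>\<C>" using \<open>S \<in> \<C>\<close> by blast
    qed
    moreover have "\<forall>A\<in>\<Union>\<C>. \<forall>b\<in>C. A \<inter> b \<noteq> {}"
    proof (intro ballI)
      fix A b assume "A \<in> \<Union>\<C>" "b \<in> C"
      then obtain S where "S \<in> \<C>" "A \<in> S" by blast
      then show "A \<inter> b \<noteq> {}" using sub[of S] \<open>b \<in> C\<close> unfolding \<F>_def by blast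
    qed
    ultimately show "\<Union>\<C> \<in> \<F>" unfolding \<F>_def by blast
  qed
  then obtain S where S: "S \<in> \<F>" and max: "\<And>X. X \<in> \<F> \<Longrightarrow> S \<subseteq> X \<Longrightarrow> X = S" by blast
  have S_facts: "\<U> \<subseteq> S" "UNIV \<in> S" "\<And>A B. A \<in> S \<Longrightarrow> B \<in> S \<Longrightarrow> A \<inter> B \<in> S"
    "\<And>A b. A \<in> S \<Longrightarrow> b \<in> C \<Longrightarrow> A \<inter> b \<noteq> {}"
    using S unfolding \<F>_def by blast+
  have max': "\<exists>b\<in>C. \<exists>Z\<in>S. b \<inter> A \<inter> Z = {}" if A: "A \<notin> S" for A
  proof (rule ccontr)
    assume no: "\<not> ?thesis"
    \<comment> \<open>The filter generated by \<open>S\<close> and \<open>A\<close>; the negated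
      claim is exactly its positivity.\<close>
    define X where "X = {B. \<exists>Z\<in>S. Z \<inter> A \<subseteq> B}"
    have SX: "S \<subseteq> X" by (auto simp: X_def)
    have X_Int: "B \<inter> B' \<in> X" if BB: "B \<in> X" "B' \<in> X" for B B'
    proof -
      obtain Z Z' where "Z \<in> S" "Z' \<in> S" "Z \<inter> A \<subseteq> B" "Z' \<inter> A \<subseteq> B'" using BB by (auto simp: X_def)
      then show ?thesis using S_facts(3)[of Z Z'] by (auto simp: X_def intro!: bexI[of _ "Z \<inter> Z'"])
    qed
    have X_pos: "B \<inter> b \<noteq> {}" if Bb: "B \<in> X" "b \<in> C" for B b
    proof -
      obtain Z where Z: "Z \<in> S" "Z \<inter> A \<subseteq> B" using Bb by (auto simp: X_def)
      then have "b \<inter> A \<inter> Z \<noteq> {}" using no Bb by blast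
      then show ?thesis using Z by blast
    qed
    have X_mono: "\<forall>B\<in>X. \<forall>B'. B \<subseteq> B' \<longrightarrow> B' \<in> X" unfolding X_def by blast
    have "\<U> \<subseteq> X" "UNIV \<in> X" using SX S_facts(1,2) by auto
    then have "X \<in> \<F>" using X_mono by (simp add: \<F>_def X_Int X_pos)
    then have "X = S" using max SX by blast
    moreover have "A \<in> X" using S_facts(2) by (auto simp: X_def)
    ultimately show False using A by simp
  qed
  show thesis
    by (rule that[OF S_facts(1)]) (unfold_locales, (fact S_facts max')+)
qed

lemma ultrafilter_extends:
  fixes \<U> :: "'a set set"
  assumes "\<U> \<noteq> {}" "\<And>A B. A \<in> \<U> \<Longrightarrow> B \<in> \<U> \<Longrightarrow> A \<inter> B \<in> \<U>" "{} \<notin> \<U>"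
  obtains W where "\<U> \<subseteq> W" "ultrafilter W"
proof (rule positive_filter_exists[OF assms(1,2), of "{UNIV}"])
  show "A \<inter> b \<noteq> {}" if "A \<in> \<U>" "b \<in> {UNIV}" for A b using that assms(3) by auto
next
  fix W assume sub: "\<U> \<subseteq> W" and "positive_filter {UNIV} W"
  then interpret positive_filter "{UNIV}" W by simp
  have max: "\<exists>Z\<in>W. A \<inter> Z = {}" if "A \<notin> W" for A
    using S_max[OF that] by simp
  have empty: "{} \<notin> W" using S_pos[of "{}" UNIV] by auto
  moreover have mono: "B \<in> W" if AB: "A \<in> W" "A \<subseteq> B" for A B
  proof (rule ccontr)
    assume "B \<notin> W"
    then obtain Z where "Z \<in> W" "B \<inter> Z = {}" using max by blast
    then have "A \<inter> Z = {}" using AB(2) by blast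
    then show False using S_Int[OF AB(1) \<open>Z \<in> W\<close>] empty by simp
  qed
  moreover have "- A \<in> W" if A: "A \<notin> W" for A
  proof -
    obtain Z where "Z \<in> W" "A \<inter> Z = {}" using max[OF A] by blast
    then show ?thesis by (intro mono[of Z "- A"]) auto
  qed
  ultimately have "ultrafilter W" unfolding ultrafilter_def using S_UNIV S_Int by blast
  then show thesis by (rule that[OF sub])
qed

lemma ultrafilter_not_empty: "ultrafilter W \<Longrightarrow> {} \<notin> W"
  and ultrafilter_UNIV: "ultrafilter W \<Longrightarrow> UNIV \<in> W"
  and ultrafilter_Int: "ultrafilter W \<Longrightarrow> A \<in> W \<Longrightarrow> B \<in> W \<Longrightarrow> A \<inter> B \<in> W"
  and ultrafilter_mono: "ultrafilter W \<Longrightarrow> A \<in> W \<Longrightarrow> A \<subseteq> B \<Longrightarrow> B \<in> W"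
  and ultrafilter_Compl: "ultrafilter W \<Longrightarrow> A \<in> W \<or> - A \<in> W"
  unfolding ultrafilter_def by blast+

section \<open>An independent family of functions indexed by the reals\<close>

text \<open>The number \<open>n\<close> codes a finite list of pairs, read as a step function on the
  reals with jumps at rationals, and \<open>coord x n\<close> is its value at \<open>x\<close>.
  There are countably many such step functions, yet they take arbitrary values at any finitely many
  points.\<close>

definition coord :: "real \<Rightarrow> nat \<Rightarrow> nat" where
  "coord x n = (case find (\<lambda>(q, k). x < of_rat q) (from_nat n :: (rat \<times> nat) list) of
     Some (q, k) \<Rightarrow> k | None \<Rightarrow> 0)"

text \<open>A new least point \<open>b\<close> is treated by putting \<open>(q, s b)\<close> in
  front of the list, with \<open>q\<close> above \<open>b\<close> and below all other points: this
  pair answers for \<open>b\<close> alone.\<close>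

lemma coord_independent:
  assumes "finite F"
  shows "\<exists>n. \<forall>x\<in>F. coord x n = s x"
proof -
  have "\<exists>l :: (rat \<times> nat) list. \<forall>x\<in>F. \<exists>q. find (\<lambda>(q, k). x < of_rat q) l = Some (q, s x)"
    using assms
  proof (induction rule: finite_linorder_min_induct)
    case (insert b A)
    then obtain l :: "(rat \<times> nat) list" where
      l: "\<forall>x\<in>A. \<exists>q. find (\<lambda>(q, k). x < of_rat q) l = Some (q, s x)" by blast
    have "\<exists>c>b. \<forall>x\<in>A. c \<le> x"
    proof (cases "A = {}")
      case True
      then show ?thesis by (intro exI[of _ "b + 1"]) simp
    next
      case False
      then show ?thesis using insert by (intro exI[of _ "Min A"]) auto
    qed
    then obtain c where c: "b < c" "\<forall>x\<in>A. c \<le> x" by blast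
    obtain q :: rat where q: "b < of_rat q" "of_rat q < c" using of_rat_dense[OF c(1)] by blast
    have "\<exists>q'. find (\<lambda>(q, k). x < of_rat q) ((q, s b) # l) = Some (q', s x)"
      if x: "x \<in> insert b A" for x
    proof (cases "x = b")
      case False
      then have "x \<in> A" using x by auto
      then have "\<not> x < of_rat q" using c q by force
      then show ?thesis using l \<open>x \<in> A\<close> by simp
    qed (use q in simp)
    then show ?case by blast
  qed auto
  then obtain l :: "(rat \<times> nat) list" where
    l: "\<forall>x\<in>F. \<exists>q. find (\<lambda>(q, k). x < of_rat q) l = Some (q, s x)" by blast
  have "coord x (to_nat l) = s x" if x: "x \<in> F" for x
  proof -
    obtain q where "find (\<lambda>(q, k). x < of_rat q) l = Some (q, s x)" using l x by blast
    then show ?thesis by (simp add: coord_def)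
  qed
  then show ?thesis by blast
qed

text \<open>The basic clopen sets of a product of copies of \<nat> indexed by \<open>J\<close>,
  pulled back along \<open>coord\<close>; in other words the conditions of Cohen forcing.\<close>

definition cylinders :: "real set \<Rightarrow> nat set set" where
  "cylinders J = {{n. \<forall>x\<in>F. coord x n = s x} | F s. finite F \<and> F \<subseteq> J}"

lemma cylinders_ne: "b \<in> cylinders J \<Longrightarrow> b \<noteq> {}"
  using coord_independent unfolding cylinders_def by fastforce

lemma cylinders_UNIV: "UNIV \<in> cylinders J"
  unfolding cylinders_def by (auto intro!: exI[of _ "{}"])

lemma cylinders_mono: "J \<subseteq> K \<Longrightarrow> cylinders J \<subseteq> cylinders K"
  unfolding cylinders_def by blast

lemma cylinders_point: "x \<in> J \<Longrightarrow> {n. coord x n = k} \<in> cylinders J"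
  unfolding cylinders_def by (auto intro!: exI[of _ "{x}"] exI[of _ "\<lambda>_. k"])

lemma cylinders_Int:
  assumes "b \<in> cylinders J" "b' \<in> cylinders K" "b \<inter> b' \<noteq> {}"
  shows "b \<inter> b' \<in> cylinders (J \<union> K)"
proof -
  obtain F s G t where "finite F" "F \<subseteq> J" "finite G" "G \<subseteq> K"
    and b: "b = {n. \<forall>x\<in>F. coord x n = s x}" "b' = {n. \<forall>x\<in>G. coord x n = t x}"
    using assms unfolding cylinders_def by blast
  moreover obtain n where "n \<in> b" "n \<in> b'" using assms by blast
  then have "b \<inter> b' = {m. \<forall>x\<in>F \<union> G. coord x m = coord x n}" unfolding b by auto
  ultimately show ?thesis unfolding cylinders_def
    by (intro CollectI exI[of _ "F \<union> G"] exI[of _ "\<lambda>x. coord x n"]) auto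
qed

lemma cylinders_disjoint_support:
  assumes "b \<in> cylinders J" "b' \<in> cylinders K" "J \<inter> K = {}"
  shows "b \<inter> b' \<noteq> {}"
proof -
  obtain F s G t where F: "finite F" "F \<subseteq> J" "finite G" "G \<subseteq> K"
    and b: "b = {n. \<forall>x\<in>F. coord x n = s x}" "b' = {n. \<forall>x\<in>G. coord x n = t x}"
    using assms unfolding cylinders_def by blast
  obtain n where "\<forall>x\<in>F \<union> G. coord x n = (if x \<in> F then s x else t x)"
    using coord_independent[of "F \<union> G" "\<lambda>x. if x \<in> F then s x else t x"] F by auto
  then have "n \<in> b \<inter> b'" using F assms(3) unfolding b by auto
  then show ?thesis by blast
qed

section \<open>Sets decided by few coordinates\<close>

locale generic_filter = positive_filter "cylinders I" S for I :: "real set" and S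
begin

text \<open>Forcing terminology: modulo \<open>S\<close>, the condition \<open>b\<close> forces
  membership or non-membership in \<open>A\<close>.\<close>

definition decides :: "nat set \<Rightarrow> nat set \<Rightarrow> bool" where
  "decides b A \<longleftrightarrow> (\<exists>Z\<in>S. b \<inter> Z \<subseteq> A) \<or> (\<exists>Z\<in>S. b \<inter> Z \<inter> A = {})"

text \<open>The sets that depend, modulo \<open>S\<close>, on the coordinates in \<open>J\<close> only.\<close>

definition supported :: "real set \<Rightarrow> nat set set" where
  "supported J = {A. \<forall>b\<in>cylinders I. \<exists>b'\<in>cylinders J. b \<inter> b' \<noteq> {} \<and> decides b' A}"

lemma decides_Compl: "decides b A \<Longrightarrow> decides b (- A)"
  unfolding decides_def by blast

lemma decides_antimono:
  assumes "decides b A" "b' \<subseteq> b" shows "decides b' A"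
proof -
  consider Z where "Z \<in> S" "b \<inter> Z \<subseteq> A" | Z where "Z \<in> S" "b \<inter> Z \<inter> A = {}"
    using assms(1) unfolding decides_def by blast
  then show ?thesis unfolding decides_def by cases (use assms(2) in blast)+
qed

lemma decides_Int:
  assumes "decides b A" "decides b B" shows "decides b (A \<inter> B)"
proof -
  consider Z Z' where "Z \<in> S" "Z' \<in> S" "b \<inter> Z \<subseteq> A" "b \<inter> Z' \<subseteq> B"
    | Z where "Z \<in> S" "b \<inter> Z \<inter> A = {}" | Z where "Z \<in> S" "b \<inter> Z \<inter> B = {}"
    using assms unfolding decides_def by blast
  then show ?thesis
  proof cases
    case 1
    then have "Z \<inter> Z' \<in> S" "b \<inter> (Z \<inter> Z') \<subseteq> A \<inter> B" using S_Int by auto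
    then show ?thesis unfolding decides_def by blast
  qed (auto simp: decides_def)
qed

lemma supported_mono: "J \<subseteq> K \<Longrightarrow> supported J \<subseteq> supported K"
  unfolding supported_def using cylinders_mono[of J K] by blast

lemma supported_Compl: "A \<in> supported J \<Longrightarrow> - A \<in> supported J"
  unfolding supported_def using decides_Compl by blast

lemma supported_Int:
  assumes J: "J \<subseteq> I" and AB: "A \<in> supported J" "B \<in> supported J"
  shows "A \<inter> B \<in> supported J"
  unfolding supported_def
proof (intro CollectI ballI)
  fix b assume b: "b \<in> cylinders I"
  obtain b1 where b1: "b1 \<in> cylinders J" "b \<inter> b1 \<noteq> {}" "decides b1 A"
    using AB(1) b unfolding supported_def by blast
  have "b \<inter> b1 \<in> cylinders I" using cylinders_Int[OF b b1(1,2)] J by (simp add: sup.absorb1)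
  then obtain b2 where b2: "b2 \<in> cylinders J" "b \<inter> b1 \<inter> b2 \<noteq> {}" "decides b2 B"
    using AB(2) unfolding supported_def by blast
  have "b1 \<inter> b2 \<in> cylinders J" using cylinders_Int[OF b1(1) b2(1)] b2(2) by auto
  moreover have "decides (b1 \<inter> b2) (A \<inter> B)"
    using b1(3) b2(3) by (intro decides_Int) (auto elim: decides_antimono)
  moreover have "b \<inter> (b1 \<inter> b2) \<noteq> {}" using b2(2) by (simp add: Int_assoc)
  ultimately show "\<exists>b'\<in>cylinders J. b \<inter> b' \<noteq> {} \<and> decides b' (A \<inter> B)"
    by (intro bexI[of _ "b1 \<inter> b2"] conjI)
qed

lemma S_supported: "A \<in> S \<Longrightarrow> A \<in> supported J"
  unfolding supported_def decides_def using cylinders_UNIV[of J] cylinders_ne by blast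

lemma supported_coordinate:
  assumes "x \<in> J" shows "{n. P (coord x n)} \<in> supported J"
  unfolding supported_def
proof (intro CollectI ballI)
  fix b assume "b \<in> cylinders I"
  then obtain n where n: "n \<in> b" using cylinders_ne by blast
  have "decides {m. coord x m = coord x n} {n. P (coord x n)}"
    unfolding decides_def by (cases "P (coord x n)") (use S_UNIV in auto)
  moreover have "b \<inter> {m. coord x m = coord x n} \<noteq> {}" using n by auto
  ultimately show "\<exists>b'\<in>cylinders J. b \<inter> b' \<noteq> {} \<and> decides b' {n. P (coord x n)}"
    using assms by (intro bexI[of _ "{m. coord x m = coord x n}"] conjI cylinders_point)
qed

text \<open>Once a cylinder fixes \<open>coord x\<close> to a number \<open>k\<close>, the
  comparison with \<open>f\<close> becomes the set \<open>{n. k \<le> f n}\<close>, which is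
  supported by \<open>J\<close>.\<close>

lemma supported_le:
  assumes J: "J \<subseteq> I" "x \<in> I" and f: "\<And>k. {n. k \<le> f n} \<in> supported J"
  shows "{n. coord x n \<le> f n} \<in> supported (insert x J)"
  unfolding supported_def
proof (intro CollectI ballI)
  fix b assume b: "b \<in> cylinders I"
  then obtain n where n: "n \<in> b" using cylinders_ne by blast
  define b0 where "b0 = {m. coord x m = coord x n}"
  have b0: "b0 \<in> cylinders {x}" unfolding b0_def by (rule cylinders_point) simp
  have "b \<inter> b0 \<noteq> {}" using n by (auto simp: b0_def)
  then have "b \<inter> b0 \<in> cylinders (I \<union> {x})" using cylinders_Int b b0 by blast
  then have "b \<inter> b0 \<in> cylinders I" using J by (simp add: insert_absorb)
  then obtain b1 where b1: "b1 \<in> cylinders J" "b \<inter> b0 \<inter> b1 \<noteq> {}" "decides b1 {m. coord x n \<le> f m}"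
    using f[of "coord x n"] unfolding supported_def by blast
  have "b0 \<inter> b1 \<in> cylinders (insert x J)" using cylinders_Int[OF b0 b1(1)] b1(2) by auto
  moreover have "decides (b0 \<inter> b1) {m. coord x n \<le> f m}"
    using b1(3) by (auto elim: decides_antimono)
  then have "decides (b0 \<inter> b1) {m. coord x m \<le> f m}"
    unfolding decides_def b0_def by (simp add: subset_iff disjoint_iff)
  moreover have "b \<inter> (b0 \<inter> b1) \<noteq> {}" using b1(2) by (simp add: Int_assoc)
  ultimately show "\<exists>b'\<in>cylinders (insert x J). b \<inter> b' \<noteq> {} \<and> decides b' {m. coord x m \<le> f m}"
    by (intro bexI[of _ "b0 \<inter> b1"] conjI)
qed

text \<open>Product genericity. By maximality a positive \<open>A\<close> contains a cylinder modulo
  \<open>S\<close>; since \<open>A\<close> depends on \<open>J\<close>, a cylinder over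
  \<open>J\<close> can be found there, and independence makes it compatible with every cylinder over
  a disjoint \<open>K\<close>.\<close>

lemma positive_Int_cylinder:
  assumes J: "J \<subseteq> I" "K \<subseteq> I" "J \<inter> K = {}" and b: "b \<in> cylinders K"
    and A: "A \<in> supported J" "\<And>Z. Z \<in> S \<Longrightarrow> A \<inter> Z \<noteq> {}" and Z: "Z \<in> S"
  shows "A \<inter> b \<inter> Z \<noteq> {}"
proof -
  have "- A \<notin> S" using A(2)[of "- A"] by auto
  then obtain b0 Z0 where b0: "b0 \<in> cylinders I" "Z0 \<in> S" "b0 \<inter> - A \<inter> Z0 = {}"
    using S_max by blast
  then obtain b1 where b1: "b1 \<in> cylinders J" "b0 \<inter> b1 \<noteq> {}" "decides b1 A"
    using A(1) unfolding supported_def by blast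
  have b01: "b0 \<inter> b1 \<in> cylinders I"
    using cylinders_Int[OF b0(1) b1(1,2)] J by (simp add: sup.absorb1)
  \<comment> \<open>\<open>b1\<close> cannot decide against \<open>A\<close>, since
    \<open>b0 \<inter> b1\<close> is a cylinder contained in \<open>A\<close> modulo
    \<open>S\<close>.\<close>
  have "\<not> (\<exists>Z\<in>S. b1 \<inter> Z \<inter> A = {})"
  proof
    assume "\<exists>Z\<in>S. b1 \<inter> Z \<inter> A = {}"
    then obtain Z1 where "Z1 \<in> S" "b1 \<inter> Z1 \<inter> A = {}" by blast
    moreover from this have "(Z0 \<inter> Z1) \<inter> (b0 \<inter> b1) \<noteq> {}"
      using b0(2) b01 by (intro S_pos S_Int)
    ultimately show False using b0(3) by blast
  qed
  then obtain Z1 where Z1: "Z1 \<in> S" "b1 \<inter> Z1 \<subseteq> A" using b1(3) unfolding decides_def by blast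
  have "b1 \<inter> b \<in> cylinders (J \<union> K)"
    using b b1(1) J(3) by (intro cylinders_Int cylinders_disjoint_support) auto
  then have "b1 \<inter> b \<in> cylinders I" using cylinders_mono J by (meson Un_least subsetD)
  then have "(Z \<inter> Z1) \<inter> (b1 \<inter> b) \<noteq> {}" using Z Z1(1) by (intro S_pos S_Int)
  then show ?thesis using Z1(2) by blast
qed

text \<open>As the underlying set \<open>\<nat>\<close> is countable, countably many deciding cylinders suffice; this
  replaces the countable chain condition.\<close>

lemma countably_supported: "\<exists>J\<subseteq>I. countable J \<and> A \<in> supported J"
proof -
  \<comment> \<open>For each possible \<open>n\<close> one deciding cylinder through
    \<open>n\<close> is chosen; the finite supports of these countably many cylinders make up
    \<open>J\<close>.\<close>
  define good where "good n b \<longleftrightarrow> b \<in> cylinders I \<and> decides b A \<and> n \<in> b" for n b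
  define N where "N = {n. \<exists>b. good n b}"
  have "\<exists>F\<subseteq>I. finite F \<and> (\<exists>b\<in>cylinders F. good n b)" if n: "n \<in> N" for n
  proof -
    obtain b where b: "good n b" using n by (auto simp: N_def)
    then obtain F s where "finite F" "F \<subseteq> I" "b = {n. \<forall>x\<in>F. coord x n = s x}"
      unfolding good_def cylinders_def by blast
    then have "b \<in> cylinders F" unfolding cylinders_def by blast
    then show ?thesis using b \<open>finite F\<close> \<open>F \<subseteq> I\<close> by blast
  qed
  then obtain F where F: "\<And>n. n \<in> N \<Longrightarrow> F n \<subseteq> I" "\<And>n. n \<in> N \<Longrightarrow> finite (F n)"
    "\<And>n. n \<in> N \<Longrightarrow> \<exists>b\<in>cylinders (F n). good n b" by metis
  define J where "J = (\<Union>n\<in>N. F n)"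
  have "countable J" unfolding J_def using F by (intro countable_UN) (auto intro: countable_finite)
  moreover have "J \<subseteq> I" using F by (auto simp: J_def)
  moreover have "A \<in> supported J"
    unfolding supported_def
  proof (intro CollectI ballI)
    fix b assume b: "b \<in> cylinders I"
    \<comment> \<open>If \<open>b\<close> does not decide \<open>A\<close>, then
      \<open>b \<inter> A\<close> is positive, so maximality yields a cylinder inside it modulo
      \<open>S\<close>.\<close>
    have "\<exists>b1\<in>cylinders I. b1 \<subseteq> b \<and> decides b1 A"
    proof (cases "decides b A")
      case False
      have "- (b \<inter> A) \<notin> S"
      proof
        assume "- (b \<inter> A) \<in> S"
        moreover have "b \<inter> - (b \<inter> A) \<inter> A = {}" by blast
        ultimately show False using False unfolding decides_def by blast
      qed
      then obtain b0 Z where b0: "b0 \<in> cylinders I" "Z \<in> S" "b0 \<inter> - (b \<inter> A) \<inter> Z = {}"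
        using S_max by blast
      moreover have "Z \<inter> b0 \<noteq> {}" using S_pos b0 by blast
      ultimately have "b0 \<inter> b \<noteq> {}" by blast
      then have "b0 \<inter> b \<in> cylinders I" using cylinders_Int[OF b0(1) b] by simp
      moreover have "b0 \<inter> b \<inter> Z \<subseteq> A" using b0(3) by blast
      then have "decides (b0 \<inter> b) A" using b0(2) unfolding decides_def by blast
      ultimately show ?thesis by (intro bexI[of _ "b0 \<inter> b"] conjI) auto
    qed (use b in auto)
    then obtain b1 where b1: "b1 \<in> cylinders I" "b1 \<subseteq> b" "decides b1 A" by blast
    then obtain n where n: "n \<in> b1" using cylinders_ne by blast
    then have "n \<in> N" using b1 by (auto simp: N_def good_def)
    \<comment> \<open>The chosen cylinder may differ from \<open>b1\<close>, but it passes through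
      \<open>n\<close>, a point of \<open>b\<close>, and so meets \<open>b\<close>.\<close>
    then obtain b' where "b' \<in> cylinders (F n)" "good n b'" using F(3) by blast
    moreover have "cylinders (F n) \<subseteq> cylinders J"
      using \<open>n \<in> N\<close> by (intro cylinders_mono) (auto simp: J_def)
    ultimately show "\<exists>b'\<in>cylinders J. b \<inter> b' \<noteq> {} \<and> decides b' A"
      using n b1(2) unfolding good_def by (intro bexI[of _ b']) auto
  qed
  ultimately show ?thesis by blast
qed

end

section \<open>A tower of ultrafilters along a well-order\<close>

text \<open>The clause \<open>bounded\<close> is uncountable cofinality without a last element. It
  puts every subset of \<nat>, having countable support, at some stage.\<close>

locale generic_tower = generic_filter I S for I S +
  fixes r :: "real rel"
  assumes wo: "Well_order r" and Field: "Field r = I"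
    and bounded: "\<And>J. J \<subseteq> I \<Longrightarrow> countable J \<Longrightarrow> \<exists>x\<in>I. J \<subseteq> underS r x"
begin

lemma wo_rel: "wo_rel r" using wo by (simp add: wo_rel_def)

lemma underS_subset: "y \<in> underS r x \<Longrightarrow> underS r y \<subseteq> underS r x"
  using wo_rel.TRANS[OF wo_rel] wo_rel.ANTISYM[OF wo_rel]
  by (intro underS_incr) (auto simp: underS_def)

lemma underS_I: "underS r x \<subseteq> I"
  using Field by (auto simp: underS_def Field_def)

lemma underS_cases:
  assumes "x \<in> I" "y \<in> I"
  obtains "x = y" | "x \<in> underS r y" | "y \<in> underS r x"
  using wo_rel.TOTAL[OF wo_rel] assms Field by (auto simp: total_on_def underS_def)

definition below :: "real \<Rightarrow> nat set set" where
  "below x = supported (underS r x)"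

definition up_to :: "real \<Rightarrow> nat set set" where
  "up_to x = supported (insert x (underS r x))"

text \<open>The filter forcing the coordinate \<open>y\<close> to be infinite, but smaller than every infinite
  function below \<open>y\<close> in the sense of the ultrafilter \<open>E\<close>.\<close>

definition forced :: "nat set set \<Rightarrow> real \<Rightarrow> nat set set" where
  "forced E y = {R. \<exists>k0. \<forall>k\<ge>k0. \<exists>B\<in>E \<inter> below y. \<exists>Z\<in>S. B \<inter> Z \<inter> {n. coord y n = k} \<subseteq> R}"

lemma below_Int: "A \<in> below x \<Longrightarrow> B \<in> below x \<Longrightarrow> A \<inter> B \<in> below x"
  unfolding below_def by (rule supported_Int[OF underS_I])

lemma up_to_Int: "x \<in> I \<Longrightarrow> A \<in> up_to x \<Longrightarrow> B \<in> up_to x \<Longrightarrow> A \<inter> B \<in> up_to x"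
  unfolding up_to_def by (rule supported_Int) (use underS_I in auto)

lemma below_up_to: "below x \<subseteq> up_to x"
  unfolding below_def up_to_def by (rule supported_mono) auto

lemma up_to_below: "y \<in> underS r x \<Longrightarrow> up_to y \<subseteq> below x"
  unfolding below_def up_to_def using underS_subset by (intro supported_mono) auto

lemma S_below: "A \<in> S \<Longrightarrow> A \<in> below x" and S_up_to: "A \<in> S \<Longrightarrow> A \<in> up_to x"
  unfolding below_def up_to_def by (simp_all add: S_supported)

lemma forced_Int:
  assumes E: "ultrafilter E" and R: "R \<in> forced E y" "R' \<in> forced E y"
  shows "R \<inter> R' \<in> forced E y"
proof -
  obtain k0 where k0: "\<And>k. k \<ge> k0 \<Longrightarrow> \<exists>B\<in>E \<inter> below y. \<exists>Z\<in>S. B \<inter> Z \<inter> {n. coord y n = k} \<subseteq> R"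
    using R(1) unfolding forced_def by blast
  obtain k1 where k1: "\<And>k. k \<ge> k1 \<Longrightarrow> \<exists>B\<in>E \<inter> below y. \<exists>Z\<in>S. B \<inter> Z \<inter> {n. coord y n = k} \<subseteq> R'"
    using R(2) unfolding forced_def by blast
  have "\<exists>B\<in>E \<inter> below y. \<exists>Z\<in>S. B \<inter> Z \<inter> {n. coord y n = k} \<subseteq> R \<inter> R'" if k: "k \<ge> max k0 k1" for k
  proof -
    obtain B Z where B: "B \<in> E" "B \<in> below y" "Z \<in> S" "B \<inter> Z \<inter> {n. coord y n = k} \<subseteq> R"
      using k0[of k] k by auto
    obtain B' Z' where B': "B' \<in> E" "B' \<in> below y" "Z' \<in> S" "B' \<inter> Z' \<inter> {n. coord y n = k} \<subseteq> R'"
      using k1[of k] k by auto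
    have "B \<inter> B' \<in> E \<inter> below y" "Z \<inter> Z' \<in> S"
      using B B' by (simp_all add: ultrafilter_Int[OF E] below_Int S_Int)
    moreover have "(B \<inter> B') \<inter> (Z \<inter> Z') \<inter> {n. coord y n = k} \<subseteq> R \<inter> R'"
      using B(4) B'(4) by blast
    ultimately show ?thesis by (intro bexI[of _ "B \<inter> B'"] bexI[of _ "Z \<inter> Z'"])
  qed
  then show ?thesis unfolding forced_def by blast
qed

text \<open>\<open>B\<close> depends on earlier coordinates and is positive because \<open>E\<close>
  extends \<open>S\<close>, while \<open>{n. coord y n = k}\<close> concerns \<open>y\<close> alone;
  by independence they meet inside every member of \<open>S\<close>.\<close>

lemma forced_not_empty:
  assumes E: "ultrafilter E" "S \<subseteq> E" and y: "y \<in> I"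
  shows "{} \<notin> forced E y"
proof
  assume "{} \<in> forced E y"
  then obtain k B Z where B: "B \<in> E" "B \<in> below y" "Z \<in> S" "B \<inter> Z \<inter> {n. coord y n = k} \<subseteq> {}"
    unfolding forced_def by blast
  have "B \<inter> {n. coord y n = k} \<inter> Z \<noteq> {}"
  proof (rule positive_Int_cylinder)
    show "underS r y \<subseteq> I" by (rule underS_I)
    show "{y} \<subseteq> I" using y by simp
    show "underS r y \<inter> {y} = {}" by (auto simp: underS_def)
    show "{n. coord y n = k} \<in> cylinders {y}" by (rule cylinders_point) simp
    show "B \<in> supported (underS r y)" using B(2) by (simp add: below_def)
    show "Z \<in> S" by (rule B(3))
    show "B \<inter> Z' \<noteq> {}" if "Z' \<in> S" for Z'
      using ultrafilter_Int[OF E(1) B(1), of Z'] ultrafilter_not_empty[OF E(1)] E(2) that by force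
  qed
  then show False using B(4) by blast
qed

lemma below_forced:
  assumes "B \<in> E" "B \<in> below y" shows "B \<in> forced E y"
proof -
  have "B \<inter> UNIV \<inter> {n. coord y n = k} \<subseteq> B" for k by auto
  then show ?thesis unfolding forced_def using assms S_UNIV by blast
qed

lemma infinite_forced:
  assumes "ultrafilter E" shows "{n. k < coord y n} \<in> forced E y"
proof -
  have "UNIV \<inter> UNIV \<inter> {n. coord y n = k'} \<subseteq> {n. k < coord y n}" if "k' \<ge> Suc k" for k'
    using that by auto
  then show ?thesis
    unfolding forced_def using S_UNIV S_below[OF S_UNIV, of y] ultrafilter_UNIV[OF assms] by blast
qed

text \<open>At the value \<open>k\<close> the witness is \<open>{n. k \<le> f n}\<close>. This is
  why \<open>forced\<close> lets \<open>B\<close> vary with \<open>k\<close>.\<close>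

lemma le_forced:
  assumes "\<And>k. {n. k \<le> f n} \<in> E \<inter> below y" shows "{n. coord y n \<le> f n} \<in> forced E y"
proof -
  have "{n. k \<le> f n} \<inter> UNIV \<inter> {n. coord y n = k} \<subseteq> {n. coord y n \<le> f n}" for k
    by auto
  then show ?thesis
    unfolding forced_def using S_UNIV assms by blast
qed

text \<open>Each \<open>E x\<close> is an ultrafilter of subsets of \<nat> rather than of a stage
  algebra, so that the plain extension theorem provides it; coherence between stages is asked of the
  sets in \<open>up_to y\<close>.\<close>

lemma tower_exists:
  "\<exists>E. \<forall>x. ultrafilter (E x) \<and> S \<subseteq> E x \<and> (\<forall>y\<in>underS r x. forced (E y) y \<inter> up_to y \<subseteq> E x)"
proof (rule dependent_wf_choice[OF wo_rel.WF[OF wo_rel]])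
  fix E E' :: "real \<Rightarrow> nat set set" and x W
  assume "\<And>z. (z, x) \<in> r - Id \<Longrightarrow> E z = E' z"
  then have "E y = E' y" if "y \<in> underS r x" for y using that by (auto simp: underS_def)
  then show "(ultrafilter W \<and> S \<subseteq> W \<and> (\<forall>y\<in>underS r x. forced (E y) y \<inter> up_to y \<subseteq> W)) =
             (ultrafilter W \<and> S \<subseteq> W \<and> (\<forall>y\<in>underS r x. forced (E' y) y \<inter> up_to y \<subseteq> W))" by simp
next
  fix x and E :: "real \<Rightarrow> nat set set"
  assume "\<And>y. (y, x) \<in> r - Id \<Longrightarrow> ultrafilter (E y) \<and> S \<subseteq> E y \<and>
    (\<forall>z\<in>underS r y. forced (E z) z \<inter> up_to z \<subseteq> E y)"
  then have IH: "ultrafilter (E y)" "S \<subseteq> E y" "\<And>z. z \<in> underS r y \<Longrightarrow> forced (E z) z \<inter> up_to z \<subseteq> E y"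
    if "y \<in> underS r x" for y using that by (auto simp: underS_def)
  define G where "G y = forced (E y) y \<inter> up_to y" for y
  have yI: "y \<in> I" if "y \<in> underS r x" for y using that underS_I by blast
  \<comment> \<open>What is forced at \<open>z\<close> is known below \<open>y\<close> and was put
    into \<open>E y\<close>, hence is forced again at \<open>y\<close>.\<close>
  have G_chain: "G z \<subseteq> G y" if "z \<in> underS r y" "y \<in> underS r x" for y z
  proof
    fix A assume A: "A \<in> G z"
    then have "A \<in> E y" using IH(3)[OF that(2,1)] by (auto simp: G_def)
    moreover have "A \<in> below y" using A up_to_below[OF that(1)] by (auto simp: G_def)
    ultimately show "A \<in> G y" using below_forced[of A] below_up_to[of y] by (auto simp: G_def)
  qed
  have S_G: "S \<subseteq> G y" if "y \<in> underS r x" for y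
    using IH(2)[OF that] S_below S_up_to by (auto simp: G_def intro: below_forced)
  have G_Int: "A \<inter> B \<in> G y" if "A \<in> G y" "B \<in> G y" "y \<in> underS r x" for A B y
    using that forced_Int[OF IH(1)] up_to_Int[OF yI] by (auto simp: G_def)
  define \<U> where "\<U> = S \<union> (\<Union>y\<in>underS r x. G y)"
  have cases: "A \<in> S \<and> B \<in> S \<or> (\<exists>y\<in>underS r x. A \<in> G y \<and> B \<in> G y)"
    if AB: "A \<in> \<U>" "B \<in> \<U>" for A B
  proof (cases "A \<in> S \<or> B \<in> S")
    case True
    then show ?thesis using AB S_G unfolding \<U>_def by blast
  next
    case False
    then obtain y z where yz: "y \<in> underS r x" "A \<in> G y" "z \<in> underS r x" "B \<in> G z"
      using AB unfolding \<U>_def by blast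
    show ?thesis
    proof (rule underS_cases[of y z])
      show "y \<in> I" "z \<in> I" using yz yI by auto
    next
      assume "y = z" then show ?thesis using yz by blast
    next
      assume "y \<in> underS r z" then show ?thesis using yz G_chain by blast
    next
      assume "z \<in> underS r y" then show ?thesis using yz G_chain by blast
    qed
  qed
  have "\<exists>W. \<U> \<subseteq> W \<and> ultrafilter W"
  proof (rule ultrafilter_extends[of \<U>])
    show "\<U> \<noteq> {}" using S_UNIV by (auto simp: \<U>_def)
    show "A \<inter> B \<in> \<U>" if AB: "A \<in> \<U>" "B \<in> \<U>" for A B
    proof (cases "A \<in> S \<and> B \<in> S")
      case True
      then show ?thesis by (simp add: \<U>_def S_Int)
    next
      case False
      then obtain y where y: "y \<in> underS r x" "A \<in> G y" "B \<in> G y" using cases[OF AB] by blast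
      then have "A \<inter> B \<in> G y" by (intro G_Int)
      then show ?thesis using y(1) by (auto simp: \<U>_def)
    qed
    have "{} \<notin> S" using S_pos[of "{}" UNIV] cylinders_UNIV by blast
    moreover have "{} \<notin> G y" if "y \<in> underS r x" for y
      using forced_not_empty IH(1,2)[OF that] yI[OF that] by (auto simp: G_def)
    ultimately show "{} \<notin> \<U>" by (auto simp: \<U>_def)
  qed auto
  then obtain W where W: "\<U> \<subseteq> W" "ultrafilter W" by blast
  have "S \<subseteq> W" using W(1) by (auto simp: \<U>_def)
  moreover have "forced (E y) y \<inter> up_to y \<subseteq> W" if "y \<in> underS r x" for y
    using W(1) that by (auto simp: \<U>_def G_def)
  ultimately show "\<exists>W. ultrafilter W \<and> S \<subseteq> W \<and> (\<forall>y\<in>underS r x. forced (E y) y \<inter> up_to y \<subseteq> W)"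
    using W(2) by blast
qed

text \<open>The parts \<open>E x \<inter> below x\<close> increase with \<open>x\<close>. Their
  union is an ultrafilter because each subset of \<nat> has countable support and is judged at some
  stage. Likewise the countably many sets \<open>{n. k \<le> f n}\<close> all appear by some stage
  \<open>z\<close>, and \<open>coord z\<close> was forced below \<open>f\<close>.\<close>

lemma tower_ultrafilter:
  obtains D where "nonprincipal_ultrafilter D"
    "\<And>x k. x \<in> I \<Longrightarrow> {n. k < coord x n} \<in> D"
    "\<And>f. (\<And>k. {n. k \<le> f n} \<in> D) \<Longrightarrow> \<exists>x\<in>I. {n. coord x n \<le> f n} \<in> D"
    "\<And>x y. y \<in> underS r x \<Longrightarrow> {n. coord x n \<le> coord y n} \<in> D"
proof -
  obtain E where E: "\<And>x. ultrafilter (E x)" "\<And>x. S \<subseteq> E x"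
    "\<And>x y. y \<in> underS r x \<Longrightarrow> forced (E y) y \<inter> up_to y \<subseteq> E x"
    using tower_exists by blast
  have bounded': "\<exists>z\<in>I. J \<subseteq> underS r z" if "finite J" "J \<subseteq> I" for J
    using that by (intro bounded) (auto intro: countable_finite)
  have E_mono: "A \<in> E x \<inter> below x" if "A \<in> E y \<inter> below y" "y \<in> underS r x" for A x y
    using that E(3) up_to_below below_up_to below_forced by blast
  have forced_E: "A \<in> E x \<inter> below x" if "A \<in> forced (E y) y" "A \<in> up_to y" "y \<in> underS r x" for A x y
    using that E(3) up_to_below by blast
  define D where "D = (\<Union>x\<in>I. E x \<inter> below x)"
  have forced_D: "A \<in> D" if A: "A \<in> forced (E y) y" "A \<in> up_to y" "y \<in> I" for A y
  proof -
    obtain x where "x \<in> I" "y \<in> underS r x" using bounded'[of "{y}"] A by auto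
    then show ?thesis using forced_E A unfolding D_def by blast
  qed
  have le_D: "{n. coord y n \<le> f n} \<in> D" if f: "\<And>k. {n. k \<le> f n} \<in> E y \<inter> below y" and y: "y \<in> I" for f y
  proof (rule forced_D)
    show "{n. coord y n \<le> f n} \<in> forced (E y) y" by (rule le_forced[OF f])
    show "{n. coord y n \<le> f n} \<in> up_to y"
      using f y underS_I unfolding up_to_def below_def by (intro supported_le) auto
  qed (rule y)
  have below_all: "\<exists>x\<in>I. A \<in> below x" for A
  proof -
    obtain J where J: "J \<subseteq> I" "countable J" "A \<in> supported J" using countably_supported by blast
    then obtain x where "x \<in> I" "J \<subseteq> underS r x" using bounded by blast
    then show ?thesis using J(3) supported_mono unfolding below_def by blast
  qed
  have "ultrafilter D"
    unfolding ultrafilter_def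
  proof (intro conjI ballI allI impI)
    obtain x where "x \<in> I" using bounded'[of "{}"] by blast
    then show "UNIV \<in> D" using ultrafilter_UNIV[OF E(1)] S_below[OF S_UNIV] by (auto simp: D_def)
    show "{} \<notin> D" using ultrafilter_not_empty[OF E(1)] by (auto simp: D_def)
  next
    fix A B assume "A \<in> D" "B \<in> D"
    then obtain x y where xy: "x \<in> I" "y \<in> I" "A \<in> E x \<inter> below x" "B \<in> E y \<inter> below y"
      unfolding D_def by blast
    then obtain z where z: "z \<in> I" "x \<in> underS r z" "y \<in> underS r z" using bounded'[of "{x, y}"] by auto
    then have "A \<in> E z \<inter> below z" "B \<in> E z \<inter> below z" using xy E_mono by blast+
    then have "A \<inter> B \<in> E z \<inter> below z" using ultrafilter_Int[OF E(1)] below_Int by blast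
    then show "A \<inter> B \<in> D" using z(1) unfolding D_def by blast
  next
    fix A B assume "A \<in> D" "A \<subseteq> B"
    then obtain x where x: "x \<in> I" "A \<in> E x \<inter> below x" unfolding D_def by blast
    obtain y where y: "y \<in> I" "B \<in> below y" using below_all by blast
    obtain z where z: "z \<in> I" "x \<in> underS r z" "y \<in> underS r z"
      using bounded'[of "{x, y}"] x y by auto
    have "A \<in> E z" using E_mono x(2) z(2) by blast
    then have "B \<in> E z" using ultrafilter_mono[OF E(1)] \<open>A \<subseteq> B\<close> by blast
    moreover have "B \<in> below z" using y(2) below_up_to up_to_below[OF z(3)] by blast
    ultimately show "B \<in> D" using z(1) unfolding D_def by blast
  next
    fix A
    obtain x where x: "x \<in> I" "A \<in> below x" using below_all by blast
    moreover have "- A \<in> below x" using x(2) unfolding below_def by (rule supported_Compl)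
    ultimately show "A \<in> D \<or> - A \<in> D" using ultrafilter_Compl[OF E(1)] unfolding D_def by blast
  qed
  have inf_up_to: "{n. k < coord x n} \<in> up_to x" "{n. k \<le> coord x n} \<in> up_to x" for x k
    unfolding up_to_def by (rule supported_coordinate, simp)+
  have inf_D: "{n. k < coord x n} \<in> D" if "x \<in> I" for x k
    using infinite_forced[OF E(1)] inf_up_to(1) that by (rule forced_D)
  have "nonprincipal_ultrafilter D"
    unfolding nonprincipal_ultrafilter_def
  proof (intro conjI allI)
    fix a
    obtain x where "x \<in> I" using bounded'[of "{}"] by blast
    then have "{n. coord x a < coord x n} \<in> D" by (rule inf_D)
    then have "{a} \<inter> {n. coord x a < coord x n} \<in> D" if "{a} \<in> D"
      using ultrafilter_Int[OF \<open>ultrafilter D\<close> that] by blast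
    moreover have "{a} \<inter> {n. coord x a < coord x n} = {}" by auto
    ultimately show "{a} \<notin> D" using ultrafilter_not_empty[OF \<open>ultrafilter D\<close>] by auto
  qed (rule \<open>ultrafilter D\<close>)
  moreover have "\<exists>x\<in>I. {n. coord x n \<le> f n} \<in> D" if f: "\<And>k. {n. k \<le> f n} \<in> D" for f :: "nat \<Rightarrow> nat"
  proof -
    have "\<forall>k. \<exists>x. x \<in> I \<and> {n. k \<le> f n} \<in> E x \<inter> below x" using f unfolding D_def by blast
    then obtain c where c: "\<And>k. c k \<in> I" "\<And>k. {n. k \<le> f n} \<in> E (c k) \<inter> below (c k)" by metis
    have "range c \<subseteq> I" "countable (range c)" using c(1) by auto
    then obtain z where z: "z \<in> I" "range c \<subseteq> underS r z" using bounded by blast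
    have "{n. k \<le> f n} \<in> E z \<inter> below z" for k using c(2) by (rule E_mono) (use z(2) in auto)
    then show ?thesis using le_D z(1) by blast
  qed
  \<comment> \<open>The earlier coordinate is itself an infinite function known at stage
    \<open>x\<close>.\<close>
  moreover have "{n. coord x n \<le> coord y n} \<in> D" if xy: "y \<in> underS r x" for x y
  proof (rule le_D)
    show "x \<in> I" using xy Field underS_def[of r x] by (auto simp: Field_def)
    fix k
    \<comment> \<open>What was forced are strict bounds, hence \<open>k - 1\<close>; truncation at
      \<open>k = 0\<close> is harmless.\<close>
    have "{n. k \<le> coord y n} \<in> forced (E y) y"
      using infinite_forced[OF E(1), of "k - 1" y y] forced_Int
      unfolding forced_def by (fastforce simp: subset_iff)
    then show "{n. k \<le> coord y n} \<in> E x \<inter> below x" using inf_up_to(2) xy by (rule forced_E)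
  qed
  ultimately show thesis using that inf_D by blast
qed

end

section \<open>Regular index sets and the two ultrafilters\<close>

text \<open>Regularity of a successor cardinal: an unbounded \<open>J\<close> would exhibit
  \<open>I\<close> as \<open>J\<close> together with at most \<kappa> initial segments, each of size
  at most \<kappa>.\<close>

lemma card_bounded:
  assumes \<kappa>: "Card_order \<kappa>" "\<not> finite (Field \<kappa>)" and I: "|I| =o cardSuc \<kappa>"
    and J: "J \<subseteq> I" "|J| \<le>o \<kappa>"
  shows "\<exists>x\<in>I. J \<subseteq> underS |I| x"
proof (rule ccontr)
  assume no: "\<not> ?thesis"
  have wo: "wo_rel |I|" by (simp add: wo_rel_def card_of_Well_order)
  have F: "Field |I| = I" by (rule Field_card_of)
  have le: "|underS |I| x| \<le>o \<kappa>" if "x \<in> I" for x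
  proof -
    have "|underS |I| x| <o |I|" using that F by (intro card_of_underS card_of_Card_order) simp
    then have "|underS |I| x| <o cardSuc \<kappa>" using I by (rule ordLess_ordIso_trans)
    then show ?thesis by (rule cardSuc_ordLeq_ordLess[OF \<kappa>(1) card_of_Card_order, THEN iffD1])
  qed
  have "I \<subseteq> J \<union> (\<Union>j\<in>J. underS |I| j)"
  proof
    fix x assume x: "x \<in> I"
    then obtain j where "j \<in> J" "j \<notin> underS |I| x" using no by blast
    moreover from this have "j \<in> I" using J by blast
    ultimately have "x = j \<or> x \<in> underS |I| j"
      using x F wo_rel.TOTAL[OF wo] unfolding total_on_def underS_def by auto
    then show "x \<in> J \<union> (\<Union>j\<in>J. underS |I| j)" using \<open>j \<in> J\<close> by blast
  qed
  then have "|I| \<le>o |J \<union> (\<Union>j\<in>J. underS |I| j)|" by (rule card_of_mono1)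
  also have "|J \<union> (\<Union>j\<in>J. underS |I| j)| \<le>o \<kappa>"
    using J le by (intro card_of_Un_ordLeq_infinite_Field card_of_UNION_ordLeq_infinite_Field \<kappa>) auto
  finally have "cardSuc \<kappa> \<le>o \<kappa>" using I ordIso_ordLeq_trans ordIso_symmetric by blast
  then show False using cardSuc_greater[OF \<kappa>(1)] not_ordLess_ordLeq by blast
qed

text \<open>Later coordinates are smaller, so regularity of the index set turns into a lower bound
  for any \<kappa> of them. Together with coinitiality of the coordinates this fixes the
  coinitiality of the infinite functions as the successor of \<kappa>.\<close>

lemma tower_ultrafilter_exists:
  assumes \<kappa>: "Card_order \<kappa>" "natLeq \<le>o \<kappa>" "cardSuc \<kappa> \<le>o |UNIV :: real set|"
  obtains I :: "real set" and D where "nonprincipal_ultrafilter D" "|I| =o cardSuc \<kappa>"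
    "\<And>x k. x \<in> I \<Longrightarrow> {n. k < coord x n} \<in> D"
    "\<And>f. (\<And>k. {n. k \<le> f n} \<in> D) \<Longrightarrow> \<exists>x\<in>I. {n. coord x n \<le> f n} \<in> D"
    "\<And>J. J \<subseteq> I \<Longrightarrow> |J| \<le>o \<kappa> \<Longrightarrow> \<exists>x\<in>I. \<forall>y\<in>J. {n. coord x n \<le> coord y n} \<in> D"
proof -
  have "|Field (cardSuc \<kappa>)| \<le>o |UNIV :: real set|"
    using card_of_Field_ordIso[OF cardSuc_Card_order[OF \<kappa>(1)]] \<kappa>(3) ordIso_ordLeq_trans by blast
  then obtain g :: "_ \<Rightarrow> real" where g: "inj_on g (Field (cardSuc \<kappa>))"
    unfolding card_of_ordLeq[symmetric] by blast
  define I where "I = g ` Field (cardSuc \<kappa>)"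
  have "|I| =o |Field (cardSuc \<kappa>)|"
    unfolding I_def using g by (intro ordIso_symmetric[OF card_of_ordIso[THEN iffD1]])
      (auto simp: bij_betw_def)
  then have I: "|I| =o cardSuc \<kappa>"
    using card_of_Field_ordIso[OF cardSuc_Card_order[OF \<kappa>(1)]] ordIso_transitive by blast
  have inf: "\<not> finite (Field \<kappa>)"
    using \<kappa>(1,2) natLeq_ordLeq_cinfinite
    by (metis Field_natLeq card_of_Field_ordIso card_of_ordLeq_infinite card_of_mono2 infinite_UNIV_nat)
  obtain S where S: "positive_filter (cylinders I) S"
    by (rule positive_filter_exists[of "{UNIV}" "cylinders I"]) (use cylinders_ne in auto)
  interpret generic_tower I S "|I|"
  proof (intro generic_tower.intro generic_filter.intro generic_tower_axioms.intro S)
    show "\<exists>x\<in>I. J \<subseteq> underS |I| x" if "J \<subseteq> I" "countable J" for J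
    proof (rule card_bounded[OF \<kappa>(1) inf I])
      have "|J| \<le>o natLeq" using that(2) by (rule countable_card_le_natLeq[THEN iffD1])
      then show "|J| \<le>o \<kappa>" using \<kappa>(2) by (rule ordLeq_transitive)
    qed (rule that)
  qed (use card_of_Well_order[of I] in \<open>auto simp: Field_card_of\<close>)
  show thesis
  proof (rule tower_ultrafilter)
    fix D
    assume D: "nonprincipal_ultrafilter D"
      "\<And>x k. x \<in> I \<Longrightarrow> {n. k < coord x n} \<in> D"
      "\<And>f. (\<And>k. {n. k \<le> f n} \<in> D) \<Longrightarrow> \<exists>x\<in>I. {n. coord x n \<le> f n} \<in> D"
      "\<And>x y. y \<in> underS |I| x \<Longrightarrow> {n. coord x n \<le> coord y n} \<in> D"
    have "\<exists>x\<in>I. \<forall>y\<in>J. {n. coord x n \<le> coord y n} \<in> D" if J: "J \<subseteq> I" "|J| \<le>o \<kappa>" for J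
      using card_bounded[OF \<kappa>(1) inf I J] D(4) by blast
    with D(1) I D(2,3) show thesis by (rule that)
  qed
qed

lemma card_real: "|UNIV :: real set| =o ctwo ^c natLeq"
proof -
  obtain f :: "nat set \<Rightarrow> real" where "bij_betw f UNIV UNIV"
    using nat_sets_eqpoll_reals unfolding eqpoll_def by blast
  then have "|UNIV :: nat set set| =o |UNIV :: real set|" by (rule card_of_ordIsoI)
  moreover have "|Pow (UNIV :: nat set)| =o |Func (UNIV :: nat set) (UNIV :: bool set)|"
    by (rule card_of_Pow_Func)
  moreover have "ctwo ^c natLeq = |Func (UNIV :: nat set) (UNIV :: bool set)|"
    by (simp add: cexp_def ctwo_def Field_natLeq Field_card_of)
  ultimately show ?thesis using ordIso_symmetric ordIso_transitive by (metis Pow_UNIV)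
qed

lemma cardSuc_natLeq_le_real: "cardSuc natLeq \<le>o |UNIV :: real set|"
proof -
  have "\<not> |UNIV :: real set| \<le>o natLeq"
    using uncountable_UNIV_real countable_card_le_natLeq by blast
  then have "natLeq <o |UNIV :: real set|"
    using natLeq_Well_order card_of_Well_order not_ordLeq_iff_ordLess by blast
  then show ?thesis
    using cardSuc_ordLess_ordLeq natLeq_Card_order card_of_Card_order by blast
qed

definition infinite_mod :: "nat filter \<Rightarrow> (nat \<Rightarrow> nat) \<Rightarrow> bool" where
  "infinite_mod U f \<longleftrightarrow> (\<forall>k. \<forall>\<^sub>F n in U. k \<le> f n)"

definition thin_filter :: "nat filter \<Rightarrow> bool" where
  "thin_filter U \<longleftrightarrow> (\<exists>H. |H| \<le>o cardSuc natLeq \<and> (\<forall>h\<in>H. infinite_mod U h) \<and>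
     (\<forall>f. infinite_mod U f \<longrightarrow> (\<exists>h\<in>H. \<forall>\<^sub>F n in U. h n \<le> f n)))"

text \<open>For a free ultrafilter this excludes \<open>thin_filter\<close>: an infinite lower bound
  \<open>g\<close> of a coinitial \<open>H\<close> would have a member of \<open>H\<close>, hence
  itself, below \<open>g - 1\<close>.\<close>

definition thick_filter :: "nat filter \<Rightarrow> bool" where
  "thick_filter U \<longleftrightarrow> (\<forall>H. |H| \<le>o cardSuc natLeq \<and> (\<forall>h\<in>H. infinite_mod U h) \<longrightarrow>
     (\<exists>g. infinite_mod U g \<and> (\<forall>h\<in>H. \<forall>\<^sub>F n in U. g n \<le> h n)))"

lemma thin_ultrafilter_exists:
  obtains u where "nonprincipal_ultrafilter u" "thin_filter (set_filter u)"
proof (rule tower_ultrafilter_exists[OF natLeq_Card_order ordLeq_reflexive cardSuc_natLeq_le_real])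
  fix I u
  assume u: "nonprincipal_ultrafilter u" and I: "|I| =o cardSuc natLeq"
    and inf: "\<And>x k. x \<in> I \<Longrightarrow> {n. k < coord x n} \<in> u"
    and coin: "\<And>f. (\<And>k. {n. k \<le> f n} \<in> u) \<Longrightarrow> \<exists>x\<in>I. {n. coord x n \<le> f n} \<in> u"
  have ev: "eventually P (set_filter u) \<longleftrightarrow> {n. P n} \<in> u" for P
    using u by (intro eventually_set_filter) (simp add: nonprincipal_ultrafilter_def)
  show thesis
  proof (rule that[OF u], unfold thin_filter_def, intro exI[of _ "coord ` I"] conjI allI ballI impI)
    show "|coord ` I| \<le>o cardSuc natLeq"
      using card_of_image I by (rule ordLeq_ordIso_trans)
    show "infinite_mod (set_filter u) h" if "h \<in> coord ` I" for h
    proof -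
      have "\<forall>\<^sub>F n in set_filter u. k < h n" for k using that inf ev by auto
      then show ?thesis unfolding infinite_mod_def by (metis (mono_tags, lifting) eventually_mono less_imp_le)
    qed
    show "\<exists>h\<in>coord ` I. \<forall>\<^sub>F n in set_filter u. h n \<le> f n" if "infinite_mod (set_filter u) f" for f
      using that coin[of f] by (auto simp: infinite_mod_def ev)
  qed
qed (rule natLeq_Well_order)

text \<open>Without CH the reals have room for \<omega>_2 indices, and a tower of that regular
  length bounds any \<omega>_1 coordinates.\<close>

lemma thick_ultrafilter_exists:
  assumes "\<not> Continuum_Hypothesis"
  obtains v where "nonprincipal_ultrafilter v" "thick_filter (set_filter v)"
proof (rule tower_ultrafilter_exists[of "cardSuc natLeq"])
  show C: "Card_order (cardSuc natLeq)" by (rule cardSuc_Card_order[OF natLeq_Card_order])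
  show "natLeq \<le>o cardSuc natLeq" by (rule cardSuc_ordLeq[OF natLeq_Card_order])
  have "\<not> cardSuc natLeq =o |UNIV :: real set|"
    using assms card_real ordIso_symmetric ordIso_transitive unfolding Continuum_Hypothesis_def by blast
  then have "cardSuc natLeq <o |UNIV :: real set|"
    using cardSuc_natLeq_le_real ordLeq_iff_ordLess_or_ordIso by blast
  then show "cardSuc (cardSuc natLeq) \<le>o |UNIV :: real set|"
    using cardSuc_ordLess_ordLeq[OF C card_of_Card_order] by blast
next
  fix I v
  assume v: "nonprincipal_ultrafilter v"
    and inf: "\<And>x k. x \<in> I \<Longrightarrow> {n. k < coord x n} \<in> v"
    and coin: "\<And>f. (\<And>k. {n. k \<le> f n} \<in> v) \<Longrightarrow> \<exists>x\<in>I. {n. coord x n \<le> f n} \<in> v"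
    and bdd: "\<And>J. J \<subseteq> I \<Longrightarrow> |J| \<le>o cardSuc natLeq \<Longrightarrow> \<exists>x\<in>I. \<forall>y\<in>J. {n. coord x n \<le> coord y n} \<in> v"
  have ev: "eventually P (set_filter v) \<longleftrightarrow> {n. P n} \<in> v" for P
    using v by (intro eventually_set_filter) (simp add: nonprincipal_ultrafilter_def)
  show thesis
  proof (rule that[OF v], unfold thick_filter_def, intro allI impI)
    fix H :: "(nat \<Rightarrow> nat) set"
    assume "|H| \<le>o cardSuc natLeq \<and> (\<forall>h\<in>H. infinite_mod (set_filter v) h)"
    then have H: "|H| \<le>o cardSuc natLeq" "\<And>h. h \<in> H \<Longrightarrow> infinite_mod (set_filter v) h" by auto
    \<comment> \<open>Coinitiality replaces each member of \<open>H\<close> by a coordinate below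
      it, so it suffices to bound \<omega>_1 coordinates.\<close>
    have "\<exists>x. x \<in> I \<and> {n. coord x n \<le> h n} \<in> v" if "h \<in> H" for h
    proof -
      have "{n. k \<le> h n} \<in> v" for k using H(2)[OF that] by (simp add: infinite_mod_def ev)
      from coin[OF this] show ?thesis by blast
    qed
    then obtain c where c: "\<And>h. h \<in> H \<Longrightarrow> c h \<in> I" "\<And>h. h \<in> H \<Longrightarrow> {n. coord (c h) n \<le> h n} \<in> v"
      by metis
    have "|c ` H| \<le>o cardSuc natLeq" using card_of_image H(1) by (rule ordLeq_transitive)
    then obtain x where x: "x \<in> I" "\<forall>y\<in>c ` H. {n. coord x n \<le> coord y n} \<in> v"
      using bdd[of "c ` H"] c(1) by blast
    have "\<forall>\<^sub>F n in set_filter v. coord x n \<le> h n" if "h \<in> H" for h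
    proof -
      have "\<forall>\<^sub>F n in set_filter v. coord x n \<le> coord (c h) n" using x that by (simp add: ev)
      moreover have "\<forall>\<^sub>F n in set_filter v. coord (c h) n \<le> h n" using c that by (simp add: ev)
      ultimately show ?thesis by eventually_elim (rule order_trans)
    qed
    moreover have "infinite_mod (set_filter v) (coord x)"
    proof -
      have "\<forall>\<^sub>F n in set_filter v. k < coord x n" for k using x inf ev by auto
      then show ?thesis unfolding infinite_mod_def by (metis (mono_tags, lifting) eventually_mono less_imp_le)
    qed
    ultimately show "\<exists>g. infinite_mod (set_filter v) g \<and> (\<forall>h\<in>H. \<forall>\<^sub>F n in set_filter v. g n \<le> h n)"
      by blast
  qed
qed

section \<open>Ultralimits of unit intervals\<close>

text \<open>Maps on the whole line avoid partial functions; those that agree on \<open>[0,1]\<close>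
  receive equal values at all points of the ultralimit.\<close>

typedef unit_fun = "{f :: real \<Rightarrow> real. continuous_on UNIV f \<and> range f \<subseteq> {0..1}}"
  morphisms app Unit_fun
  by (rule exI[of _ "\<lambda>_. 0"]) auto

lemma continuous_on_app: "continuous_on A (app f)"
  using app[of f] continuous_on_subset by blast

lemma app_bounds: "0 \<le> app f t" "app f t \<le> 1"
  using app[of f] by (auto simp: image_subset_iff)

definition clamp01 :: "real \<Rightarrow> real" where
  "clamp01 s = max 0 (min 1 s)"

lemma clamp01_simps [simp]:
  "s \<in> {0..1} \<Longrightarrow> clamp01 s = s" "s \<le> 0 \<Longrightarrow> clamp01 s = 0" "1 \<le> s \<Longrightarrow> clamp01 s = 1"
  "0 \<le> clamp01 s" "clamp01 s \<le> 1"
  by (auto simp: clamp01_def)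

lemma continuous_on_clamp01 [continuous_intros]:
  "continuous_on A f \<Longrightarrow> continuous_on A (\<lambda>x. clamp01 (f x))"
  unfolding clamp01_def by (intro continuous_intros)

definition unit_fun_of :: "(real \<Rightarrow> real) \<Rightarrow> unit_fun" where
  "unit_fun_of g = Unit_fun (\<lambda>t. clamp01 (g (clamp01 t)))"

lemma app_unit_fun_of:
  assumes "continuous_on {0..1} g"
  shows "app (unit_fun_of g) t = clamp01 (g (clamp01 t))"
proof -
  have "continuous_on UNIV (\<lambda>t. g (clamp01 t))"
    by (rule continuous_on_compose2[OF assms]) (auto intro!: continuous_intros)
  then have "(\<lambda>t. clamp01 (g (clamp01 t))) \<in> {f. continuous_on UNIV f \<and> range f \<subseteq> {0..1}}"
    by (auto intro!: continuous_intros)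
  then show ?thesis unfolding unit_fun_of_def by (subst Unit_fun_inverse) auto
qed

type_synonym up_point = "(nat \<Rightarrow> unit_fun) \<Rightarrow> real"

text \<open>A point of the ultralimit is coded by the values that it gives to all sequences of maps
  \<open>[0,1] \<rightarrow> [0,1]\<close>.\<close>

definition ulim_set :: "nat filter \<Rightarrow> (nat \<Rightarrow> real set) \<Rightarrow> up_point set" where
  "ulim_set U A = {x. \<forall>F. finite F \<longrightarrow> (\<forall>e>0. \<forall>\<^sub>F n in U. \<exists>t\<in>A n. \<forall>f\<in>F. \<bar>app (f n) t - x f\<bar> < e)}"

lemma ulim_setD:
  "x \<in> ulim_set U A \<Longrightarrow> finite F \<Longrightarrow> 0 < e \<Longrightarrow>
     \<forall>\<^sub>F n in U. \<exists>t\<in>A n. \<forall>f\<in>F. \<bar>app (f n) t - x f\<bar> < e"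
  unfolding ulim_set_def by blast

lemma ulim_set_mono:
  assumes "x \<in> ulim_set U A" "\<forall>\<^sub>F n in U. A n \<subseteq> B n"
  shows "x \<in> ulim_set U B"
  unfolding ulim_set_def
proof (intro CollectI allI impI)
  fix F :: "(nat \<Rightarrow> unit_fun) set" and e :: real assume "finite F" "0 < e"
  from ulim_setD[OF assms(1) this] assms(2)
  show "\<forall>\<^sub>F n in U. \<exists>t\<in>B n. \<forall>f\<in>F. \<bar>app (f n) t - x f\<bar> < e"
    by eventually_elim (rule bexE, assumption, rule bexI, auto)
qed

lemma open_coordinate_ball:
  fixes x :: "'a \<Rightarrow> real"
  assumes "finite F" shows "open {y. \<forall>f\<in>F. \<bar>y f - x f\<bar> < e}"
proof -
  have "open {y. \<bar>y f - x f\<bar> < e}" for f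
    by (intro open_Collect_less continuous_intros continuous_on_product_coordinates)
  then have "open (\<Inter>f\<in>F. {y. \<bar>y f - x f\<bar> < e})" using assms by (intro open_INT) auto
  moreover have "{y. \<forall>f\<in>F. \<bar>y f - x f\<bar> < e} = (\<Inter>f\<in>F. {y. \<bar>y f - x f\<bar> < e})" by auto
  ultimately show ?thesis by simp
qed

locale ultra_interval =
  fixes U :: "nat filter"
  assumes U: "free_ultra U"
begin

lemma not_eventually_iff: "\<not> eventually P U \<longleftrightarrow> (\<forall>\<^sub>F n in U. \<not> P n)"
  using free_ultra_not_iff[OF U] by blast

lemma U_ne: "U \<noteq> bot"
  using U by (simp add: free_ultra_def)

lemma eventually_False_iff: "\<not> (\<forall>\<^sub>F n in U. False)"
  using U_ne by (simp add: trivial_limit_def)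

text \<open>The triple of limits is approximated by triples of values at genuine points
  \<open>t\<close>, so a closed relation passes to it. Three places accommodate the graph of a
  binary operation.\<close>

lemma ulim_set_rel:
  assumes x: "x \<in> ulim_set U A" and C: "closed C"
    and ev: "\<forall>\<^sub>F n in U. \<forall>t\<in>A n. (app (f n) t, app (g n) t, app (h n) t) \<in> C"
  shows "(x f, x g, x h) \<in> C"
proof (rule ccontr)
  assume "(x f, x g, x h) \<notin> C"
  then obtain e where e: "e > 0" "ball (x f, x g, x h) e \<subseteq> - C"
    using C by (meson ComplI open_Compl open_contains_ball)
  have "\<forall>\<^sub>F n in U. \<exists>t\<in>A n. \<forall>k\<in>{f, g, h}. \<bar>app (k n) t - x k\<bar> < e / 3"
    using e by (intro ulim_setD[OF x]) auto
  with ev have "\<forall>\<^sub>F n in U. False"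
  proof eventually_elim
    case (elim n)
    then obtain t where t: "t \<in> A n" "\<bar>app (f n) t - x f\<bar> < e / 3" "\<bar>app (g n) t - x g\<bar> < e / 3"
      "\<bar>app (h n) t - x h\<bar> < e / 3" by blast
    have "dist (x f, x g, x h) (app (f n) t, app (g n) t, app (h n) t)
        \<le> dist (x f) (app (f n) t) + (dist (x g) (app (g n) t) + dist (x h) (app (h n) t))"
      unfolding dist_Pair_Pair
      by (rule order_trans[OF sqrt_sum_squares_le_sum add_left_mono])
        (auto intro!: sqrt_sum_squares_le_sum)
    also have "\<dots> < e" using t unfolding dist_real_def by linarith
    finally have "(app (f n) t, app (g n) t, app (h n) t) \<in> ball (x f, x g, x h) e" by simp
    then show False using e(2) elim(1) t(1) by blast
  qed
  then show False by (simp add: eventually_False_iff)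
qed

lemma ulim_set_eq:
  assumes "x \<in> ulim_set U A" "\<forall>\<^sub>F n in U. \<forall>t\<in>A n. app (f n) t = app (g n) t"
  shows "x f = x g"
proof -
  have "closed {p :: real \<times> real \<times> real. fst p = fst (snd p)}"
    by (intro closed_Collect_eq continuous_intros)
  from ulim_set_rel[OF assms(1) this, of f g g] assms(2) show ?thesis by simp
qed

lemma ulim_set_op:
  assumes x: "x \<in> ulim_set U A" and h: "continuous_on UNIV (\<lambda>p. h (fst p) (snd p))"
    and ev: "\<forall>\<^sub>F n in U. \<forall>t\<in>A n. app (k n) t = h (app (f n) t) (app (g n) t)"
  shows "x k = h (x f) (x g)"
proof -
  have "closed {p :: real \<times> real \<times> real. fst p = h (fst (snd p)) (snd (snd p))}"
    by (intro closed_Collect_eq continuous_intros continuous_on_compose2[OF h]) auto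
  from ulim_set_rel[OF x this, of k f g] ev show ?thesis by simp
qed

lemma ulim_set_interval:
  assumes "x \<in> ulim_set U A" "\<forall>\<^sub>F n in U. \<forall>t\<in>A n. app (f n) t \<in> {p..q}"
  shows "x f \<in> {p..q}"
  using ulim_set_rel[OF assms(1), of "{p..q} \<times> UNIV \<times> UNIV" f f f] assms(2)
  by (auto simp: closed_Times)

lemma ulim_set_bounds: "x \<in> ulim_set U A \<Longrightarrow> x f \<in> {0..1}"
  by (rule ulim_set_interval) (auto simp: app_bounds)

text \<open>An ultrafilter is prime: if both parts fail, each at some finite approximation, then the
  joint approximation fails almost everywhere.\<close>

lemma ulim_set_Un:
  assumes "x \<in> ulim_set U (\<lambda>n. A n \<union> B n)"
  shows "x \<in> ulim_set U A \<or> x \<in> ulim_set U B"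
proof (rule ccontr)
  assume no: "\<not> ?thesis"
  obtain F e where F: "finite F" "e > 0"
    "\<not> (\<forall>\<^sub>F n in U. \<exists>t\<in>A n. \<forall>f\<in>F. \<bar>app (f n) t - x f\<bar> < e)"
    using no unfolding ulim_set_def by blast
  obtain G d where G: "finite G" "d > 0"
    "\<not> (\<forall>\<^sub>F n in U. \<exists>t\<in>B n. \<forall>f\<in>G. \<bar>app (f n) t - x f\<bar> < d)"
    using no unfolding ulim_set_def by blast
  have "\<forall>\<^sub>F n in U. \<exists>t\<in>A n \<union> B n. \<forall>f\<in>F \<union> G. \<bar>app (f n) t - x f\<bar> < min e d"
    using F G by (intro ulim_setD[OF assms]) auto
  moreover have "\<forall>\<^sub>F n in U. \<not> (\<exists>t\<in>A n. \<forall>f\<in>F. \<bar>app (f n) t - x f\<bar> < e)"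
    using F(3) by (simp only: not_eventually_iff)
  moreover have "\<forall>\<^sub>F n in U. \<not> (\<exists>t\<in>B n. \<forall>f\<in>G. \<bar>app (f n) t - x f\<bar> < d)"
    using G(3) by (simp only: not_eventually_iff)
  ultimately have "\<forall>\<^sub>F n in U. False"
  proof eventually_elim
    case (elim n)
    then obtain t where t: "t \<in> A n \<union> B n" "\<forall>f\<in>F \<union> G. \<bar>app (f n) t - x f\<bar> < min e d" by blast
    then have "\<forall>f\<in>F. \<bar>app (f n) t - x f\<bar> < e" "\<forall>f\<in>G. \<bar>app (f n) t - x f\<bar> < d" by auto
    then show False using elim(2,3) t(1) by blast
  qed
  then show False by (simp add: eventually_False_iff)
qed

lemma closed_ulim_set: "closed (ulim_set U A)"
  unfolding closed_def
proof (subst open_subopen, intro ballI)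
  fix x assume "x \<in> - ulim_set U A"
  then obtain F e where F: "finite F" "e > 0"
    "\<not> (\<forall>\<^sub>F n in U. \<exists>t\<in>A n. \<forall>f\<in>F. \<bar>app (f n) t - x f\<bar> < e)"
    unfolding ulim_set_def by blast
  define W where "W = {y. \<forall>f\<in>F. \<bar>y f - x f\<bar> < e / 2}"
  have "open W" unfolding W_def using F(1) by (rule open_coordinate_ball)
  moreover have "x \<in> W" using F(2) by (simp add: W_def)
  moreover have "W \<subseteq> - ulim_set U A"
  proof
    fix y assume y: "y \<in> W"
    show "y \<in> - ulim_set U A"
    proof
      assume "y \<in> ulim_set U A"
      then have "\<forall>\<^sub>F n in U. \<exists>t\<in>A n. \<forall>f\<in>F. \<bar>app (f n) t - y f\<bar> < e / 2"
        using F by (intro ulim_setD) auto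
      then have "\<forall>\<^sub>F n in U. \<exists>t\<in>A n. \<forall>f\<in>F. \<bar>app (f n) t - x f\<bar> < e"
      proof eventually_elim
        case (elim n)
        then obtain t where t: "t \<in> A n" "\<forall>f\<in>F. \<bar>app (f n) t - y f\<bar> < e / 2" by blast
        have "\<bar>app (f n) t - x f\<bar> < e" if "f \<in> F" for f
        proof -
          have "\<bar>app (f n) t - y f\<bar> < e / 2" "\<bar>y f - x f\<bar> < e / 2"
            using t(2) y that by (auto simp: W_def)
          then show ?thesis by linarith
        qed
        then show ?case using t(1) by blast
      qed
      then show False using F(3) by blast
    qed
  qed
  ultimately show "\<exists>T. open T \<and> x \<in> T \<and> T \<subseteq> - ulim_set U A" by blast
qed

lemma compact_ulim_set: "compact (ulim_set U A)"
proof -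
  have "compactin (product_topology (\<lambda>_. euclidean) (UNIV :: (nat \<Rightarrow> unit_fun) set))
      (Pi\<^sub>E UNIV (\<lambda>_. {0..1::real}))"
    by (simp add: compactin_PiE)
  then have "compact (Pi\<^sub>E (UNIV :: (nat \<Rightarrow> unit_fun) set) (\<lambda>_. {0..1::real}))"
    by (simp add: euclidean_product_topology)
  moreover have "ulim_set U A \<subseteq> Pi\<^sub>E UNIV (\<lambda>_. {0..1})"
    using ulim_set_bounds by auto
  ultimately show ?thesis
    using closed_ulim_set compact_Int_closed by (metis inf.absorb_iff2)
qed

section \<open>Points given by sequences\<close>

definition pt :: "(nat \<Rightarrow> real) \<Rightarrow> up_point" where
  "pt a = (\<lambda>f. Lim U (\<lambda>n. app (f n) (a n)))"

lemma tendsto_pt: "((\<lambda>n. app (f n) (a n)) \<longlongrightarrow> pt a f) U"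
proof -
  define G where "G = filtermap (\<lambda>n. app (f n) (a n)) U"
  have "G \<noteq> bot" using U_ne by (simp add: G_def filtermap_bot_iff)
  moreover have "eventually (\<lambda>y. y \<in> {0..1}) G" by (simp add: G_def eventually_filtermap app_bounds)
  ultimately obtain y where y: "inf (nhds y) G \<noteq> bot"
    using compact_filter[of "{0..1::real}"] by auto
  \<comment> \<open>The image of an ultrafilter decides every set, so its cluster points are
    limits.\<close>
  have "G \<le> nhds y"
    unfolding le_filter_def
  proof (intro allI impI, rule ccontr)
    fix P assume P: "eventually P (nhds y)" "\<not> eventually P G"
    then have "eventually (\<lambda>s. \<not> P s) G"
      unfolding G_def eventually_filtermap using not_eventually_iff by blast
    with P(1) have "eventually (\<lambda>_. False) (inf (nhds y) G)"
      unfolding eventually_inf by blast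
    then show False using y by (simp add: trivial_limit_def)
  qed
  then have "((\<lambda>n. app (f n) (a n)) \<longlongrightarrow> y) U" unfolding filterlim_def G_def .
  moreover from this have "pt a f = y" unfolding pt_def by (intro tendsto_Lim U_ne)
  ultimately show ?thesis by simp
qed

lemma pt_in:
  assumes "\<forall>\<^sub>F n in U. a n \<in> A n" shows "pt a \<in> ulim_set U A"
  unfolding ulim_set_def
proof (intro CollectI allI impI)
  fix F :: "(nat \<Rightarrow> unit_fun) set" and e :: real assume F: "finite F" and e: "0 < e"
  have "\<forall>\<^sub>F n in U. \<bar>app (f n) (a n) - pt a f\<bar> < e" for f
    using tendstoD[OF tendsto_pt e, of f a] by (simp add: dist_real_def)
  then have "\<forall>\<^sub>F n in U. \<forall>f\<in>F. \<bar>app (f n) (a n) - pt a f\<bar> < e"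
    using F by (intro eventually_ball_finite) auto
  with assms show "\<forall>\<^sub>F n in U. \<exists>t\<in>A n. \<forall>f\<in>F. \<bar>app (f n) t - pt a f\<bar> < e"
    by eventually_elim blast
qed

lemma pt_interval:
  assumes "\<forall>\<^sub>F n in U. app (f n) (a n) \<in> {p..q}" shows "pt a f \<in> {p..q}"
  using ulim_set_interval[OF pt_in[of a "\<lambda>n. {a n}"], of f p q] assms by simp

definition X :: "up_point set" where
  "X = ulim_set U (\<lambda>_. {0..1})"

section \<open>Separation by coordinates\<close>

text \<open>The separating function has to be a coordinate, that is, a sequence of maps on the
  intervals themselves. This pulls topological separation in the ultralimit back to almost all
  intervals.\<close>

definition separated :: "up_point set \<Rightarrow> up_point set \<Rightarrow> bool" where
  "separated P Q \<longleftrightarrow> (\<exists>f. (\<forall>z\<in>P. z f = 0) \<and> (\<forall>z\<in>Q. z f = 1))"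

lemma op_ex:
  assumes h: "continuous_on UNIV (\<lambda>p. h (fst p) (snd p))"
    and range: "\<And>a b. a \<in> {0..1} \<Longrightarrow> b \<in> {0..1} \<Longrightarrow> h a b \<in> {0..1}"
  obtains k where "\<And>z. z \<in> X \<Longrightarrow> z k = h (z f) (z g)"
proof
  define k where "k n = unit_fun_of (\<lambda>t. h (app (f n) t) (app (g n) t))" for n
  have "continuous_on {0..1} (\<lambda>t. (\<lambda>p. h (fst p) (snd p)) (app (f n) t, app (g n) t))" for n
    by (rule continuous_on_compose2[OF h]) (auto intro!: continuous_intros continuous_on_app)
  then have "app (k n) t = h (app (f n) t) (app (g n) t)" if "t \<in> {0..1}" for n t
    unfolding k_def using that range[of "app (f n) t" "app (g n) t"]
    by (subst app_unit_fun_of) (auto simp: app_bounds)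
  then show "z k = h (z f) (z g)" if "z \<in> X" for z
    using that unfolding X_def by (intro ulim_set_op[OF _ h]) auto
qed

lemma separated_INT_UN:
  assumes "finite Y" "\<And>y. y \<in> Y \<Longrightarrow> separated (X \<inter> W y) (X \<inter> V y)"
  shows "separated (X \<inter> (\<Inter>y\<in>Y. W y)) (X \<inter> (\<Union>y\<in>Y. V y))"
  using assms
proof (induction Y)
  case empty
  have "z (\<lambda>_. unit_fun_of (\<lambda>_. 0)) = 0" if "z \<in> X" for z
    using ulim_set_interval[of z "\<lambda>_. {0..1}" "\<lambda>_. unit_fun_of (\<lambda>_. 0)" 0 0] that
    by (simp add: X_def app_unit_fun_of)
  then show ?case by (auto simp: separated_def intro!: exI[of _ "\<lambda>_. unit_fun_of (\<lambda>_. 0)"])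
next
  case (insert y Y)
  have "separated (X \<inter> (\<Inter>y\<in>Y. W y)) (X \<inter> (\<Union>y\<in>Y. V y))"
    using insert.prems by (intro insert.IH) simp
  then obtain f where f: "\<forall>z\<in>X \<inter> (\<Inter>y\<in>Y. W y). z f = 0" "\<forall>z\<in>X \<inter> (\<Union>y\<in>Y. V y). z f = 1"
    unfolding separated_def by blast
  have "separated (X \<inter> W y) (X \<inter> V y)" by (rule insert.prems) simp
  then obtain g where g: "\<forall>z\<in>X \<inter> W y. z g = 0" "\<forall>z\<in>X \<inter> V y. z g = 1"
    unfolding separated_def by blast
  have c: "continuous_on UNIV (\<lambda>p :: real \<times> real. max (fst p) (snd p))" by (intro continuous_intros)
  obtain k where k: "\<And>z. z \<in> X \<Longrightarrow> z k = max (z f) (z g)"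
    by (rule op_ex[where h = max and f = f and g = g, OF c]) auto
  have le: "z f \<le> 1 \<and> z g \<le> 1" if "z \<in> X" for z
    using that ulim_set_bounds unfolding X_def by auto
  show ?case unfolding separated_def
  proof (intro exI[of _ k] conjI ballI)
    fix z assume z: "z \<in> X \<inter> (\<Inter>y\<in>insert y Y. W y)"
    then have "z f = 0" "z g = 0" using f(1) g(1) by blast+
    then show "z k = 0" using k[of z] z by simp
  next
    fix z assume z: "z \<in> X \<inter> (\<Union>y\<in>insert y Y. V y)"
    then have "z f = 1 \<or> z g = 1" using f(2) g(2) by blast
    then show "z k = 1" using k[of z] le[of z] z by (auto simp: max_def)
  qed
qed

lemma separated_sym:
  assumes "separated P Q" "P \<subseteq> X" "Q \<subseteq> X" shows "separated Q P"
proof -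
  obtain f where f: "\<forall>z\<in>P. z f = 0" "\<forall>z\<in>Q. z f = 1" using assms unfolding separated_def by blast
  have c: "continuous_on UNIV (\<lambda>p :: real \<times> real. 1 - fst p)" by (intro continuous_intros)
  obtain k where k: "\<And>z. z \<in> X \<Longrightarrow> z k = 1 - z f"
    by (rule op_ex[where h = "\<lambda>a b. 1 - a" and f = f and g = f, OF c]) auto
  show ?thesis unfolding separated_def
  proof (intro exI[of _ k] conjI ballI)
    show "z k = 0" if "z \<in> Q" for z using k[of z] f(2) assms(3) that by auto
    show "z k = 1" if "z \<in> P" for z using k[of z] f(1) assms(2) that by auto
  qed
qed

lemma separated_points:
  assumes xy: "x \<noteq> y"
  shows "\<exists>W V. open W \<and> open V \<and> x \<in> W \<and> y \<in> V \<and> separated (X \<inter> W) (X \<inter> V)"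
proof -
  obtain g where g: "x g \<noteq> y g" using xy by blast
  \<comment> \<open>The affine map with \<open>x g\<close> sent to -1 and \<open>y g\<close> to 2,
    so that clamping makes it constant near both points.\<close>
  define \<alpha> where "\<alpha> s = 3 * ((s - x g) / (y g - x g)) - 1" for s
  have \<alpha>: "continuous_on A \<alpha>" for A unfolding \<alpha>_def using g by (intro continuous_intros) auto
  have c: "continuous_on UNIV (\<lambda>p :: real \<times> real. clamp01 (\<alpha> (fst p)))"
    by (intro continuous_intros continuous_on_compose2[OF \<alpha>]) auto
  obtain k where k: "\<And>z. z \<in> X \<Longrightarrow> z k = clamp01 (\<alpha> (z g))"
    by (rule op_ex[where h = "\<lambda>a b. clamp01 (\<alpha> a)" and f = g and g = g, OF c]) auto
  have "separated (X \<inter> {z. \<alpha> (z g) < 0}) (X \<inter> {z. \<alpha> (z g) > 1})"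
    unfolding separated_def
  proof (intro exI[of _ k] conjI ballI)
    show "z k = 0" if "z \<in> X \<inter> {z. \<alpha> (z g) < 0}" for z using k[of z] that by simp
    show "z k = 1" if "z \<in> X \<inter> {z. \<alpha> (z g) > 1}" for z using k[of z] that by simp
  qed
  moreover have "continuous_on UNIV (\<lambda>z :: up_point. \<alpha> (z g))"
    by (rule continuous_on_compose2[OF \<alpha>[of UNIV] continuous_on_product_coordinates]) simp
  then have "open {z :: up_point. \<alpha> (z g) < 0}" "open {z :: up_point. \<alpha> (z g) > 1}"
    by (simp_all add: open_Collect_less continuous_on_const)
  moreover have "\<alpha> (x g) < 0" "\<alpha> (y g) > 1" using g by (auto simp: \<alpha>_def)
  ultimately show ?thesis
    by (intro exI[of _ "{z. \<alpha> (z g) < 0}"] exI[of _ "{z. \<alpha> (z g) > 1}"]) auto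
qed

lemma separated_subset: "separated P Q \<Longrightarrow> P' \<subseteq> P \<Longrightarrow> Q' \<subseteq> Q \<Longrightarrow> separated P' Q'"
  unfolding separated_def by blast

lemma separated_point_compact:
  assumes D: "compact D" "D \<subseteq> X" and x: "x \<notin> D"
  shows "\<exists>W. open W \<and> x \<in> W \<and> separated (X \<inter> W) D"
proof -
  have "\<forall>y\<in>D. \<exists>W V. open W \<and> open V \<and> x \<in> W \<and> y \<in> V \<and> separated (X \<inter> W) (X \<inter> V)"
    using separated_points x by metis
  then obtain W V where WV: "\<And>y. y \<in> D \<Longrightarrow> open (W y)" "\<And>y. y \<in> D \<Longrightarrow> open (V y)"
    "\<And>y. y \<in> D \<Longrightarrow> x \<in> W y" "\<And>y. y \<in> D \<Longrightarrow> y \<in> V y"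
    "\<And>y. y \<in> D \<Longrightarrow> separated (X \<inter> W y) (X \<inter> V y)" by metis
  obtain Y where Y: "Y \<subseteq> D" "finite Y" "D \<subseteq> (\<Union>y\<in>Y. V y)"
  proof (rule compactE_image[OF D(1), of D V])
    show "\<And>T. T \<in> D \<Longrightarrow> open (V T)" by (rule WV(2))
    show "D \<subseteq> (\<Union>y\<in>D. V y)" using WV(4) by blast
  qed auto
  have "separated (X \<inter> (\<Inter>y\<in>Y. W y)) (X \<inter> (\<Union>y\<in>Y. V y))"
    using Y WV(5) by (intro separated_INT_UN) auto
  then have "separated (X \<inter> (\<Inter>y\<in>Y. W y)) D"
    by (rule separated_subset) (use D(2) Y(3) in auto)
  moreover have "open (\<Inter>y\<in>Y. W y)" using Y WV(1) by (intro open_INT) auto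
  moreover have "x \<in> (\<Inter>y\<in>Y. W y)" using Y WV(3) by auto
  ultimately show ?thesis by blast
qed

text \<open>The two-step compactness proof of normality, carried out with separating coordinates
  combined by maxima, so that the Urysohn function is a sequence of maps.\<close>

lemma separated_compact:
  assumes C: "compact C" "C \<subseteq> X" and D: "compact D" "D \<subseteq> X" and disj: "C \<inter> D = {}"
  shows "separated C D"
proof -
  have "\<forall>x\<in>C. \<exists>W. open W \<and> x \<in> W \<and> separated (X \<inter> W) D"
    using separated_point_compact[OF D] disj by blast
  then obtain W where W: "\<And>x. x \<in> C \<Longrightarrow> open (W x)" "\<And>x. x \<in> C \<Longrightarrow> x \<in> W x"
    "\<And>x. x \<in> C \<Longrightarrow> separated (X \<inter> W x) D" by metis
  obtain Y where Y: "Y \<subseteq> C" "finite Y" "C \<subseteq> (\<Union>y\<in>Y. W y)"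
  proof (rule compactE_image[OF C(1), of C W])
    show "\<And>T. T \<in> C \<Longrightarrow> open (W T)" by (rule W(1))
    show "C \<subseteq> (\<Union>y\<in>C. W y)" using W(2) by blast
  qed auto
  have "separated (X \<inter> D) (X \<inter> W y)" if "y \<in> Y" for y
  proof -
    have "separated (X \<inter> W y) D" using W(3) Y(1) that by blast
    then have "separated D (X \<inter> W y)" by (rule separated_sym) (use D(2) in auto)
    then show ?thesis by (rule separated_subset) auto
  qed
  then have "separated (X \<inter> (\<Inter>y\<in>Y. D)) (X \<inter> (\<Union>y\<in>Y. W y))"
    using Y(2) by (intro separated_INT_UN) auto
  then have "separated D C"
    by (rule separated_subset) (use C(2) D(2) Y(3) in auto)
  then show ?thesis using D(2) C(2) by (rule separated_sym)
qed

end

section \<open>Gaps of subcontinua\<close>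

definition subcontinuum_at :: "'a topology \<Rightarrow> 'a \<Rightarrow> 'a set \<Rightarrow> bool" where
  "subcontinuum_at T e K \<longleftrightarrow> closedin T K \<and> connectedin T K \<and> e \<in> K"

definition irreducible_between :: "'a topology \<Rightarrow> 'a \<Rightarrow> 'a \<Rightarrow> bool" where
  "irreducible_between T e e' \<longleftrightarrow>
     (\<forall>K. subcontinuum_at T e K \<and> e' \<in> K \<longrightarrow> K = topspace T)"

text \<open>Plain inclusion would leave no room for interpolating a set \<open>lower a\<close>
  between two arbitrary subcontinua; an open set in between does.\<close>

definition well_inside :: "'a topology \<Rightarrow> 'a set \<Rightarrow> 'a set \<Rightarrow> bool" where
  "well_inside T A B \<longleftrightarrow> (\<exists>W. openin T W \<and> A \<subseteq> W \<and> W \<subseteq> B)"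

definition fills_gap :: "'a topology \<Rightarrow> 'a \<Rightarrow> 'a set set \<Rightarrow> (nat \<Rightarrow> 'a set) \<Rightarrow> bool" where
  "fills_gap T e \<L> K \<longleftrightarrow> (\<exists>M M'. subcontinuum_at T e M \<and> subcontinuum_at T e M' \<and> well_inside T M M' \<and>
     (\<forall>L\<in>\<L>. well_inside T L M) \<and> (\<forall>n. well_inside T M' (K n)))"

text \<open>The topological invariant: an \<open>(\<omega>\<^sub>1, \<omega>\<^sup>*)\<close>-gap among the subcontinua at \<open>e\<close>. Two sets are
  required to fill a gap since the intersection of the \<open>K n\<close> always lies inside it.\<close>

definition thin_at :: "'a topology \<Rightarrow> 'a \<Rightarrow> bool" where
  "thin_at T e \<longleftrightarrow> (\<exists>(K :: nat \<Rightarrow> 'a set) \<L>. |\<L>| \<le>o cardSuc natLeq \<and> \<L> \<noteq> {} \<and> K 0 \<noteq> topspace T \<and>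
     (\<forall>n. subcontinuum_at T e (K n) \<and> well_inside T (K (Suc n)) (K n)) \<and>
     (\<forall>L\<in>\<L>. subcontinuum_at T e L \<and> (\<exists>L'\<in>\<L>. well_inside T L L') \<and> (\<forall>n. well_inside T L (K n))) \<and>
     \<not> fills_gap T e \<L> K)"

lemma subcontinuum_at_image:
  assumes "homeomorphic_map T T' h" "subcontinuum_at T e K"
  shows "subcontinuum_at T' (h e) (h ` K)"
  using assms unfolding subcontinuum_at_def
  by (meson closedin_subset connectedin_continuous_map_image homeomorphic_imp_continuous_map
      homeomorphic_map_closedness_eq imageI)

lemma well_inside_image:
  assumes h: "homeomorphic_map T T' h" and "well_inside T A B"
  shows "well_inside T' (h ` A) (h ` B)"
proof -
  obtain W where W: "openin T W" "A \<subseteq> W" "W \<subseteq> B" using assms unfolding well_inside_def by blast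
  then have "openin T' (h ` W)"
    using h homeomorphic_map_openness_eq openin_subset by metis
  then show ?thesis using W unfolding well_inside_def by blast
qed

lemma thin_at_homeomorphic:
  assumes h: "homeomorphic_map T T' h" and thin: "thin_at T e" and e: "e \<in> topspace T"
  shows "thin_at T' (h e)"
proof -
  obtain g where g: "homeomorphic_maps T T' h g" using h homeomorphic_map_maps by blast
  then have g': "homeomorphic_map T' T g" by (simp add: homeomorphic_maps_map)
  have gh: "g (h x) = x" if "x \<in> topspace T" for x using g that by (simp add: homeomorphic_maps_def)
  have gh_im: "g ` h ` A = A" if "A \<subseteq> topspace T" for A
    using gh that by (force simp: image_image)
  obtain K \<L> where c: "|\<L>| \<le>o cardSuc natLeq" "\<L> \<noteq> {}" "K 0 \<noteq> topspace T"
    and K: "\<And>n. subcontinuum_at T e (K n)" "\<And>n :: nat. well_inside T (K (Suc n)) (K n)"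
    and L: "\<And>L. L \<in> \<L> \<Longrightarrow> subcontinuum_at T e L" "\<And>L. L \<in> \<L> \<Longrightarrow> \<exists>L'\<in>\<L>. well_inside T L L'"
      "\<And>L n. L \<in> \<L> \<Longrightarrow> well_inside T L (K n)"
    and no: "\<not> fills_gap T e \<L> K"
    using thin unfolding thin_at_def by blast
  have sub: "A \<subseteq> topspace T" if "subcontinuum_at T e A" for A
    using that by (simp add: subcontinuum_at_def closedin_subset)
  show ?thesis
    unfolding thin_at_def
  proof (intro exI[of _ "\<lambda>n. h ` K n"] exI[of _ "(`) h ` \<L>"] conjI allI ballI notI)
    show "|(`) h ` \<L>| \<le>o cardSuc natLeq" using card_of_image c(1) by (rule ordLeq_transitive)
    show False if "(`) h ` \<L> = {}" using c(2) that by simp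
    have "g ` topspace T' = topspace T" using homeomorphic_imp_surjective_map[OF g'] .
    then show False if "h ` K 0 = topspace T'" using c(3) gh_im[OF sub[OF K(1)[of 0]]] that by metis
    show "subcontinuum_at T' (h e) (h ` K n)" for n using h K(1) by (rule subcontinuum_at_image)
    show "well_inside T' (h ` K (Suc n)) (h ` K n)" for n using h K(2) by (rule well_inside_image)
  next
    fix L assume "L \<in> (`) h ` \<L>"
    then obtain L0 where L0: "L0 \<in> \<L>" "L = h ` L0" by blast
    show "subcontinuum_at T' (h e) L" unfolding L0 using h L(1)[OF L0(1)] by (rule subcontinuum_at_image)
    obtain L1 where "L1 \<in> \<L>" "well_inside T L0 L1" using L(2) L0(1) by blast
    then show "\<exists>L'\<in>(`) h ` \<L>. well_inside T' L L'"
      unfolding L0 using well_inside_image[OF h] by blast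
    show "well_inside T' L (h ` K n)" for n
      unfolding L0 using h L(3)[OF L0(1)] by (rule well_inside_image)
  next
    assume "fills_gap T' (h e) ((`) h ` \<L>) (\<lambda>n. h ` K n)"
    then obtain M M' where M0: "subcontinuum_at T' (h e) M \<and> subcontinuum_at T' (h e) M' \<and>
      well_inside T' M M' \<and> (\<forall>L\<in>(`) h ` \<L>. well_inside T' L M) \<and>
      (\<forall>n. well_inside T' M' (h ` K n))" unfolding fills_gap_def by (elim exE)
    then have M: "subcontinuum_at T' (h e) M" "subcontinuum_at T' (h e) M'" "well_inside T' M M'"
      "\<And>L. L \<in> \<L> \<Longrightarrow> well_inside T' (h ` L) M" "\<And>n. well_inside T' M' (h ` K n)"
      by simp_all
    have "subcontinuum_at T e (g ` M)" "subcontinuum_at T e (g ` M')"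
      using subcontinuum_at_image[OF g' M(1)] subcontinuum_at_image[OF g' M(2)] gh[OF e] by simp_all
    moreover have "well_inside T (g ` M) (g ` M')" using g' M(3) by (rule well_inside_image)
    moreover have "well_inside T L (g ` M)" if "L \<in> \<L>" for L
      using well_inside_image[OF g' M(4)[OF that]] gh_im[OF sub[OF L(1)[OF that]]] by simp
    moreover have "well_inside T (g ` M') (K n)" for n
      using well_inside_image[OF g' M(5)[of n]] gh_im[OF sub[OF K(1)]] by simp
    ultimately have "fills_gap T e \<L> K"
      unfolding fills_gap_def by (intro exI[of _ "g ` M"] exI[of _ "g ` M'"]) simp
    then show False using no by contradiction
  qed
qed

lemma irreducible_between_homeomorphic:
  assumes h: "homeomorphic_map T T' h" and irr: "irreducible_between T e e'"
    and e: "e \<in> topspace T" "e' \<in> topspace T"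
  shows "irreducible_between T' (h e) (h e')"
  unfolding irreducible_between_def
proof (intro allI impI)
  fix K assume K: "subcontinuum_at T' (h e) K \<and> h e' \<in> K"
  obtain g where g: "homeomorphic_maps T T' h g" using h homeomorphic_map_maps by blast
  then have g': "homeomorphic_map T' T g" by (simp add: homeomorphic_maps_map)
  have gh: "g (h x) = x" if "x \<in> topspace T" for x using g that by (simp add: homeomorphic_maps_def)
  have hg: "h (g y) = y" if "y \<in> topspace T'" for y using g that by (simp add: homeomorphic_maps_def)
  have "subcontinuum_at T e (g ` K)" "e' \<in> g ` K"
    using subcontinuum_at_image[OF g'] K gh e by (metis, metis imageI)
  then have gK: "g ` K = topspace T" using irr by (simp add: irreducible_between_def)
  have sub: "K \<subseteq> topspace T'" using K by (simp add: subcontinuum_at_def closedin_subset)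
  have "h ` g ` K = K" using hg sub by (force simp: image_image)
  then show "K = topspace T'"
    unfolding gK using homeomorphic_imp_surjective_map[OF h] by simp
qed

section \<open>Initial and final segments, cut points and end points\<close>

context ultra_interval
begin

abbreviation X_top :: "up_point topology" where
  "X_top \<equiv> top_of_set X"

abbreviation pt0 :: up_point where
  "pt0 \<equiv> pt (\<lambda>_. 0)"

abbreviation pt1 :: up_point where
  "pt1 \<equiv> pt (\<lambda>_. 1)"

definition unit_seq :: "(nat \<Rightarrow> real) \<Rightarrow> bool" where
  "unit_seq a \<longleftrightarrow> (\<forall>n. a n \<in> {0..1})"

lemma unit_seqD: "unit_seq a \<Longrightarrow> 0 \<le> a n" "unit_seq a \<Longrightarrow> a n \<le> 1"
  by (auto simp: unit_seq_def)

definition lower :: "(nat \<Rightarrow> real) \<Rightarrow> up_point set" where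
  "lower a = ulim_set U (\<lambda>n. {0..a n})"

definition upper :: "(nat \<Rightarrow> real) \<Rightarrow> up_point set" where
  "upper a = ulim_set U (\<lambda>n. {a n..1})"

lemma closed_lower: "closed (lower a)" and closed_upper: "closed (upper a)" and closed_X: "closed X"
  unfolding lower_def upper_def X_def by (rule closed_ulim_set)+

lemma compact_X: "compact X"
  unfolding X_def by (rule compact_ulim_set)

lemma lower_mono:
  assumes "\<forall>\<^sub>F n in U. a n \<le> b n" shows "lower a \<subseteq> lower b"
proof
  fix x assume "x \<in> lower a"
  moreover from assms have "\<forall>\<^sub>F n in U. {0..a n} \<subseteq> {0..b n}" by eventually_elim auto
  ultimately show "x \<in> lower b" unfolding lower_def by (rule ulim_set_mono)
qed

lemma lower_subset_X: "unit_seq a \<Longrightarrow> lower a \<subseteq> X"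
  unfolding lower_def X_def unit_seq_def
  by (rule subsetI, erule ulim_set_mono) (auto intro!: always_eventually order_trans)

lemma upper_subset_X: "unit_seq a \<Longrightarrow> upper a \<subseteq> X"
  unfolding upper_def X_def unit_seq_def
  by (rule subsetI, erule ulim_set_mono) (auto intro!: always_eventually intro: order_trans)

lemma lower_1: "lower (\<lambda>_. 1) = X"
  by (simp add: lower_def X_def)

lemma pt_lower: "unit_seq a \<Longrightarrow> \<forall>\<^sub>F n in U. a n \<le> b n \<Longrightarrow> pt a \<in> lower b"
  unfolding lower_def unit_seq_def by (rule pt_in) (auto elim: eventually_mono)

lemma pt_upper: "unit_seq a \<Longrightarrow> \<forall>\<^sub>F n in U. b n \<le> a n \<Longrightarrow> pt a \<in> upper b"
  unfolding upper_def unit_seq_def by (rule pt_in) (auto elim: eventually_mono)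

lemma pt_X: "unit_seq a \<Longrightarrow> pt a \<in> X"
  unfolding X_def unit_seq_def by (rule pt_in) (auto intro: always_eventually)

lemma X_split:
  assumes "unit_seq a" shows "X = lower a \<union> upper a"
proof
  show "lower a \<union> upper a \<subseteq> X" using lower_subset_X upper_subset_X assms by blast
  show "X \<subseteq> lower a \<union> upper a"
  proof
    fix x assume "x \<in> X"
    moreover have "{0..1} = {0..a n} \<union> {a n..1}" for n
      using unit_seqD[OF assms] by (intro ivl_disj_un_two_touch(4)[symmetric])
    ultimately have "x \<in> ulim_set U (\<lambda>n. {0..a n} \<union> {a n..1})" by (simp add: X_def)
    then show "x \<in> lower a \<union> upper a" 
      using ulim_set_Un[of x "\<lambda>n. {0..a n}" "\<lambda>n. {a n..1}"] by (simp add: lower_def upper_def)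
  qed
qed

lemma lower_upper_disjoint:
  assumes "\<forall>\<^sub>F n in U. a n < b n" "unit_seq a" "unit_seq b"
  shows "lower a \<inter> upper b = {}"
proof (rule ccontr)
  assume "\<not> ?thesis"
  then obtain x where x: "x \<in> lower a" "x \<in> upper b" by blast
  \<comment> \<open>A ramp that is 0 up to \<open>a n\<close> and 1 from \<open>b n\<close>
    on.\<close>
  define f where "f n = unit_fun_of (\<lambda>t. (t - a n) / (b n - a n))" for n
  have f: "app (f n) t = clamp01 ((clamp01 t - a n) / (b n - a n))" for n t
    unfolding f_def using assms(1)
    by (subst app_unit_fun_of) (cases "b n = a n"; auto intro!: continuous_intros)+
  have "\<forall>\<^sub>F n in U. \<forall>t\<in>{0..a n}. app (f n) t \<in> {0..0}"
    using assms(1)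
  proof eventually_elim
    case (elim n)
    then show ?case using assms(2)[unfolded unit_seq_def, rule_format, of n]
      by (auto simp: f divide_nonpos_pos)
  qed
  then have "x f \<in> {0..0}" using x(1) unfolding lower_def by (intro ulim_set_interval)
  moreover have "\<forall>\<^sub>F n in U. \<forall>t\<in>{b n..1}. app (f n) t \<in> {1..1}"
    using assms(1)
  proof eventually_elim
    case (elim n)
    then show ?case using assms(3)[unfolded unit_seq_def, rule_format, of n]
      by (auto simp: f)
  qed
  then have "x f \<in> {1..1}" using x(2) unfolding upper_def by (intro ulim_set_interval)
  ultimately show False by simp
qed

lemma pt_lower_iff:
  assumes "unit_seq a" "unit_seq b" shows "pt a \<in> lower b \<longleftrightarrow> (\<forall>\<^sub>F n in U. a n \<le> b n)"
proof
  assume a: "pt a \<in> lower b"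
  show "\<forall>\<^sub>F n in U. a n \<le> b n"
  proof (rule ccontr)
    assume "\<not> ?thesis"
    then have "\<forall>\<^sub>F n in U. b n < a n" by (simp add: not_eventually_iff not_le)
    then have "lower b \<inter> upper a = {}" using assms by (intro lower_upper_disjoint)
    moreover have "pt a \<in> upper a" using assms by (intro pt_upper) auto
    ultimately show False using a by blast
  qed
qed (rule pt_lower[OF assms(1)])

lemma pt_upper_iff:
  assumes "unit_seq a" "unit_seq b" shows "pt a \<in> upper b \<longleftrightarrow> (\<forall>\<^sub>F n in U. b n \<le> a n)"
proof
  assume a: "pt a \<in> upper b"
  show "\<forall>\<^sub>F n in U. b n \<le> a n"
  proof (rule ccontr)
    assume "\<not> ?thesis"
    then have "\<forall>\<^sub>F n in U. a n < b n" by (simp add: not_eventually_iff not_le)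
    then have "lower a \<inter> upper b = {}" using assms by (intro lower_upper_disjoint)
    moreover have "pt a \<in> lower a" using assms by (intro pt_lower) auto
    ultimately show False using a by blast
  qed
qed (rule pt_upper[OF assms(1)])

lemma lower_subset_iff:
  assumes "unit_seq a" "unit_seq b" shows "lower a \<subseteq> lower b \<longleftrightarrow> (\<forall>\<^sub>F n in U. a n \<le> b n)"
proof
  assume "lower a \<subseteq> lower b"
  moreover have "pt a \<in> lower a" using assms by (intro pt_lower) auto
  ultimately show "\<forall>\<^sub>F n in U. a n \<le> b n" using pt_lower_iff assms by blast
qed (rule lower_mono)

text \<open>This makes \<open>pt a\<close> the only passage between the two sides. At a point lying
  on both, every coordinate is squeezed to its value at \<open>pt a\<close>.\<close>

lemma lower_Int_upper:
  assumes a: "unit_seq a" shows "lower a \<inter> upper a = {pt a}"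
proof
  show "{pt a} \<subseteq> lower a \<inter> upper a" using pt_lower[OF a, of a] pt_upper[OF a, of a] by simp
  show "lower a \<inter> upper a \<subseteq> {pt a}"
  proof
    fix x assume x: "x \<in> lower a \<inter> upper a"
    have "x f = pt a f" for f
    proof -
      \<comment> \<open>The oscillation \<open>|f - f(a)|\<close>, halved and given opposite signs on the two sides of \<open>a\<close>.\<close>
      define s where "s n t = \<bar>app (f n) t - app (f n) (a n)\<bar> / 2" for n t
      define q where "q n t = (if t \<le> a n then 1 / 2 - s n t else 1 / 2 + s n t)" for n t
      have s: "0 \<le> s n t" "s n t \<le> 1 / 2" for n t
        using app_bounds[of "f n" t] app_bounds[of "f n" "a n"] unfolding s_def by auto
      have s_a: "s n (a n) = 0" for n by (simp add: s_def)
      have cs: "continuous_on A (s n)" for A n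
        unfolding s_def by (intro continuous_intros continuous_on_app) simp
      have cq: "continuous_on {0..1} (q n)" for n
        unfolding q_def
        by (rule continuous_on_cases_le[where h = "\<lambda>t. t" and a = "a n"])
          (auto intro!: continuous_intros cs simp: s_a)
      define k where "k n = unit_fun_of (q n)" for n
      define c where "c n = unit_fun_of (\<lambda>_. app (f n) (a n))" for n
      have k: "app (k n) t = q n t" if "t \<in> {0..1}" for n t
        unfolding k_def using that s[of n t] by (subst app_unit_fun_of[OF cq]) (auto simp: q_def)
      have c: "app (c n) t = app (f n) (a n)" for n t
        unfolding c_def by (subst app_unit_fun_of) (auto simp: app_bounds)
      have a01: "0 \<le> a n" "a n \<le> 1" for n using a by (auto simp: unit_seq_def)
      have "app (k n) t \<in> {0..1 / 2}" if "t \<in> {0..a n}" for n t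
        using k[of t n] that a01[of n] s[of n t] by (auto simp: q_def)
      then have "x k \<in> {0..1 / 2}"
        using x unfolding lower_def by (intro ulim_set_interval[of x "\<lambda>n. {0..a n}"]) auto
      moreover have "app (k n) t \<in> {1 / 2..1}" if "t \<in> {a n..1}" for n t
        using k[of t n] that a01[of n] s[of n t] by (auto simp: q_def s_def)
      then have "x k \<in> {1 / 2..1}"
        using x unfolding upper_def by (intro ulim_set_interval[of x "\<lambda>n. {a n..1}"]) auto
      ultimately have xk: "x k = 1 / 2" by auto
      have "closed {p :: real \<times> real \<times> real. 2 * \<bar>fst p - 1 / 2\<bar> = \<bar>fst (snd p) - snd (snd p)\<bar>}"
        by (intro closed_Collect_eq continuous_intros)
      moreover have "2 * \<bar>app (k n) t - 1 / 2\<bar> = \<bar>app (f n) t - app (c n) t\<bar>" if "t \<in> {0..1}" for n t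
        using k[OF that] by (simp add: q_def c s_def)
      moreover have "x \<in> X" using x lower_subset_X[OF a] by blast
      ultimately have "(x k, x f, x c) \<in> {p. 2 * \<bar>fst p - 1 / 2\<bar> = \<bar>fst (snd p) - snd (snd p)\<bar>}"
        unfolding X_def by (intro ulim_set_rel[of x "\<lambda>_. {0..1}"]) auto
      then have "x f = x c" using xk by simp
      \<comment> \<open>\<open>c\<close> is constant on each interval with value
        \<open>f(a)\<close>, so its value at \<open>x\<close> is the limit of these numbers.\<close>
      moreover have "x c = pt a f"
      proof (rule tendsto_unique[OF U_ne _ tendsto_pt])
        have "\<forall>\<^sub>F n in U. \<bar>app (f n) (a n) - x c\<bar> < e" if "e > 0" for e
        proof -
          have "\<forall>\<^sub>F n in U. \<exists>t\<in>{0..1}. \<forall>f\<in>{c}. \<bar>app (f n) t - x f\<bar> < e"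
            using \<open>x \<in> X\<close> that unfolding X_def by (intro ulim_setD) auto
          then show ?thesis by eventually_elim (auto simp: c)
        qed
        then show "((\<lambda>n. app (f n) (a n)) \<longlongrightarrow> x c) U"
          by (intro tendstoI) (simp add: dist_real_def)
      qed
      ultimately show ?thesis by simp
    qed
    then show "x \<in> {pt a}" by auto
  qed
qed

text \<open>A separation into two closed sets would be witnessed by one coordinate with values 0 and
  1. By the intermediate value theorem it takes the value 1/2 on almost every \<open>A n\<close>,
  and a sequence of such places gives a point in neither part.\<close>

lemma connected_ulim_interval:
  assumes A: "\<And>n. is_interval (A n)" "\<And>n. A n \<subseteq> {0..1}"
  shows "connected (ulim_set U A)"
proof (rule ccontr)
  assume "\<not> connected (ulim_set U A)"
  then obtain C D where CD: "closed C" "closed D" "C \<noteq> {}" "D \<noteq> {}" "C \<union> D = ulim_set U A" "C \<inter> D = {}"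
    unfolding connected_closed_set[OF closed_ulim_set] by blast
  have sub: "ulim_set U A \<subseteq> X" unfolding X_def using A(2) by (auto elim: ulim_set_mono)
  have comp: "compact C" "compact D"
    using CD compact_ulim_set[of A] by (metis Un_upper1 compact_Int_closed inf.absorb_iff2)
      (metis CD(2,5) Un_upper2 compact_Int_closed compact_ulim_set inf.absorb_iff2)
  have "separated C D" using comp CD sub by (intro separated_compact) auto
  then obtain f where f: "\<And>z. z \<in> C \<Longrightarrow> z f = 0" "\<And>z. z \<in> D \<Longrightarrow> z f = 1"
    unfolding separated_def by blast
  obtain x y where xy: "x \<in> C" "y \<in> D" using CD by blast
  have "\<forall>\<^sub>F n in U. \<exists>t\<in>A n. \<forall>g\<in>{f}. \<bar>app (g n) t - x g\<bar> < 1 / 2"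
    using xy CD(5) by (intro ulim_setD) auto
  moreover have "\<forall>\<^sub>F n in U. \<exists>t\<in>A n. \<forall>g\<in>{f}. \<bar>app (g n) t - y g\<bar> < 1 / 2"
    using xy CD(5) by (intro ulim_setD) auto
  ultimately have ev: "\<forall>\<^sub>F n in U. \<exists>t\<in>A n. app (f n) t = 1 / 2"
  proof eventually_elim
    case (elim n)
    obtain s where s: "s \<in> A n" "\<bar>app (f n) s - x f\<bar> < 1 / 2" using elim(1) by blast
    obtain t where t: "t \<in> A n" "\<bar>app (f n) t - y f\<bar> < 1 / 2" using elim(2) by blast
    have st: "app (f n) s < 1 / 2" "app (f n) t > 1 / 2"
      using s t f(1)[OF xy(1)] f(2)[OF xy(2)] by linarith+
    have "connected (app (f n) ` A n)"
      using A(1) by (intro connected_continuous_image continuous_on_app) (simp add: is_interval_connected)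
    then have "1 / 2 \<in> app (f n) ` A n"
      by (rule connectedD_interval[OF _ imageI[OF s(1)] imageI[OF t(1)]]) (use st in simp_all)
    then show ?case by force
  qed
  define a where "a n = (SOME t. t \<in> A n \<and> app (f n) t = 1 / 2)" for n
  have a: "\<forall>\<^sub>F n in U. a n \<in> A n \<and> app (f n) (a n) = 1 / 2"
    using ev unfolding a_def by eventually_elim (rule someI_ex, blast)
  then have "pt a \<in> ulim_set U A" by (intro pt_in) (auto elim: eventually_mono)
  moreover have "pt a f \<in> {1 / 2..1 / 2}"
    using a by (intro pt_interval) (auto elim: eventually_mono)
  ultimately show False using f[of "pt a"] CD(5) by auto
qed

lemma connected_lower: "unit_seq a \<Longrightarrow> connected (lower a)"
  unfolding lower_def unit_seq_def
  by (rule connected_ulim_interval) (auto simp: is_interval_cc intro: order_trans)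

lemma connected_upper: "unit_seq a \<Longrightarrow> connected (upper a)"
  unfolding upper_def unit_seq_def
  by (rule connected_ulim_interval) (auto simp: is_interval_cc intro: order_trans)

lemma subcontinuum_X_iff:
  "subcontinuum_at X_top e K \<longleftrightarrow> closed K \<and> K \<subseteq> X \<and> connected K \<and> e \<in> K"
  unfolding subcontinuum_at_def
  using closed_X by (auto simp: closedin_closed_eq connectedin_subtopology)

lemma unit_seq_const [simp]: "unit_seq (\<lambda>_. 0)" "unit_seq (\<lambda>_. 1)"
  by (auto simp: unit_seq_def)

lemma pt0_lower: "unit_seq a \<Longrightarrow> pt0 \<in> lower a"
  by (rule pt_lower) (auto simp: unit_seq_def)

lemma pt1_upper: "unit_seq a \<Longrightarrow> pt1 \<in> upper a"
  by (rule pt_upper) (auto simp: unit_seq_def)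

lemma connected_missing_pt:
  assumes K: "closed K" "K \<subseteq> X" "connected K" and a: "unit_seq a" and "pt a \<notin> K"
  shows "K \<inter> lower a = {} \<or> K \<inter> upper a = {}"
proof (rule ccontr)
  assume "\<not> ?thesis"
  moreover have "K \<subseteq> lower a \<union> upper a" using K(2) X_split[OF a] by simp
  moreover have "lower a \<inter> upper a \<inter> K = {}"
    unfolding lower_Int_upper[OF a] using assms(5) by simp
  ultimately show False
    using K(3) closed_lower closed_upper unfolding connected_closed by (metis inf_commute)
qed

text \<open>Near any point missed by \<open>K\<close> there is a point \<open>pt a\<close> that is
  also missed, and cutting there separates the two ends.\<close>

lemma irreducible_X: "irreducible_between X_top pt0 pt1"
  unfolding irreducible_between_def subcontinuum_X_iff
proof (intro allI impI)
  fix K assume K: "(closed K \<and> K \<subseteq> X \<and> connected K \<and> pt0 \<in> K) \<and> pt1 \<in> K"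
  have "x \<in> K" if x: "x \<in> X" for x
  proof (rule ccontr)
    assume "x \<notin> K"
    have "compact K" using K compact_X by (metis compact_Int_closed inf.absorb_iff2)
    then have "separated {x} K" using K x \<open>x \<notin> K\<close> by (intro separated_compact) auto
    then obtain f where f: "x f = 0" "\<And>z. z \<in> K \<Longrightarrow> z f = 1" unfolding separated_def by auto
    have ev: "\<forall>\<^sub>F n in U. \<exists>t\<in>{0..1}. \<forall>g\<in>{f}. \<bar>app (g n) t - x g\<bar> < 1 / 2"
      using x unfolding X_def by (intro ulim_setD) auto
    have "\<exists>b. b \<in> {0..1} \<and> ((\<exists>t\<in>{0..1}. app (f n) t < 1 / 2) \<longrightarrow> app (f n) b < 1 / 2)" for n
    proof (cases "\<exists>t\<in>{0..1}. app (f n) t < 1 / 2")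
      case False
      then show ?thesis by (intro exI[of _ 0]) simp
    qed blast
    then obtain a where a1: "\<And>n. a n \<in> {0..1}"
      "\<And>n. (\<exists>t\<in>{0..1}. app (f n) t < 1 / 2) \<Longrightarrow> app (f n) (a n) < 1 / 2" by metis
    have a: "unit_seq a" using a1 by (simp add: unit_seq_def)
    have "\<forall>\<^sub>F n in U. app (f n) (a n) \<in> {0..1 / 2}"
      using ev
    proof eventually_elim
      case (elim n)
      then obtain t where t: "t \<in> {0..1}" "\<bar>app (f n) t - x f\<bar> < 1 / 2" by blast
      have "app (f n) t < 1 / 2" using t(2) f(1) by linarith
      then have "app (f n) (a n) < 1 / 2" using t(1) by (intro a1(2)) blast
      then show ?case by (simp add: app_bounds)
    qed
    then have "pt a f \<in> {0..1 / 2}" by (rule pt_interval)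
    then have "pt a \<notin> K" using f(2) by force
    then have "K \<inter> lower a = {} \<or> K \<inter> upper a = {}"
      using K a by (intro connected_missing_pt) auto
    then show False using K pt0_lower[OF a] pt1_upper[OF a] by blast
  qed
  then show "K = topspace X_top" using K by auto
qed

text \<open>\<open>a n\<close> is the first place where \<open>f n\<close> reaches 1/2, or 1 if
  there is none. Hence \<open>pt a\<close> has \<open>f\<close>-value exactly 1/2 unless
  \<open>lower a\<close> is everything, so a continuum on which \<open>f\<close> vanishes can
  contain \<open>pt a\<close> only in that case.\<close>

lemma threshold:
  assumes f: "pt0 f = 0"
  obtains a where "unit_seq a" "\<And>z. z \<in> lower a \<Longrightarrow> z f \<le> 1 / 2" "pt a f = 0 \<Longrightarrow> lower a = X"
    "\<forall>\<^sub>F n in U. 0 < a n"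
proof -
  define good where "good k b \<longleftrightarrow>
    0 < b \<and> b \<le> 1 \<and> (\<forall>t\<in>{0..b}. app k t \<le> 1 / 2) \<and> (b = 1 \<or> app k b = 1 / 2)" for k b
  have ex: "\<exists>b. good k b"
    if k: "app k 0 < 1 / 2" for k
  proof (cases "\<exists>t\<in>{0..1}. app k t \<ge> 1 / 2")
    case True
    define C where "C = {t \<in> {0..1}. app k t \<ge> 1 / 2}"
    have "closed {t. 1 / 2 \<le> app k t}" by (intro closed_Collect_le continuous_intros continuous_on_app)
    then have "compact ({0..1} \<inter> {t. 1 / 2 \<le> app k t})" by (intro compact_Int_closed) auto
    moreover have "{0..1} \<inter> {t. 1 / 2 \<le> app k t} = C" by (auto simp: C_def)
    ultimately have C: "compact C" by simp
    have "C \<noteq> {}" using True by (auto simp: C_def)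
    then obtain b where b: "b \<in> C" "\<And>t. t \<in> C \<Longrightarrow> b \<le> t" using compact_attains_inf[OF C] by blast
    have b01: "0 \<le> b" "b \<le> 1" "1 / 2 \<le> app k b" using b(1) by (auto simp: C_def)
    obtain s where s: "0 \<le> s" "s \<le> b" "app k s = 1 / 2"
      using IVT'[of "app k" 0 "1 / 2" b] k b01 continuous_on_app by auto
    then have "b \<le> s" using b01 by (intro b(2)) (auto simp: C_def)
    then have "app k b = 1 / 2" using s by simp
    moreover have "b \<noteq> 0" using k b01 by auto
    moreover have "app k t \<le> 1 / 2" if "t \<in> {0..b}" for t
    proof (rule ccontr)
      assume gt: "\<not> ?thesis"
      then have "t \<in> C" using that b01 by (auto simp: C_def)
      then have "t = b" using b(2)[of t] that by auto
      then show False using gt \<open>app k b = 1 / 2\<close> by simp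
    qed
    ultimately show ?thesis unfolding good_def using b01 by (intro exI[of _ b]) auto
  next
    case False
    then show ?thesis unfolding good_def by (intro exI[of _ 1]) force
  qed
  \<comment> \<open>\<open>f n\<close> starts below 1/2 for almost every \<open>n\<close>; elsewhere
    0 is a default.\<close>
  have "\<exists>b. (app (f n) 0 < 1 / 2 \<longrightarrow> good (f n) b) \<and> b \<in> {0..1}" for n
  proof (cases "app (f n) 0 < 1 / 2")
    case True
    then obtain b where "good (f n) b" using ex by blast
    moreover from this have "b \<in> {0..1}" by (auto simp: good_def)
    ultimately show ?thesis by blast
  qed (intro exI[of _ 0], simp)
  then obtain a where a: "\<And>n. app (f n) 0 < 1 / 2 \<Longrightarrow> good (f n) (a n)" "\<And>n. a n \<in> {0..1}"
    by metis
  have unit: "unit_seq a" using a(2) by (simp add: unit_seq_def)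
  have "\<forall>\<^sub>F n in U. app (f n) 0 < 1 / 2"
    using tendsto_pt[of f "\<lambda>_. 0"] f by (intro order_tendstoD) auto
  then have ev: "\<forall>\<^sub>F n in U. 0 < a n \<and> a n \<le> 1 \<and> (\<forall>t\<in>{0..a n}. app (f n) t \<le> 1 / 2) \<and>
      (a n = 1 \<or> app (f n) (a n) = 1 / 2)"
    by eventually_elim (drule a(1), simp add: good_def)
  show thesis
  proof (rule that[OF unit])
    show "z f \<le> 1 / 2" if z: "z \<in> lower a" for z
    proof -
      have "\<forall>\<^sub>F n in U. \<forall>t\<in>{0..a n}. app (f n) t \<in> {0..1 / 2}"
        using ev by eventually_elim (auto simp: app_bounds)
      then have "z f \<in> {0..1 / 2}" using z unfolding lower_def by (intro ulim_set_interval)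
      then show ?thesis by simp
    qed
    show "\<forall>\<^sub>F n in U. 0 < a n" using ev by eventually_elim simp
    assume 0: "pt a f = 0"
    have "\<forall>\<^sub>F n in U. a n = 1 \<or> app (f n) (a n) = 1 / 2" using ev by eventually_elim simp
    then consider "\<forall>\<^sub>F n in U. a n = 1" | "\<forall>\<^sub>F n in U. app (f n) (a n) = 1 / 2"
      using free_ultra_disj_iff[OF U] by blast
    then show "lower a = X"
    proof cases
      case 1
      then have "\<forall>\<^sub>F n in U. 1 \<le> a n" by eventually_elim simp
      then have "lower (\<lambda>_. 1) \<subseteq> lower a" by (rule lower_mono)
      then show ?thesis using lower_1 lower_subset_X[OF unit] by simp
    next
      case 2
      then have "\<forall>\<^sub>F n in U. app (f n) (a n) \<in> {1 / 2..1 / 2}" by eventually_elim simp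
      then have "pt a f \<in> {1 / 2..1 / 2}" by (rule pt_interval)
      then show ?thesis using 0 by simp
    qed
  qed
qed

lemma compact_closed_subset_X: "closed K \<Longrightarrow> K \<subseteq> X \<Longrightarrow> compact K"
  using compact_X by (metis compact_Int_closed inf.absorb_iff2)

text \<open>The passage from topology to order: a coordinate that is 0 on \<open>K\<close> and 1
  outside the open set between \<open>K\<close> and \<open>K'\<close> is cut at its threshold. As
  \<open>K\<close> contains \<open>pt0\<close>, missing \<open>pt a\<close> confines it to
  \<open>lower a\<close>.\<close>

lemma interpolate:
  assumes K: "subcontinuum_at X_top pt0 K" and "well_inside X_top K K'"
  obtains a where "unit_seq a" "K \<subseteq> lower a" "well_inside X_top (lower a) K'"
proof -
  have K': "closed K" "K \<subseteq> X" "connected K" "pt0 \<in> K" using K by (auto simp: subcontinuum_X_iff)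
  obtain W where W: "openin X_top W" "K \<subseteq> W" "W \<subseteq> K'" using assms(2) unfolding well_inside_def by blast
  have "closedin X_top (X - W)" using W(1) by (simp add: openin_closedin_eq)
  then have "closed (X - W)" using closed_X closedin_closed_trans by blast
  then have "separated K (X - W)"
    using K' W by (intro separated_compact compact_closed_subset_X) auto
  then obtain f where f: "\<And>z. z \<in> K \<Longrightarrow> z f = 0" "\<And>z. z \<in> X - W \<Longrightarrow> z f = 1"
    unfolding separated_def by blast
  obtain a where a: "unit_seq a" "\<And>z. z \<in> lower a \<Longrightarrow> z f \<le> 1 / 2" "pt a f = 0 \<Longrightarrow> lower a = X"
    by (rule threshold[OF f(1)[OF K'(4)]]) blast
  have "lower a \<subseteq> W"
  proof
    fix z assume z: "z \<in> lower a"
    show "z \<in> W"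
    proof (rule ccontr)
      assume "z \<notin> W"
      then have "z f = 1" using z lower_subset_X[OF a(1)] by (intro f(2)) blast
      then show False using a(2)[OF z] by simp
    qed
  qed
  then have "well_inside X_top (lower a) K'" using W unfolding well_inside_def by blast
  moreover have "K \<subseteq> lower a"
  proof (cases "pt a \<in> K")
    case True
    then show ?thesis using a(3) f(1) K'(2) by auto
  next
    case False
    then have "K \<inter> lower a = {} \<or> K \<inter> upper a = {}" using K' a(1) by (intro connected_missing_pt)
    then show ?thesis using K'(2,4) pt0_lower[OF a(1)] X_split[OF a(1)] by blast
  qed
  ultimately show thesis using that a(1) by blast
qed

text \<open>Two points different from \<open>pt0\<close> both lie in some \<open>upper a\<close>
  with \<open>a\<close> positive almost everywhere, and this subcontinuum is proper. The other end
  is reached through the reflection \<open>flip\<close>.\<close>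

lemma irreducible_endpoint:
  assumes irr: "irreducible_between X_top e e'" and e: "e \<in> X" "e' \<in> X"
  shows "e = pt0 \<or> e' = pt0"
proof (rule ccontr)
  assume no: "\<not> ?thesis"
  have "separated {pt0} {e, e'}"
    using no e by (intro separated_compact) (auto intro: pt_X)
  then obtain f where f: "pt0 f = 0" "e f = 1" "e' f = 1" unfolding separated_def by auto
  obtain a where a: "unit_seq a" "\<And>z. z \<in> lower a \<Longrightarrow> z f \<le> 1 / 2" "\<forall>\<^sub>F n in U. 0 < a n"
    by (rule threshold[OF f(1)]) blast
  have "e \<in> upper a" "e' \<in> upper a"
    using a(2)[of e] a(2)[of e'] f e X_split[OF a(1)] by auto
  then have "upper a = X"
    using irr closed_upper connected_upper[OF a(1)] upper_subset_X[OF a(1)]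
    unfolding irreducible_between_def subcontinuum_X_iff by auto
  then have "pt0 \<in> upper a" using pt_X[of "\<lambda>_. 0"] by simp
  then have "\<forall>\<^sub>F n in U. a n \<le> 0" using pt_upper_iff[of "\<lambda>_. 0" a] a(1) by simp
  with a(3) have "\<forall>\<^sub>F n in U. False" by eventually_elim simp
  then show False by (simp add: eventually_False_iff)
qed

lemma lower_well_inside:
  assumes "unit_seq a" "unit_seq b" "\<forall>\<^sub>F n in U. a n < b n"
  shows "well_inside X_top (lower a) (lower b)"
  unfolding well_inside_def
proof (intro exI[of _ "X - upper b"] conjI)
  show "openin X_top (X - upper b)"
    using closed_upper by (metis Diff_eq open_Compl openin_open_Int)
  show "lower a \<subseteq> X - upper b"
    using lower_upper_disjoint[OF assms(3,1,2)] lower_subset_X[OF assms(1)] by blast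
  show "X - upper b \<subseteq> lower b" using X_split[OF assms(2)] by blast
qed

lemma subcontinuum_lower: "unit_seq a \<Longrightarrow> subcontinuum_at X_top pt0 (lower a)"
  unfolding subcontinuum_X_iff by (simp add: closed_lower connected_lower lower_subset_X pt0_lower)

lemma connected_X: "connected X"
  using connected_lower[of "\<lambda>_. 1"] by (simp add: lower_1)

text \<open>Otherwise \<open>lower b\<close> would coincide with the open set in between, and a
  proper nonempty clopen set contradicts connectedness.\<close>

lemma well_inside_less:
  assumes ab: "unit_seq a" "unit_seq b" and wi: "well_inside X_top (lower a) (lower b)"
    and ne: "lower b \<noteq> X"
  shows "\<forall>\<^sub>F n in U. a n < b n"
proof (rule ccontr)
  assume "\<not> ?thesis"
  then have "\<forall>\<^sub>F n in U. b n \<le> a n" by (simp add: not_eventually_iff not_less)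
  then have "lower b \<subseteq> lower a" by (rule lower_mono)
  moreover obtain W where "openin X_top W" "lower a \<subseteq> W" "W \<subseteq> lower b"
    using wi unfolding well_inside_def by blast
  ultimately have "openin X_top (lower b)" by (metis subset_antisym subset_trans)
  moreover have "closedin X_top (lower b)"
    using closed_lower lower_subset_X[OF ab(2)] by (metis closed_subset)
  moreover have "lower b \<noteq> {}" using pt0_lower[OF ab(2)] by blast
  ultimately show False using connected_X ne unfolding connected_clopen by auto
qed

section \<open>Gaps at the end point\<close>

text \<open>The reciprocals of a coinitial family of infinite functions are cofinal among the
  infinitesimals, so no cut lies above all of them and below every \<open>1 / (n + 2)\<close>. The
  offset 2 keeps \<open>K 0\<close> proper.\<close>

lemma thin_at_pt0:
  assumes "thin_filter U" shows "thin_at X_top pt0"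
proof -
  obtain H where H: "|H| \<le>o cardSuc natLeq" "\<And>h. h \<in> H \<Longrightarrow> infinite_mod U h"
    "\<And>f. infinite_mod U f \<Longrightarrow> \<exists>h\<in>H. \<forall>\<^sub>F n in U. h n \<le> f n"
    using assms unfolding thin_filter_def by auto
  define K where "K n = lower (\<lambda>_. 1 / (real n + 2))" for n
  define b where "b h m = 1 / (real (h m) + 1)" for h :: "nat \<Rightarrow> nat" and m
  define \<L> where "\<L> = (\<lambda>h. lower (b h)) ` H"
  have uK: "unit_seq (\<lambda>_. 1 / (real n + 2))" for n by (auto simp: unit_seq_def field_simps)
  have ub: "unit_seq (b h)" for h by (auto simp: unit_seq_def b_def field_simps)
  have infinite: "\<forall>\<^sub>F m in U. k \<le> h m" if "h \<in> H" for h k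
    using H(2)[OF that] by (simp add: infinite_mod_def)
  show ?thesis
    unfolding thin_at_def
  proof (intro exI[of _ K] exI[of _ \<L>] conjI allI ballI notI)
    show "|\<L>| \<le>o cardSuc natLeq" unfolding \<L>_def using card_of_image H(1) by (rule ordLeq_transitive)
    have "infinite_mod U (\<lambda>n. n)" using free_ultra_ge[OF U] by (simp add: infinite_mod_def)
    then show False if "\<L> = {}" using H(3) that unfolding \<L>_def by blast
    show False if "K 0 = topspace X_top"
    proof -
      have "pt1 \<in> K 0" using that pt_X[of "\<lambda>_. 1"] by simp
      then have "\<forall>\<^sub>F n in U. (1::real) \<le> 1 / (real 0 + 2)"
        unfolding K_def by (rule pt_lower_iff[OF _ uK, THEN iffD1, rotated]) simp
      then show False by (simp add: eventually_False_iff)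
    qed
    show "subcontinuum_at X_top pt0 (K n)" for n
      unfolding K_def using uK by (rule subcontinuum_lower)
    show "well_inside X_top (K (Suc n)) (K n)" for n
      unfolding K_def by (rule lower_well_inside[OF uK uK]) (simp add: field_simps)
  next
    fix L assume "L \<in> \<L>"
    then obtain h where h: "h \<in> H" "L = lower (b h)" by (auto simp: \<L>_def)
    show "subcontinuum_at X_top pt0 L" unfolding h(2) using ub by (rule subcontinuum_lower)
    show "well_inside X_top L (K n)" for n
      unfolding h(2) K_def
    proof (rule lower_well_inside[OF ub uK])
      show "\<forall>\<^sub>F m in U. b h m < 1 / (real n + 2)"
        using infinite[OF h(1), of "n + 2"] by eventually_elim (auto simp: b_def field_simps)
    qed
    \<comment> \<open>A member of \<open>H\<close> below \<open>h - 1\<close> has a strictly larger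
      reciprocal and provides the next member of \<L>.\<close>
    have "infinite_mod U (\<lambda>m. h m - 1)"
      unfolding infinite_mod_def
    proof
      fix k show "\<forall>\<^sub>F m in U. k \<le> h m - 1"
        using infinite[OF h(1), of "k + 1"] by eventually_elim simp
    qed
    then obtain h' where h': "h' \<in> H" "\<forall>\<^sub>F m in U. h' m \<le> h m - 1" using H(3) by blast
    have "\<forall>\<^sub>F m in U. b h m < b h' m"
      using h'(2) infinite[OF h(1), of 1]
    proof eventually_elim
      case (elim m)
      then have "h' m < h m" by simp
      then show ?case by (simp add: b_def field_simps)
    qed
    then have "well_inside X_top L (lower (b h'))" unfolding h(2) by (rule lower_well_inside[OF ub ub])
    then show "\<exists>L'\<in>\<L>. well_inside X_top L L'" using h'(1) by (auto simp: \<L>_def)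
  next
    assume "fills_gap X_top pt0 \<L> K"
    then obtain M M' where M: "subcontinuum_at X_top pt0 M" "well_inside X_top M M'"
      "\<And>L. L \<in> \<L> \<Longrightarrow> well_inside X_top L M" "\<And>n. well_inside X_top M' (K n)"
      unfolding fills_gap_def by blast
    obtain a where a: "unit_seq a" "M \<subseteq> lower a" "well_inside X_top (lower a) M'"
      by (rule interpolate[OF M(1,2)])
    have a0: "0 \<le> a m" for m using a(1) by (auto simp: unit_seq_def)
    have small: "\<forall>\<^sub>F m in U. a m \<le> 1 / (real n + 2)" for n
    proof -
      have "lower a \<subseteq> K n" using a(3) M(4)[of n] unfolding well_inside_def by blast
      then show ?thesis unfolding K_def using lower_subset_iff[OF a(1) uK] by blast
    qed
    \<comment> \<open>\<open>a\<close> may vanish; the added term makes \<open>s\<close> positive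
      and strictly larger than \<open>a\<close>, yet still infinitesimal.\<close>
    define s where "s m = a m + 1 / (real m + 1)" for m
    have s0: "0 < s m" for m using a0[of m] by (simp add: s_def add_nonneg_pos)
    have s_small: "\<forall>\<^sub>F m in U. s m \<le> 2 / (real n + 2)" for n
      using small[of n] free_ultra_ge[OF U, of "n + 1"]
    proof eventually_elim
      case (elim m)
      then have "1 / (real m + 1) \<le> 1 / (real n + 2)" by (intro divide_left_mono) auto
      then show ?case using elim(1) by (simp add: s_def)
    qed
    \<comment> \<open>The factor 2 absorbs the \<open>+ 1\<close> in \<open>b\<close>:
      \<open>h \<le> 1 / (2 * s)\<close> and \<open>s \<le> 1 / 2\<close> give
      \<open>(h + 1) * s \<le> 1\<close>, so \<open>a < s \<le> b h\<close>, against
      \<open>b h \<le> a\<close>.\<close>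
    define f where "f m = nat \<lfloor>1 / (2 * s m)\<rfloor>" for m
    have "infinite_mod U f"
      unfolding infinite_mod_def
    proof
      fix k
      show "\<forall>\<^sub>F m in U. k \<le> f m"
        using s_small[of "4 * k"]
      proof eventually_elim
        case (elim m)
        then have "real k * (2 * s m) \<le> real k * (2 * (2 / (4 * real k + 2)))"
          by (intro mult_left_mono) auto
        also have "\<dots> \<le> 1" by (simp add: field_simps)
        finally have "real k \<le> 1 / (2 * s m)" using s0[of m] by (simp add: field_simps)
        then show ?case unfolding f_def by (rule le_nat_floor)
      qed
    qed
    then obtain h where h: "h \<in> H" "\<forall>\<^sub>F m in U. h m \<le> f m" using H(3) by blast
    have "well_inside X_top (lower (b h)) M" using h(1) by (intro M(3)) (auto simp: \<L>_def)
    then have "lower (b h) \<subseteq> lower a" using a(2) unfolding well_inside_def by blast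
    then have "\<forall>\<^sub>F m in U. b h m \<le> a m" using lower_subset_iff[OF ub a(1)] by blast
    with h(2) s_small[of 2] have "\<forall>\<^sub>F m in U. False"
    proof eventually_elim
      case (elim m)
      have "real (h m) \<le> real (f m)" using elim(1) by simp
      also have "\<dots> \<le> 1 / (2 * s m)" using s0[of m] unfolding f_def by (intro of_nat_floor) simp
      finally have "real (h m) \<le> 1 / (2 * s m)" .
      then have "(real (h m) + 1) * s m \<le> 1 / 2 + s m" using s0[of m] by (simp add: field_simps)
      also have "\<dots> \<le> 1" using elim(2) by simp
      finally have "s m \<le> b h m" by (simp add: b_def field_simps)
      moreover have "0 < 1 / (real m + 1)" by simp
      ultimately show False using elim(3) unfolding s_def by linarith
    qed
    then show False by (simp add: eventually_False_iff)
  qed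
qed

text \<open>Countable saturation by hand: \<open>N n\<close> is the largest number up to
  \<open>n\<close> such that all earlier statements hold at \<open>n\<close>; the bound
  \<open>n\<close> makes the maximum exist.\<close>

lemma infinite_diagonal:
  assumes "\<And>k. \<forall>\<^sub>F n in U. Q k n"
  obtains N where "infinite_mod U N" "\<And>n k. k < N n \<Longrightarrow> Q k n"
proof -
  define S where "S n = {N. N \<le> n \<and> (\<forall>k<N. Q k n)}" for n
  have S: "finite (S n)" "0 \<in> S n" for n
    by (auto simp: S_def intro: finite_subset[of _ "{..n}"])
  show thesis
  proof
    show "infinite_mod U (\<lambda>n. Max (S n))"
      unfolding infinite_mod_def
    proof
      fix k
      have "\<forall>\<^sub>F n in U. \<forall>i\<in>{..<k}. Q i n" using assms by (intro eventually_ball_finite) auto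
      with free_ultra_ge[OF U, of k] show "\<forall>\<^sub>F n in U. k \<le> Max (S n)"
        by eventually_elim (rule Max_ge[OF S(1)], simp add: S_def)
    qed
    fix n k assume "k < Max (S n)"
    moreover have "Max (S n) \<in> S n" using S by (intro Max_in) auto
    ultimately show "Q k n" by (simp add: S_def)
  qed
qed

text \<open>Interpolation extracts from the supposed gap a decreasing sequence of cuts
  \<open>a n\<close> and a cut \<open>b L\<close> for each \<open>L\<close>. How long the
  \<open>a n\<close> keep decreasing above \<open>b L\<close> is measured by an infinite function
  \<open>N L\<close>; a common infinite lower bound \<open>g\<close> of these functions selects cuts
  that fill the gap.\<close>

lemma not_thin_at_pt0:
  assumes thick: "thick_filter U" shows "\<not> thin_at X_top pt0"
proof
  let ?e = "pt0"
  assume "thin_at X_top ?e"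
  then obtain K \<L> where card: "|\<L>| \<le>o cardSuc natLeq" and ne: "\<L> \<noteq> {}" "K 0 \<noteq> topspace X_top"
    and K: "\<And>n. subcontinuum_at X_top ?e (K n)" "\<And>n :: nat. well_inside X_top (K (Suc n)) (K n)"
    and L: "\<And>L. L \<in> \<L> \<Longrightarrow> subcontinuum_at X_top ?e L" "\<And>L. L \<in> \<L> \<Longrightarrow> \<exists>L'\<in>\<L>. well_inside X_top L L'"
      "\<And>L n. L \<in> \<L> \<Longrightarrow> well_inside X_top L (K n)"
    and no: "\<not> fills_gap X_top ?e \<L> K"
    unfolding thin_at_def by blast
  have wi_sub: "A \<subseteq> B" if "well_inside X_top A B" for A B
    using that unfolding well_inside_def by blast
  have "\<exists>a. unit_seq a \<and> K (Suc n) \<subseteq> lower a \<and> well_inside X_top (lower a) (K n)" for n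
    by (rule interpolate[OF K(1) K(2)]) blast
  then obtain a where a: "\<And>n. unit_seq (a n)" "\<And>n. K (Suc n) \<subseteq> lower (a n)"
    "\<And>n. well_inside X_top (lower (a n)) (K n)" by metis
  have "\<exists>b. unit_seq b \<and> L \<subseteq> lower b \<and> (\<exists>L'\<in>\<L>. well_inside X_top (lower b) L')" if LL: "L \<in> \<L>" for L
  proof -
    obtain L' where L': "L' \<in> \<L>" "well_inside X_top L L'" using L(2)[OF LL] by blast
    show ?thesis by (rule interpolate[OF L(1)[OF LL] L'(2)]) (use L'(1) in blast)
  qed
  then obtain b where b: "\<And>L. L \<in> \<L> \<Longrightarrow> unit_seq (b L)" "\<And>L. L \<in> \<L> \<Longrightarrow> L \<subseteq> lower (b L)"
    "\<And>L. L \<in> \<L> \<Longrightarrow> \<exists>L'\<in>\<L>. well_inside X_top (lower (b L)) L'" by metis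
  have K0: "K n \<subseteq> K 0" for n
    by (induction n) (use wi_sub[OF K(2)] in blast)+
  have sub_X: "K n \<subseteq> X" for n using K(1)[of n] by (simp add: subcontinuum_X_iff)
  have strict: "\<forall>\<^sub>F j in U. a (Suc n) j < a n j" for n
  proof (rule well_inside_less[OF a(1) a(1)])
    show "well_inside X_top (lower (a (Suc n))) (lower (a n))"
      using a(3)[of "Suc n"] a(2)[of n] unfolding well_inside_def by blast
    show "lower (a n) \<noteq> X" using wi_sub[OF a(3)[of n]] K0[of n] sub_X[of 0] ne(2) by auto
  qed
  have ba: "\<forall>\<^sub>F j in U. b L j \<le> a n j" if LL: "L \<in> \<L>" for L n
  proof -
    obtain L' where "L' \<in> \<L>" "lower (b L) \<subseteq> L'" using b(3)[OF LL] wi_sub by blast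
    then have "lower (b L) \<subseteq> lower (a n)" using wi_sub[OF L(3)[of L' "Suc n"]] a(2)[of n] by blast
    then show ?thesis using lower_subset_iff[OF b(1)[OF LL] a(1)] by blast
  qed
  have "\<exists>N. infinite_mod U N \<and> (\<forall>j. \<forall>k<N j. b L j \<le> a k j \<and> a (Suc k) j < a k j)" if "L \<in> \<L>" for L
    by (rule infinite_diagonal[of "\<lambda>k j. b L j \<le> a k j \<and> a (Suc k) j < a k j"])
      (use eventually_conj[OF ba[OF that] strict] in blast)+
  then obtain N where N: "\<And>L. L \<in> \<L> \<Longrightarrow> infinite_mod U (N L)"
    "\<And>L j k. L \<in> \<L> \<Longrightarrow> k < N L j \<Longrightarrow> b L j \<le> a k j \<and> a (Suc k) j < a k j" by metis
  have "|N ` \<L>| \<le>o cardSuc natLeq" using card_of_image card by (rule ordLeq_transitive)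
  then obtain g where g: "infinite_mod U g" "\<And>L. L \<in> \<L> \<Longrightarrow> \<forall>\<^sub>F n in U. g n \<le> N L n"
    using thick[unfolded thick_filter_def, rule_format, of "N ` \<L>"] N(1) by blast
  \<comment> \<open>Two indices just under \<open>g\<close>. Below \<open>N L\<close> the sequence
    still decreases and stays above \<open>b L\<close>, which gives \<open>b L \<le> m < m'\<close>;
    as \<open>g\<close> is infinite, its index also passes each \<open>n\<close>, which gives
    \<open>m' \<le> a n\<close>.\<close>
  define m where "m j = a (g j - 1) j" for j
  define m' where "m' j = a (g j - 2) j" for j
  have um: "unit_seq m" "unit_seq m'" using a(1) by (auto simp: unit_seq_def m_def m'_def)
  have g_ge: "\<forall>\<^sub>F n in U. k \<le> g n" for k using g(1) by (simp add: infinite_mod_def)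
  obtain L0 where L0: "L0 \<in> \<L>" using ne(1) by blast
  have "\<forall>\<^sub>F j in U. m j < m' j"
    using g(2)[OF L0] g_ge[of 2]
  proof eventually_elim
    case (elim j)
    then have "g j - 2 < N L0 j" "Suc (g j - 2) = g j - 1" by auto
    then show ?case using N(2)[OF L0, of "g j - 2" j] by (simp add: m_def m'_def)
  qed
  then have mm': "well_inside X_top (lower m) (lower m')" using um by (intro lower_well_inside)
  have bm: "\<forall>\<^sub>F j in U. b L j \<le> m j" if "L \<in> \<L>" for L
    using g(2)[OF that] g_ge[of 2]
  proof eventually_elim
    case (elim j)
    then show ?case using N(2)[OF that, of "g j - 1" j] by (simp add: m_def)
  qed
  have m'a: "\<forall>\<^sub>F j in U. m' j \<le> a n j" for n
    using g(2)[OF L0] g_ge[of "n + 2"]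
  proof eventually_elim
    case (elim j)
    have "i \<le> N L0 j \<longrightarrow> a i j \<le> a n j" if "n \<le> i" for i
      using that
    proof (induction i rule: dec_induct)
      case (step i)
      then show ?case using N(2)[OF L0, of i j] by auto
    qed simp
    from this[of "g j - 2"] elim show ?case by (simp add: m'_def)
  qed
  have "fills_gap X_top ?e \<L> K"
    unfolding fills_gap_def
  proof (rule exI[of _ "lower m"], rule exI[of _ "lower m'"], intro conjI ballI allI)
    show "subcontinuum_at X_top ?e (lower m)" using um(1) by (rule subcontinuum_lower)
    show "subcontinuum_at X_top ?e (lower m')" using um(2) by (rule subcontinuum_lower)
    show "well_inside X_top (lower m) (lower m')" by (rule mm')
    fix L assume LL: "L \<in> \<L>"
    show "well_inside X_top L (lower m)"
    proof -
      obtain L' where L': "L' \<in> \<L>" "well_inside X_top L L'" using L(2)[OF LL] by blast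
      have "L' \<subseteq> lower m" using b(2)[OF L'(1)] lower_mono[OF bm[OF L'(1)]] by blast
      then show ?thesis using L'(2) unfolding well_inside_def by blast
    qed
  next
    fix n show "well_inside X_top (lower m') (K n)"
      using lower_mono[OF m'a[of n]] a(3)[of n] unfolding well_inside_def by blast
  qed
  then show False using no by contradiction
qed

section \<open>The reflection exchanging the two ends\<close>

definition flip :: "up_point \<Rightarrow> up_point" where
  "flip z = (\<lambda>f. z (\<lambda>n. unit_fun_of (\<lambda>t. app (f n) (1 - t))))"

lemma app_flip:
  "t \<in> {0..1} \<Longrightarrow> app (unit_fun_of (\<lambda>t. app f (1 - t))) t = app f (1 - t)"
  by (subst app_unit_fun_of)
    (auto intro!: continuous_intros continuous_on_compose2[OF continuous_on_app[of UNIV f]] simp: app_bounds)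

lemma flip_X:
  assumes "z \<in> X" shows "flip z \<in> X"
  unfolding X_def ulim_set_def
proof (intro CollectI allI impI)
  fix F :: "(nat \<Rightarrow> unit_fun) set" and e :: real assume F: "finite F" and e: "0 < e"
  define r where "r f n = unit_fun_of (\<lambda>t. app (f n) (1 - t))" for f :: "nat \<Rightarrow> unit_fun" and n
  have "\<forall>\<^sub>F n in U. \<exists>t\<in>{0..1}. \<forall>f\<in>r ` F. \<bar>app (f n) t - z f\<bar> < e"
    using assms F e unfolding X_def by (intro ulim_setD) auto
  then show "\<forall>\<^sub>F n in U. \<exists>t\<in>{0..1}. \<forall>f\<in>F. \<bar>app (f n) t - flip z f\<bar> < e"
  proof eventually_elim
    case (elim n)
    then obtain t where t: "t \<in> {0..1}" "\<And>f. f \<in> F \<Longrightarrow> \<bar>app (r f n) t - z (r f)\<bar> < e" by auto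
    have "\<bar>app (f n) (1 - t) - flip z f\<bar> < e" if "f \<in> F" for f
      using t(2)[OF that] app_flip[OF t(1), of "f n"] unfolding r_def flip_def by simp
    moreover have "1 - t \<in> {0..1}" using t(1) by auto
    ultimately show ?case by blast
  qed
qed

lemma flip_flip: "z \<in> X \<Longrightarrow> flip (flip z) = z"
  unfolding X_def
proof
  fix f :: "nat \<Rightarrow> unit_fun" assume z: "z \<in> ulim_set U (\<lambda>_. {0..1})"
  have "app (unit_fun_of (\<lambda>t. app (unit_fun_of (\<lambda>t. app (f n) (1 - t))) (1 - t))) t = app (f n) t"
    if "t \<in> {0..1}" for n t
    using that by (simp add: app_flip)
  then show "flip (flip z) f = z f"
    unfolding flip_def by (intro ulim_set_eq[OF z]) (simp add: always_eventually)
qed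

lemma homeomorphic_map_flip: "homeomorphic_map X_top X_top flip"
proof -
  have "continuous_on A flip" for A
    unfolding flip_def
    by (intro continuous_on_coordinatewise_then_product
        continuous_on_subset[OF continuous_on_product_coordinates] subset_UNIV)
  then have "homeomorphic_maps X_top X_top flip flip"
    unfolding homeomorphic_maps_def using flip_X flip_flip by auto
  then show ?thesis using homeomorphic_maps_map by blast
qed

lemma flip_pt0: "flip pt0 = pt1"
  unfolding flip_def pt_def by (simp add: app_flip)

end

text \<open>If \<open>U.pt0\<close> is not sent to \<open>V.pt0\<close>, then \<open>U.pt1\<close>
  is. After the reflection this second point becomes \<open>V.pt1\<close>, so the first one must
  have become \<open>V.pt0\<close>. In either case thinness is carried to the end
  \<open>V.pt0\<close>, where thickness excludes it.\<close>

lemma thin_thick_not_homeomorphic: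
  assumes U: "ultra_interval U" "thin_filter U" and V: "ultra_interval V" "thick_filter V"
  shows "\<not> top_of_set (ultra_interval.X U) homeomorphic_space top_of_set (ultra_interval.X V)"
proof
  interpret U: ultra_interval U by (rule U(1))
  interpret V: ultra_interval V by (rule V(1))
  assume "U.X_top homeomorphic_space V.X_top"
  then obtain h where h: "homeomorphic_map U.X_top V.X_top h" unfolding homeomorphic_space by blast
  let ?e = "U.pt0" and ?e' = "U.pt1"
  have e: "?e \<in> topspace U.X_top" "?e' \<in> topspace U.X_top" by (auto intro: U.pt_X)
  have thin: "thin_at V.X_top (h ?e)"
    by (rule thin_at_homeomorphic[OF h U.thin_at_pt0[OF U(2)] e(1)])
  have irr: "irreducible_between V.X_top (h ?e) (h ?e')"
    by (rule irreducible_between_homeomorphic[OF h U.irreducible_X e])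
  have he: "h ?e \<in> V.X" "h ?e' \<in> V.X"
    using e homeomorphic_imp_surjective_map[OF h] by auto
  have not_thin: "\<not> thin_at V.X_top (V.pt0)" by (rule V.not_thin_at_pt0[OF V(2)])
  then have ne: "h ?e \<noteq> V.pt0" using thin by metis
  have "irreducible_between V.X_top (V.flip (h ?e)) (V.flip (h ?e'))"
    by (rule irreducible_between_homeomorphic[OF V.homeomorphic_map_flip irr]) (use he in simp_all)
  then have "V.flip (h ?e) = V.pt0 \<or> V.flip (h ?e') = V.pt0"
    by (rule V.irreducible_endpoint) (use he V.flip_X in simp_all)
  moreover have "V.flip (h ?e) \<noteq> V.pt0"
    using thin_at_homeomorphic[OF V.homeomorphic_map_flip thin] he(1) not_thin by auto
  moreover have "h ?e' = V.pt0" using V.irreducible_endpoint[OF irr he] ne by blast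
  then have "V.flip (h ?e') = V.pt1" by (simp add: V.flip_pt0)
  moreover have "V.pt1 \<noteq> V.pt0"
    using V.pt_lower_iff[of "\<lambda>_. 1" "\<lambda>_. 0"] V.pt0_lower[of "\<lambda>_. 0"] V.eventually_False_iff by auto
  ultimately show False by metis
qed

section \<open>Isomorphic ultrapowers under CH\<close>

type_synonym box_rel = "(rat list \<times> rat) option"

text \<open>\<open>None\<close> is equality, which makes the partners under an elementary relation
  unique modulo the ultrafilters. \<open>Some (qs, e)\<close> is the solvability of a box; rational
  data keep the language countable.\<close>

fun unit_rel :: "box_rel \<Rightarrow> unit_fun list \<Rightarrow> bool" where
  "unit_rel None fs \<longleftrightarrow> (\<exists>f. fs = [f, f])"
| "unit_rel (Some (qs, e)) fs \<longleftrightarrow> (\<exists>t\<in>{0..1}. list_all2 (\<lambda>f q. \<bar>app f t - of_rat q\<bar> < of_rat e) fs qs)"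

lemma elementary_Rel:
  assumes E: "elementary R U V E" and ps: "set ps \<subseteq> E" "ps \<noteq> []"
  shows "(\<forall>\<^sub>F n in U. R i (map (\<lambda>p. fst p n) ps)) \<longleftrightarrow> (\<forall>\<^sub>F n in V. R i (map (\<lambda>p. snd p n) ps))"
proof -
  \<comment> \<open>Past the end of the list the first pair is repeated, so that every variable is
    assigned inside \<open>E\<close>.\<close>
  define p where "p x = (if x < length ps then ps ! x else hd ps)" for x
  have "range p \<subseteq> E" using ps nth_mem hd_in_set unfolding p_def by fastforce
  then have "elem_seq R U V p" using E by (simp add: elementary_def)
  then have "(\<forall>\<^sub>F n in U. sat R (Rel i [0..<length ps]) (\<lambda>x. fst (p x) n)) \<longleftrightarrow>
      (\<forall>\<^sub>F n in V. sat R (Rel i [0..<length ps]) (\<lambda>x. snd (p x) n))"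
    unfolding elem_seq_def by blast
  moreover have "map (\<lambda>x. fst (p x) n) [0..<length ps] = map (\<lambda>y. fst y n) ps"
    "map (\<lambda>x. snd (p x) n) [0..<length ps] = map (\<lambda>y. snd y n) ps" for n
    by (rule nth_equalityI; simp add: p_def)+
  ultimately show ?thesis by simp
qed

text \<open>Membership in the ultralimit is solvability of boxes around the prescribed values, which
  the relations express up to a rational approximation. Points are functions of coordinates, so
  moving them from \<open>U\<close> to \<open>V\<close> is composition with a choice \<sigma> in the
  opposite direction.\<close>

lemma transfer_point:
  assumes U: "free_ultra U" and V: "free_ultra V" and E: "elementary unit_rel U V E"
    and \<sigma>: "\<And>g. (\<sigma> g, g) \<in> E" and x: "x \<in> ultra_interval.X U"
  shows "(\<lambda>g. x (\<sigma> g)) \<in> ultra_interval.X V"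
proof -
  interpret U: ultra_interval U by standard (rule U)
  interpret V: ultra_interval V by standard (rule V)
  show ?thesis
    unfolding V.X_def ulim_set_def
  proof (intro CollectI allI impI)
    fix F :: "(nat \<Rightarrow> unit_fun) set" and e :: real
    assume F: "finite F" and e: "0 < e"
    show "\<forall>\<^sub>F n in V. \<exists>t\<in>{0..1}. \<forall>f\<in>F. \<bar>app (f n) t - x (\<sigma> f)\<bar> < e"
    proof (cases "F = {}")
      case True
      have "\<exists>t::real. t \<in> {0..1}" by (intro exI[of _ 0]) simp
      then show ?thesis using True by (auto intro: always_eventually)
    next
      case False
      obtain gs where gs: "set gs = F" using F finite_list by blast
      \<comment> \<open>The centres \<open>q\<close> will be within \<open>e' / 2\<close> of the
        true values. An approximation within \<open>e' / 2\<close> then lies in the box of radius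
        \<open>e'\<close>, and the box stays within \<open>e' + e' / 2 < e\<close> of the true
        values.\<close>
      obtain e' where e': "0 < e'" "of_rat e' < e / 2"
        using of_rat_dense[of 0 "e / 2"] e by auto
      have "\<exists>q. \<bar>of_rat q - x (\<sigma> g)\<bar> < of_rat e' / 2" for g
      proof -
        have "x (\<sigma> g) - of_rat e' / 2 < x (\<sigma> g) + of_rat e' / 2" using e'(1) by simp
        then obtain q where "x (\<sigma> g) - of_rat e' / 2 < of_rat q" "of_rat q < x (\<sigma> g) + of_rat e' / 2"
          using of_rat_dense by blast
        then have "\<bar>of_rat q - x (\<sigma> g)\<bar> < of_rat e' / 2" by linarith
        then show ?thesis by (rule exI[of _ q])
      qed
      then obtain q where q: "\<And>g. \<bar>of_rat (q g) - x (\<sigma> g)\<bar> < of_rat e' / 2" by metis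
      define ps where "ps = map (\<lambda>g. (\<sigma> g, g)) gs"
      have ps: "set ps \<subseteq> E" "ps \<noteq> []" using \<sigma> gs False by (auto simp: ps_def)
      define i where "i = Some (map q gs, e')"
      have "\<forall>\<^sub>F n in U. \<exists>t\<in>{0..1}. \<forall>f\<in>\<sigma> ` F. \<bar>app (f n) t - x f\<bar> < of_rat e' / 2"
        using x F e'(1) unfolding U.X_def by (intro ulim_setD) auto
      then have "\<forall>\<^sub>F n in U. unit_rel i (map (\<lambda>p. fst p n) ps)"
      proof eventually_elim
        case (elim n)
        then obtain t where t: "t \<in> {0..1}" "\<And>g. g \<in> F \<Longrightarrow> \<bar>app (\<sigma> g n) t - x (\<sigma> g)\<bar> < of_rat e' / 2"
          by blast
        have "\<bar>app (\<sigma> g n) t - of_rat (q g)\<bar> < of_rat e'" if "g \<in> F" for g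
          using t(2)[OF that] q[of g] by linarith
        then have "list_all2 (\<lambda>f q. \<bar>app f t - of_rat q\<bar> < of_rat e') (map (\<lambda>g. \<sigma> g n) gs) (map q gs)"
          using gs by (auto simp: list_all2_map1 list_all2_map2 intro!: list_all2_same[THEN iffD2])
        then show ?case using t(1) by (auto simp: i_def ps_def comp_def)
      qed
      then have "\<forall>\<^sub>F n in V. unit_rel i (map (\<lambda>p. snd p n) ps)"
        using elementary_Rel[OF E ps] by blast
      then show ?thesis
      proof eventually_elim
        case (elim n)
        then obtain t where t: "t \<in> {0..1}"
          "list_all2 (\<lambda>f q. \<bar>app f t - of_rat q\<bar> < of_rat e') (map (\<lambda>g. g n) gs) (map q gs)"
          by (auto simp: i_def ps_def comp_def)
        then have bnd: "\<bar>app (g n) t - of_rat (q g)\<bar> < of_rat e'" if "g \<in> F" for g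
          using gs that by (auto simp: list_all2_map1 list_all2_map2 list_all2_same)
        have "\<bar>app (g n) t - x (\<sigma> g)\<bar> < e" if "g \<in> F" for g
        proof -
          have "\<bar>app (g n) t - of_rat (q g)\<bar> < of_rat e'" using bnd that by blast
          then show ?thesis using q[of g] e'(2) by linarith
        qed
        then show ?case using t(1) by blast
      qed
    qed
  qed
qed

lemma elementary_fst_unique:
  assumes "elementary unit_rel U V E" "(f, g) \<in> E" "(f', g) \<in> E"
  shows "\<forall>\<^sub>F n in U. f n = f' n"
  using elementary_Rel[OF assms(1), of "[(f, g), (f', g)]" None] assms(2,3)
  by (simp add: eq_commute[of "f' _"])

text \<open>\<sigma> and \<tau> are mutually inverse modulo the ultrafilters, and points of the
  ultralimits do not distinguish sequences that agree almost everywhere.\<close>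

lemma X_homeomorphic_if_elementary:
  assumes U: "free_ultra U" and V: "free_ultra V" and E: "elementary unit_rel U V E"
    and tot: "\<And>f. \<exists>g. (f, g) \<in> E" "\<And>g. \<exists>f. (f, g) \<in> E"
  shows "top_of_set (ultra_interval.X U) homeomorphic_space top_of_set (ultra_interval.X V)"
proof -
  interpret U: ultra_interval U by standard (rule U)
  interpret V: ultra_interval V by standard (rule V)
  obtain \<sigma> where \<sigma>: "\<And>g. (\<sigma> g, g) \<in> E" using tot(2) by metis
  obtain \<tau> where \<tau>: "\<And>f. (f, \<tau> f) \<in> E" using tot(1) by metis
  have E': "elementary unit_rel V U (E\<inverse>)" using E by (rule elementary_converse)
  have \<tau>': "(\<tau> f, f) \<in> E\<inverse>" for f using \<tau> by simp
  have cont: "continuous_on A (\<lambda>x g. x (s g))" for A :: "up_point set" and s :: "(nat \<Rightarrow> unit_fun) \<Rightarrow> _"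
    by (intro continuous_on_coordinatewise_then_product
        continuous_on_subset[OF continuous_on_product_coordinates] subset_UNIV)
  have "x (\<sigma> (\<tau> f)) = x f" if "x \<in> U.X" for x f
  proof (rule U.ulim_set_eq[OF that[unfolded U.X_def]])
    have "\<forall>\<^sub>F n in U. \<sigma> (\<tau> f) n = f n" using E \<sigma> \<tau> by (rule elementary_fst_unique)
    then show "\<forall>\<^sub>F n in U. \<forall>t\<in>{0..1}. app (\<sigma> (\<tau> f) n) t = app (f n) t" by eventually_elim simp
  qed
  moreover have "y (\<tau> (\<sigma> g)) = y g" if "y \<in> V.X" for y g
  proof (rule V.ulim_set_eq[OF that[unfolded V.X_def]])
    have "\<forall>\<^sub>F n in V. \<tau> (\<sigma> g) n = g n"
      by (rule elementary_fst_unique[OF E' \<tau>']) (use \<sigma> in simp)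
    then show "\<forall>\<^sub>F n in V. \<forall>t\<in>{0..1}. app (\<tau> (\<sigma> g) n) t = app (g n) t" by eventually_elim simp
  qed
  moreover have "(\<lambda>g. x (\<sigma> g)) \<in> V.X" if "x \<in> U.X" for x using U V E \<sigma> that by (rule transfer_point)
  moreover have "(\<lambda>f. y (\<tau> f)) \<in> U.X" if "y \<in> V.X" for y using V U E' \<tau>' that by (rule transfer_point)
  ultimately have "homeomorphic_maps (top_of_set U.X) (top_of_set V.X) (\<lambda>x g. x (\<sigma> g)) (\<lambda>y f. y (\<tau> f))"
    unfolding homeomorphic_maps_def by (auto simp: cont)
  then show ?thesis unfolding homeomorphic_space_def by blast
qed

lemma app_eq_iff_rat: "f = g \<longleftrightarrow> (\<forall>q. app f (of_rat q) = app g (of_rat q))"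
proof
  assume eq: "\<forall>q. app f (of_rat q) = app g (of_rat q)"
  have "app f t = app g t" for t
  proof -
    have "closed {t. app f t = app g t}" by (intro closed_Collect_eq continuous_on_app)
    moreover have "\<rat> \<subseteq> {t. app f t = app g t}" using eq by (auto simp: Rats_def)
    ultimately have "closure \<rat> \<subseteq> {t. app f t = app g t}" by (rule closure_minimal[rotated])
    then show ?thesis using Rats_closure_real by auto
  qed
  then show "f = g" by (simp add: app_inject[symmetric] fun_eq_iff)
qed simp

text \<open>A continuous map is determined by its values at rationals, and a real by the rationals
  above it; a sequence of maps thus becomes a subset of a countable set of triples.\<close>

lemma card_unit_fun_seq: "|UNIV :: (nat \<Rightarrow> unit_fun) set| \<le>o ctwo ^c natLeq"
proof -
  define cut where "cut f = {(n, q, p). app (f n) (of_rat q) < of_rat p}" for f :: "nat \<Rightarrow> unit_fun"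
  have "inj cut"
  proof (rule injI)
    fix f g assume eq: "cut f = cut g"
    have iff: "app (f n) (of_rat q) < of_rat p \<longleftrightarrow> app (g n) (of_rat q) < of_rat p" for n q p
    proof -
      have "(n, q, p) \<in> cut f \<longleftrightarrow> (n, q, p) \<in> cut g" using eq by simp
      then show ?thesis by (simp add: cut_def)
    qed
    have "app (f n) (of_rat q) = app (g n) (of_rat q)" for n q
    proof (rule antisym)
      show "app (f n) (of_rat q) \<le> app (g n) (of_rat q)"
        by (rule ccontr) (metis not_le iff of_rat_dense order_less_asym)
      show "app (g n) (of_rat q) \<le> app (f n) (of_rat q)"
        by (rule ccontr) (metis not_le iff of_rat_dense order_less_asym)
    qed
    then show "f = g" by (simp add: fun_eq_iff[of f g] app_eq_iff_rat)
  qed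
  moreover have "inj ((`) (to_nat :: nat \<times> rat \<times> rat \<Rightarrow> nat))"
    by (simp add: inj_image_eq_iff inj_def)
  ultimately have "inj ((`) to_nat \<circ> cut)" by (intro inj_compose)
  then have "|UNIV :: (nat \<Rightarrow> unit_fun) set| \<le>o |UNIV :: nat set set|"
    unfolding card_of_ordLeq[symmetric] by blast
  also have "|UNIV :: nat set set| =o |UNIV :: real set|"
    using nat_sets_eqpoll_reals card_of_ordIsoI unfolding eqpoll_def by blast
  also note card_real
  finally show ?thesis .
qed

lemma CH_imp_X_homeomorphic:
  assumes CH: "Continuum_Hypothesis" and U: "free_ultra U" and V: "free_ultra V"
  shows "top_of_set (ultra_interval.X U) homeomorphic_space top_of_set (ultra_interval.X V)"
proof -
  have "|UNIV :: (nat \<Rightarrow> unit_fun) set| \<le>o cardSuc natLeq"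
    using card_unit_fun_seq CH unfolding Continuum_Hypothesis_def by (rule ordLeq_ordIso_trans)
  then show ?thesis
    using back_and_forth[OF U V, of unit_rel] X_homeomorphic_if_elementary[OF U V] by metis
qed

section \<open>Standard subcontinua as ultralimits of unit intervals\<close>

lemma unit_maps_iff:
  "g \<in> unit_maps half_line \<longleftrightarrow>
     g \<in> extensional {0..} \<and> continuous_on {0..} g \<and> (\<forall>t\<ge>0. g t \<in> {0..1})"
  unfolding unit_maps_def continuous_map_in_subtopology by (simp add: Pi_iff Ball_def)

lemma unit_maps_range: "f \<in> unit_maps Z \<Longrightarrow> t \<in> topspace Z \<Longrightarrow> f t \<in> {0..1}"
  unfolding unit_maps_def continuous_map_in_subtopology by (simp add: Pi_iff)

lemma topspace_unit_cube: "topspace (unit_cube Z) = Pi\<^sub>E (unit_maps Z) (\<lambda>_. {0..1})"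
  by (simp add: unit_cube_def)

text \<open>A basic open set of the cube restricts finitely many coordinates, and the least of their
  radii serves for all of them.\<close>

lemma in_unit_cube_closure_iff:
  assumes A: "A \<subseteq> topspace Z"
  shows "p \<in> unit_cube Z closure_of (stone_cech_map Z ` A) \<longleftrightarrow>
    p \<in> topspace (unit_cube Z) \<and>
    (\<forall>F e. finite F \<and> F \<subseteq> unit_maps Z \<and> 0 < e \<longrightarrow> (\<exists>t\<in>A. \<forall>f\<in>F. \<bar>f t - p f\<bar> < e))"
    (is "?L \<longleftrightarrow> ?R")
proof
  assume L: ?L
  then have p: "p \<in> topspace (unit_cube Z)" by (rule in_closure_of[THEN iffD1, THEN conjunct1])
  have "\<exists>t\<in>A. \<forall>f\<in>F. \<bar>f t - p f\<bar> < e" if F: "finite F" "F \<subseteq> unit_maps Z" and e: "0 < e" for F e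
  proof -
    define W where "W = Pi\<^sub>E (unit_maps Z) (\<lambda>f. if f \<in> F then {0..1} \<inter> {s. \<bar>s - p f\<bar> < e} else {0..1})"
    have "openin (top_of_set {0..1}) ({0..1} \<inter> {s. \<bar>s - p f\<bar> < e})" for f
      by (intro openin_open_Int open_Collect_less continuous_intros)
    then have "openin (unit_cube Z) W"
      unfolding W_def unit_cube_def openin_PiE_gen using F(1)
      by (auto intro!: disjI2 elim!: rev_finite_subset)
    moreover have "p \<in> W"
      using p e unfolding W_def topspace_unit_cube by (auto simp: PiE_iff)
    ultimately obtain y where "y \<in> stone_cech_map Z ` A" "y \<in> W"
      using L unfolding in_closure_of by blast
    then obtain t where t: "t \<in> A" "stone_cech_map Z t \<in> W" by blast
    have "\<bar>f t - p f\<bar> < e" if "f \<in> F" for f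
    proof -
      have f: "f \<in> unit_maps Z" using F(2) that by blast
      then have "stone_cech_map Z t f \<in> {0..1} \<inter> {s. \<bar>s - p f\<bar> < e}"
        using t(2) that unfolding W_def by (auto simp: PiE_iff)
      then show ?thesis using f by (simp add: stone_cech_map_def)
    qed
    then show ?thesis using t(1) by blast
  qed
  then show ?R using p by blast
next
  assume R: ?R
  show ?L
    unfolding in_closure_of
  proof (intro conjI allI impI)
    show "p \<in> topspace (unit_cube Z)" using R by blast
    fix W assume W: "p \<in> W \<and> openin (unit_cube Z) W"
    then obtain V where V: "finite {f \<in> unit_maps Z. V f \<noteq> topspace (top_of_set {0..1::real})}"
      "\<And>f. f \<in> unit_maps Z \<Longrightarrow> openin (top_of_set {0..1::real}) (V f)"
      "p \<in> Pi\<^sub>E (unit_maps Z) V" "Pi\<^sub>E (unit_maps Z) V \<subseteq> W"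
      unfolding unit_cube_def openin_product_topology_alt by meson
    define F where "F = {f \<in> unit_maps Z. V f \<noteq> topspace (top_of_set {0..1::real})}"
    have "\<exists>d>0. \<forall>s\<in>{0..1}. \<bar>s - p f\<bar> < d \<longrightarrow> s \<in> V f" if "f \<in> F" for f
    proof -
      have "f \<in> unit_maps Z" using that by (simp add: F_def)
      then have "p f \<in> V f" "openin (top_of_set {0..1}) (V f)" using V(2,3) by auto
      then show ?thesis unfolding openin_euclidean_subtopology_iff dist_real_def by blast
    qed
    then obtain d where d: "\<And>f. f \<in> F \<Longrightarrow> 0 < d f"
      "\<And>f s. f \<in> F \<Longrightarrow> s \<in> {0..1} \<Longrightarrow> \<bar>s - p f\<bar> < d f \<Longrightarrow> s \<in> V f" by metis
    have finF: "finite F" using V(1) by (simp add: F_def)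
    \<comment> \<open>The element 1 covers the case that no coordinate is restricted.\<close>
    define e where "e = Min (insert 1 (d ` F))"
    have e: "0 < e" "\<And>f. f \<in> F \<Longrightarrow> e \<le> d f" using d(1) finF by (auto simp: e_def)
    have "F \<subseteq> unit_maps Z" by (auto simp: F_def)
    then have "\<exists>t\<in>A. \<forall>f\<in>F. \<bar>f t - p f\<bar> < e"
      using finF e(1) by (intro R[THEN conjunct2, rule_format] conjI)
    then obtain t where t: "t \<in> A" "\<And>f. f \<in> F \<Longrightarrow> \<bar>f t - p f\<bar> < e" by blast
    have "stone_cech_map Z t \<in> Pi\<^sub>E (unit_maps Z) V"
    proof (rule PiE_I)
      fix f assume f: "f \<in> unit_maps Z"
      have ft: "f t \<in> {0..1}"
        using f t(1) A by (intro unit_maps_range) auto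
      have "f t \<in> V f"
      proof (cases "f \<in> F")
        case True
        then show ?thesis using d(2)[OF True ft] t(2)[OF True] e(2)[OF True] by simp
      next
        case False
        then show ?thesis using f ft by (simp add: F_def)
      qed
      then show "stone_cech_map Z t f \<in> V f" using f by (simp add: stone_cech_map_def)
    qed (simp add: stone_cech_map_def)
    then show "\<exists>y. y \<in> stone_cech_map Z ` A \<and> y \<in> W" using t(1) V(4) by blast
  qed
qed

lemma stone_cech_closure:
  assumes A: "A \<subseteq> topspace Z"
  shows "stone_cech Z closure_of (stone_cech_map Z ` A) = unit_cube Z closure_of (stone_cech_map Z ` A)"
proof -
  let ?C = "unit_cube Z closure_of (stone_cech_map Z ` topspace Z)"
  have "stone_cech_map Z ` topspace Z \<subseteq> topspace (unit_cube Z)"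
  proof
    fix q assume "q \<in> stone_cech_map Z ` topspace Z"
    then obtain t where t: "t \<in> topspace Z" "q = stone_cech_map Z t" by blast
    have "f t \<in> {0..1}" if "f \<in> unit_maps Z" for f
      using that t(1) by (rule unit_maps_range)
    then show "q \<in> topspace (unit_cube Z)" by (simp add: t(2) topspace_unit_cube stone_cech_map_def)
  qed
  then have sub: "stone_cech_map Z ` A \<subseteq> ?C"
    using A closure_of_subset by (metis image_mono subset_trans)
  then have "?C \<inter> stone_cech_map Z ` A = stone_cech_map Z ` A" by blast
  moreover have "unit_cube Z closure_of (stone_cech_map Z ` A) \<subseteq> ?C"
    using A by (intro closure_of_mono image_mono)
  ultimately show ?thesis unfolding stone_cech_def closure_of_subtopology by auto
qed

section \<open>The subcontinuum of one interval sequence and one ultrafilter\<close>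

locale interval_sequence =
  fixes c d :: "nat \<Rightarrow> real" and u :: "nat set set"
  assumes discrete: "discrete_interval_sequence c d" and u: "nonprincipal_ultrafilter u"
begin

abbreviation "\<U> \<equiv> set_filter u"

sublocale ultra_interval \<U>
  by standard (rule free_ultra_set_filter[OF u])

lemma ev_iff: "eventually P \<U> \<longleftrightarrow> {n. P n} \<in> u"
  using u by (intro eventually_set_filter) (simp add: nonprincipal_ultrafilter_def)

lemma cd: "0 \<le> c n" "c n < d n" "0 \<le> d n"
  using discrete by (auto simp: discrete_interval_sequence_def) (meson less_eq_real_def order_trans)

lemma intervals_half_line: "(\<Union>n\<in>A. {c n..d n}) \<subseteq> topspace half_line"
proof -
  have "{c n..d n} \<subseteq> topspace half_line" for n using cd(1)[of n] by auto
  then show ?thesis by (rule UN_least)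
qed

definition S :: "((real \<Rightarrow> real) \<Rightarrow> real) set" where
  "S = interval_ultralimit c d u"

text \<open>What happens somewhere in every member of an ultrafilter happens almost everywhere. This
  turns the intersection of closures over \<open>u\<close> into one eventual statement of the same
  shape as \<open>ulim_set\<close>.\<close>

lemma S_iff:
  "p \<in> S \<longleftrightarrow> p \<in> topspace (unit_cube half_line) \<and>
    (\<forall>F e. finite F \<and> F \<subseteq> unit_maps half_line \<and> 0 < e \<longrightarrow>
       (\<forall>\<^sub>F n in \<U>. \<exists>t\<in>{c n..d n}. \<forall>f\<in>F. \<bar>f t - p f\<bar> < e))"
proof -
  have uf: "ultrafilter u" using u by (simp add: nonprincipal_ultrafilter_def)
  note sub = intervals_half_line
  have meets_iff: "(\<forall>A\<in>u. \<exists>n\<in>A. P n) \<longleftrightarrow> eventually P \<U>" for P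
  proof
    assume all: "\<forall>A\<in>u. \<exists>n\<in>A. P n"
    show "eventually P \<U>"
    proof (rule ccontr)
      assume "\<not> eventually P \<U>"
      then have "\<forall>\<^sub>F n in \<U>. \<not> P n" by (rule not_eventually_iff[THEN iffD1])
      then have "{n. \<not> P n} \<in> u" by (rule ev_iff[THEN iffD1])
      with all have "\<exists>n\<in>{n. \<not> P n}. P n" by (rule bspec)
      then show False by simp
    qed
  next
    assume "eventually P \<U>"
    show "\<forall>A\<in>u. \<exists>n\<in>A. P n"
    proof
      fix A assume "A \<in> u"
      then have "\<forall>\<^sub>F n in \<U>. n \<in> A" by (simp add: ev_iff)
      with \<open>eventually P \<U>\<close> have "\<forall>\<^sub>F n in \<U>. n \<in> A \<and> P n" by eventually_elim simp
      then show "\<exists>n\<in>A. P n" using eventually_happens'[OF U_ne] by blast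
    qed
  qed
  have "p \<in> S \<longleftrightarrow> (\<forall>A\<in>u. p \<in> unit_cube half_line closure_of
      (stone_cech_map half_line ` (\<Union>n\<in>A. {c n..d n})))"
    unfolding S_def interval_ultralimit_def using stone_cech_closure[OF sub] by auto
  also have "\<dots> \<longleftrightarrow> (\<forall>A\<in>u. p \<in> topspace (unit_cube half_line) \<and>
    (\<forall>F e. finite F \<and> F \<subseteq> unit_maps half_line \<and> 0 < e \<longrightarrow>
      (\<exists>t\<in>(\<Union>n\<in>A. {c n..d n}). \<forall>f\<in>F. \<bar>f t - p f\<bar> < e)))"
    unfolding in_unit_cube_closure_iff[OF sub] ..
  also have "\<dots> \<longleftrightarrow> p \<in> topspace (unit_cube half_line) \<and>
    (\<forall>F e. finite F \<and> F \<subseteq> unit_maps half_line \<and> 0 < e \<longrightarrow>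
      (\<forall>A\<in>u. \<exists>n\<in>A. \<exists>t\<in>{c n..d n}. \<forall>f\<in>F. \<bar>f t - p f\<bar> < e))"
  proof -
    have "u \<noteq> {}" using uf by (auto simp: ultrafilter_def)
    then show ?thesis by auto
  qed
  also have "\<dots> \<longleftrightarrow> p \<in> topspace (unit_cube half_line) \<and>
    (\<forall>F e. finite F \<and> F \<subseteq> unit_maps half_line \<and> 0 < e \<longrightarrow>
       (\<forall>\<^sub>F n in \<U>. \<exists>t\<in>{c n..d n}. \<forall>f\<in>F. \<bar>f t - p f\<bar> < e))"
    unfolding meets_iff ..
  finally show ?thesis .
qed

lemma S_agree:
  assumes p: "p \<in> S" and f: "f \<in> unit_maps half_line" and g: "g \<in> unit_maps half_line"
    and eq: "\<And>n t. t \<in> {c n..d n} \<Longrightarrow> f t = g t"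
  shows "p f = p g"
proof (rule ccontr)
  assume "p f \<noteq> p g"
  then have "\<forall>\<^sub>F n in \<U>. \<exists>t\<in>{c n..d n}. \<forall>k\<in>{f, g}. \<bar>k t - p k\<bar> < \<bar>p f - p g\<bar> / 2"
    using p f g by (intro S_iff[THEN iffD1, THEN conjunct2, rule_format]) auto
  then obtain n t where t: "t \<in> {c n..d n}" "\<bar>f t - p f\<bar> < \<bar>p f - p g\<bar> / 2" "\<bar>g t - p g\<bar> < \<bar>p f - p g\<bar> / 2"
    using eventually_happens'[OF U_ne] by blast
  have "\<bar>p f - p g\<bar> \<le> \<bar>f t - p f\<bar> + \<bar>g t - p g\<bar>" unfolding eq[OF t(1)] by linarith
  also have "\<dots> < \<bar>p f - p g\<bar> / 2 + \<bar>p f - p g\<bar> / 2" using t(2,3) by (rule add_strict_mono)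
  finally show False by simp
qed

definition lin :: "nat \<Rightarrow> real \<Rightarrow> real" where
  "lin n t = c n + t * (d n - c n)"

lemma lin_range: "t \<in> {0..1} \<Longrightarrow> lin n t \<in> {c n..d n}"
proof -
  assume t: "t \<in> {0..1}"
  have "0 \<le> t * (d n - c n)" "t * (d n - c n) \<le> d n - c n"
    using t cd(2)[of n] mult_left_le_one_le[of "d n - c n" t] by auto
  then show ?thesis by (simp add: lin_def)
qed

lemma lin_inv: "s \<in> {c n..d n} \<Longrightarrow> (s - c n) / (d n - c n) \<in> {0..1}"
  "lin n ((s - c n) / (d n - c n)) = s"
  using cd(2)[of n] by (auto simp: lin_def divide_simps)

lemma discrete_nbhd:
  assumes "0 \<le> x"
  obtains W where "openin half_line W" "x \<in> W"
    "\<forall>m n s t. s \<in> W \<longrightarrow> t \<in> W \<longrightarrow> s \<in> {c m..d m} \<longrightarrow> t \<in> {c n..d n} \<longrightarrow> m = n"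
proof -
  have "x \<in> topspace half_line" using assms by simp
  then obtain W where W: "openin half_line W \<and> x \<in> W \<and>
      (\<forall>m n. W \<inter> {c m..d m} \<noteq> {} \<and> W \<inter> {c n..d n} \<noteq> {} \<longrightarrow> m = n)"
    using discrete[unfolded discrete_interval_sequence_def, THEN conjunct2] by (elim ballE exE) auto
  have uniq: "m = n" if "s \<in> W" "t \<in> W" "s \<in> {c m..d m}" "t \<in> {c n..d n}" for m n s t
  proof -
    have "W \<inter> {c m..d m} \<noteq> {}" using that(1,3) by (metis IntI empty_iff)
    moreover have "W \<inter> {c n..d n} \<noteq> {}" using that(2,4) by (metis IntI empty_iff)
    ultimately show ?thesis using W by simp
  qed
  show thesis
  proof (rule that)
    show "\<forall>m n s t. s \<in> W \<longrightarrow> t \<in> W \<longrightarrow> s \<in> {c m..d m} \<longrightarrow> t \<in> {c n..d n} \<longrightarrow> m = n"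
      by (intro allI impI) (rule uniq)
  qed (use W in simp_all)
qed

lemma disjoint_intervals:
  assumes "t \<in> {c m..d m}" "t \<in> {c n..d n}" shows "m = n"
proof -
  have "0 \<le> t" using assms(1) cd(1)[of m] by auto
  then obtain W where W: "openin half_line W" "t \<in> W"
    "\<forall>m n s t. s \<in> W \<longrightarrow> t \<in> W \<longrightarrow> s \<in> {c m..d m} \<longrightarrow> t \<in> {c n..d n} \<longrightarrow> m = n"
    by (rule discrete_nbhd)
  show ?thesis using W(3)[rule_format, OF W(2,2) assms] .
qed

text \<open>Discreteness makes the family locally finite. Closedness is what Tietze's theorem
  requires of the domain.\<close>

lemma closedin_union: "closedin half_line (\<Union>n. {c n..d n})"
  unfolding closedin_def
proof
  show "(\<Union>n. {c n..d n}) \<subseteq> topspace half_line" by (rule intervals_half_line)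
  show "openin half_line (topspace half_line - (\<Union>n. {c n..d n}))"
  proof (subst openin_subopen, intro ballI)
    fix x assume x: "x \<in> topspace half_line - (\<Union>n. {c n..d n})"
    then have "0 \<le> x" by simp
    then obtain W where W: "openin half_line W" "x \<in> W"
      "\<forall>m n s t. s \<in> W \<longrightarrow> t \<in> W \<longrightarrow> s \<in> {c m..d m} \<longrightarrow> t \<in> {c n..d n} \<longrightarrow> m = n"
      by (rule discrete_nbhd)
    have "\<exists>n. W \<inter> (\<Union>n. {c n..d n}) \<subseteq> {c n..d n}"
    proof (cases "W \<inter> (\<Union>n. {c n..d n}) = {}")
      case False
      then obtain s n where s: "s \<in> W" "s \<in> {c n..d n}" by blast
      have "t \<in> {c n..d n}" if "t \<in> W" "t \<in> {c m..d m}" for t m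
        using W(3)[rule_format, OF s(1) that(1) s(2) that(2)] that(2) by simp
      then show ?thesis by (intro exI[of _ n]) blast
    qed simp
    then obtain n where n: "W \<inter> (\<Union>n. {c n..d n}) \<subseteq> {c n..d n}" ..
    have "closedin half_line {c n..d n}"
      using cd(1)[of n] by (intro closed_subset) auto
    then have "openin half_line (W - {c n..d n})" using W(1) by (intro openin_diff)
    moreover have "x \<in> W - {c n..d n}" using x W(2) by blast
    moreover have "W - {c n..d n} \<subseteq> topspace half_line - (\<Union>n. {c n..d n})"
      using n openin_subset[OF W(1)] by blast
    ultimately show "\<exists>T. openin half_line T \<and> x \<in> T \<and> T \<subseteq> topspace half_line - (\<Union>n. {c n..d n})"
      by (intro exI[of _ "W - {c n..d n}"] conjI)
  qed
qed

lemma openin_interval: "openin (top_of_set (\<Union>n. {c n..d n})) {c n..d n}"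
proof (subst openin_subopen, intro ballI)
  fix x assume x: "x \<in> {c n..d n}"
  then have "0 \<le> x" using cd(1)[of n] by auto
  then obtain W where W: "openin half_line W" "x \<in> W"
    "\<forall>m n s t. s \<in> W \<longrightarrow> t \<in> W \<longrightarrow> s \<in> {c m..d m} \<longrightarrow> t \<in> {c n..d n} \<longrightarrow> m = n"
    by (rule discrete_nbhd)
  obtain O' where O': "open O'" "W = {0..} \<inter> O'" using W(1) by (auto simp: openin_open)
  have "(\<Union>n. {c n..d n}) \<inter> O' \<subseteq> {c n..d n}"
  proof
    fix t assume "t \<in> (\<Union>n. {c n..d n}) \<inter> O'"
    then obtain m where m: "t \<in> {c m..d m}" "t \<in> O'" by blast
    moreover have "0 \<le> t" using m(1) cd(1)[of m] by auto
    ultimately have "t \<in> W" by (simp add: O'(2))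
    then show "t \<in> {c n..d n}" using W(3)[rule_format, OF W(2) _ x m(1)] m(1) by simp
  qed
  moreover have "x \<in> (\<Union>n. {c n..d n}) \<inter> O'" using x W(2) O'(2) by blast
  moreover have "openin (top_of_set (\<Union>n. {c n..d n})) ((\<Union>n. {c n..d n}) \<inter> O')"
    using O'(1) by (rule openin_open_Int)
  ultimately show "\<exists>T. openin (top_of_set (\<Union>n. {c n..d n})) T \<and> x \<in> T \<and> T \<subseteq> {c n..d n}"
    by (intro exI[of _ "(\<Union>n. {c n..d n}) \<inter> O'"] conjI)
qed

text \<open>Each interval is relatively open in the union, so the rescaled maps paste together, and
  Tietze extends the result. Every coordinate of the ultralimit thus comes from a map on the half
  line.\<close>

lemma extension_exists:
  "\<exists>g\<in>unit_maps half_line. \<forall>n. \<forall>t\<in>{0..1}. g (lin n t) = app (f n) t"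
proof -
  define h where "h s = app (f (THE n. s \<in> {c n..d n})) ((s - c (THE n. s \<in> {c n..d n})) /
    (d (THE n. s \<in> {c n..d n}) - c (THE n. s \<in> {c n..d n})))" for s
  have the: "(THE n. s \<in> {c n..d n}) = n" if "s \<in> {c n..d n}" for s n
    using that disjoint_intervals by (intro the_equality)
  have h: "h s = app (f n) ((s - c n) / (d n - c n))" if "s \<in> {c n..d n}" for s n
    unfolding h_def the[OF that] ..
  have "continuous_map (top_of_set (\<Union>n. {c n..d n})) euclidean h"
  proof (rule pasting_lemma[where I = UNIV and T = "\<lambda>n. {c n..d n}"
        and f = "\<lambda>n s. app (f n) ((s - c n) / (d n - c n))"])
    fix n
    show "openin (top_of_set (\<Union>n. {c n..d n})) {c n..d n}" by (rule openin_interval)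
    have "continuous_on A (\<lambda>s. app (f n) ((s - c n) / (d n - c n)))" for A
      using cd(2)[of n]
      by (intro continuous_on_compose2[OF continuous_on_app[of UNIV]] continuous_intros) auto
    then show "continuous_map (subtopology (top_of_set (\<Union>n. {c n..d n})) {c n..d n}) euclidean
        (\<lambda>s. app (f n) ((s - c n) / (d n - c n)))"
      by (simp add: subtopology_subtopology)
  next
    fix i j x assume "x \<in> topspace (top_of_set (\<Union>n. {c n..d n})) \<inter> {c i..d i} \<inter> {c j..d j}"
    then have "i = j" using disjoint_intervals by blast
    then show "app (f i) ((x - c i) / (d i - c i)) = app (f j) ((x - c j) / (d j - c j))" by simp
  next
    fix x assume "x \<in> topspace (top_of_set (\<Union>n. {c n..d n}))"
    then obtain n where "x \<in> {c n..d n}" by auto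
    then show "\<exists>j. j \<in> UNIV \<and> x \<in> {c j..d j} \<and> h x = app (f j) ((x - c j) / (d j - c j))"
      using h by blast
  qed
  then have "continuous_on (\<Union>n. {c n..d n}) h" by simp
  moreover have "h x \<in> cbox 0 1" for x unfolding h_def by (simp add: app_bounds)
  ultimately obtain g where g: "continuous_on {0..} g" "\<And>x. x \<in> (\<Union>n. {c n..d n}) \<Longrightarrow> g x = h x"
    "\<And>x. x \<in> {0..} \<Longrightarrow> g x \<in> cbox 0 1"
    using Tietze_closed_interval_1[OF _ closedin_union, of h 0 1] by auto
  define g' where "g' = restrict g {0..}"
  have "continuous_on {0..} g'" using g(1) by (rule continuous_on_eq) (simp add: g'_def)
  then have "g' \<in> unit_maps half_line" using g(3) by (auto simp: unit_maps_iff g'_def)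
  moreover have "g' (lin n t) = app (f n) t" if t: "t \<in> {0..1}" for n t
  proof -
    have l: "lin n t \<in> {c n..d n}" using t by (rule lin_range)
    then have "g' (lin n t) = h (lin n t)" using g(2) cd(1)[of n] by (auto simp: g'_def)
    also have "\<dots> = app (f n) ((lin n t - c n) / (d n - c n))" using l by (rule h)
    also have "(lin n t - c n) / (d n - c n) = t" using cd(2)[of n] by (simp add: lin_def)
    finally show ?thesis .
  qed
  ultimately show ?thesis by blast
qed

text \<open>Extending and restricting maps are inverse to each other up to values off the intervals,
  which the points of either space do not see. \<Phi> and \<Psi> are composition with these
  operations.\<close>

lemma S_homeomorphic_X:
  "subtopology (stone_cech half_line) S homeomorphic_space X_top"
proof -
  obtain ext where ext: "\<And>f. ext f \<in> unit_maps half_line"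
    "\<And>f n t. t \<in> {0..1} \<Longrightarrow> ext f (lin n t) = app (f n) t"
    using extension_exists by metis
  define res where "res g n = unit_fun_of (\<lambda>t. g (lin n t))" for g :: "real \<Rightarrow> real" and n
  have res: "app (res g n) t = g (lin n t)" if g: "g \<in> unit_maps half_line" and t: "t \<in> {0..1}" for g n t
  proof -
    have nonneg: "lin n s \<in> {0..}" if "s \<in> {0..1}" for s
      using lin_range[OF that, of n] cd(1)[of n] by auto
    have lin: "continuous_on {0..1} (lin n)" unfolding lin_def by (intro continuous_intros)
    have "continuous_on {0..} g" using g by (simp add: unit_maps_iff)
    then have "continuous_on {0..1} (\<lambda>t. g (lin n t))"
      using lin by (rule continuous_on_compose2) (rule image_subsetI, rule nonneg)
    moreover have "g (lin n t) \<in> {0..1}" using g nonneg[OF t] by (simp add: unit_maps_iff)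
    ultimately show ?thesis unfolding res_def using t by (simp add: app_unit_fun_of)
  qed
  define \<Phi> where "\<Phi> p = (\<lambda>f. p (ext f))" for p :: "(real \<Rightarrow> real) \<Rightarrow> real"
  define \<Psi> where "\<Psi> x = (\<lambda>g\<in>unit_maps half_line. x (res g))" for x :: up_point
  have \<Phi>: "\<Phi> p \<in> X" if p: "p \<in> S" for p
    unfolding X_def ulim_set_def
  proof (intro CollectI allI impI)
    fix F :: "(nat \<Rightarrow> unit_fun) set" and e :: real assume "finite F" "0 < e"
    then have "\<forall>\<^sub>F n in \<U>. \<exists>t\<in>{c n..d n}. \<forall>f\<in>ext ` F. \<bar>f t - p f\<bar> < e"
      using p ext(1) by (intro S_iff[THEN iffD1, THEN conjunct2, rule_format]) auto
    then show "\<forall>\<^sub>F n in \<U>. \<exists>t\<in>{0..1}. \<forall>f\<in>F. \<bar>app (f n) t - \<Phi> p f\<bar> < e"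
    proof eventually_elim
      case (elim n)
      then obtain s where s: "s \<in> {c n..d n}" "\<And>f. f \<in> F \<Longrightarrow> \<bar>ext f s - p (ext f)\<bar> < e" by blast
      define t where "t = (s - c n) / (d n - c n)"
      have t: "t \<in> {0..1}" "lin n t = s" unfolding t_def using lin_inv s(1) by auto
      have "\<bar>app (f n) t - \<Phi> p f\<bar> < e" if "f \<in> F" for f
        using s(2)[OF that] ext(2)[OF t(1), of f n] t(2) by (simp add: \<Phi>_def)
      then show ?case using t(1) by blast
    qed
  qed
  have \<Psi>: "\<Psi> x \<in> S" if x: "x \<in> X" for x
    unfolding S_iff
  proof (intro conjI allI impI)
    show "\<Psi> x \<in> topspace (unit_cube half_line)"
      using ulim_set_bounds[OF x[unfolded X_def]] by (auto simp: topspace_unit_cube \<Psi>_def)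
    fix F :: "(real \<Rightarrow> real) set" and e :: real
    assume F: "finite F \<and> F \<subseteq> unit_maps half_line \<and> 0 < e"
    then have "\<forall>\<^sub>F n in \<U>. \<exists>t\<in>{0..1}. \<forall>f\<in>res ` F. \<bar>app (f n) t - x f\<bar> < e"
      using x unfolding X_def by (intro ulim_setD) auto
    then show "\<forall>\<^sub>F n in \<U>. \<exists>t\<in>{c n..d n}. \<forall>f\<in>F. \<bar>f t - \<Psi> x f\<bar> < e"
    proof eventually_elim
      case (elim n)
      then obtain t where t: "t \<in> {0..1}" "\<And>g. g \<in> F \<Longrightarrow> \<bar>app (res g n) t - x (res g)\<bar> < e" by blast
      have "\<bar>g (lin n t) - \<Psi> x g\<bar> < e" if "g \<in> F" for g
      proof -
        have "g \<in> unit_maps half_line" using F that by blast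
        then show ?thesis using t(2)[OF that] res[of g t n] t(1) by (simp add: \<Psi>_def)
      qed
      then show ?case using lin_range[OF t(1)] by blast
    qed
  qed
  have \<Psi>\<Phi>: "\<Psi> (\<Phi> p) = p" if p: "p \<in> S" for p
  proof
    fix g
    show "\<Psi> (\<Phi> p) g = p g"
    proof (cases "g \<in> unit_maps half_line")
      case True
      have "p (ext (res g)) = p g"
      proof (rule S_agree[OF p ext(1) True])
        fix n s assume s: "s \<in> {c n..d n}"
        show "ext (res g) s = g s"
          using ext(2)[OF lin_inv(1)[OF s], of "res g" n] res[OF True lin_inv(1)[OF s], of n]
          by (simp add: lin_inv(2))
      qed
      then show ?thesis using True by (simp add: \<Psi>_def \<Phi>_def)
    next
      case False
      \<comment> \<open>Points of the cube are extensional, so both sides are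
        \<open>undefined\<close> at an index outside \<open>unit_maps half_line\<close>.\<close>
      have "p \<in> topspace (unit_cube half_line)" using p by (rule S_iff[THEN iffD1, THEN conjunct1])
      then have "p \<in> Pi\<^sub>E (unit_maps half_line) (\<lambda>_. {0..1})" by (simp only: topspace_unit_cube)
      then have "p g = undefined" using False by (rule PiE_arb)
      then show ?thesis using False by (simp add: \<Psi>_def)
    qed
  qed
  have \<Phi>\<Psi>: "\<Phi> (\<Psi> x) = x" if x: "x \<in> X" for x
  proof
    fix f
    have "x (res (ext f)) = x f"
      by (rule ulim_set_eq[OF x[unfolded X_def]]) (simp add: res ext always_eventually)
    then show "\<Phi> (\<Psi> x) f = x f" by (simp add: \<Phi>_def \<Psi>_def ext(1))
  qed
  have S_sub: "S \<subseteq> unit_cube half_line closure_of (stone_cech_map half_line ` topspace half_line)"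
  proof -
    have "UNIV \<in> u" using u by (simp add: nonprincipal_ultrafilter_def ultrafilter_def)
    then have "S \<subseteq> stone_cech half_line closure_of (stone_cech_map half_line ` (\<Union>n\<in>UNIV. {c n..d n}))"
      unfolding S_def interval_ultralimit_def by (rule INT_lower)
    then show ?thesis
      unfolding stone_cech_closure[OF intervals_half_line]
      by (rule subset_trans[OF _ closure_of_mono[OF image_mono[OF intervals_half_line]]])
  qed
  \<comment> \<open>\<open>S\<close> lies in the compactification, so its subspace topology can be
    computed in the cube.\<close>
  have top: "subtopology (stone_cech half_line) S = subtopology (unit_cube half_line) S"
    using S_sub by (simp add: stone_cech_def subtopology_subtopology inf.absorb2)
  have "S \<subseteq> topspace (unit_cube half_line)"
    by (rule subsetI) (rule S_iff[THEN iffD1, THEN conjunct1])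
  then have S_top: "topspace (subtopology (unit_cube half_line) S) = S"
    unfolding topspace_subtopology by (rule inf.absorb2)
  have proj: "continuous_map (subtopology (unit_cube half_line) S) euclidean (\<lambda>p. p g)"
    if "g \<in> unit_maps half_line" for g
  proof (rule continuous_map_from_subtopology)
    have "continuous_map (unit_cube half_line) (top_of_set {0..1}) (\<lambda>p. p g)"
      unfolding unit_cube_def using that by (rule continuous_map_product_projection)
    then show "continuous_map (unit_cube half_line) euclidean (\<lambda>p. p g)"
      by (rule continuous_map_into_fulltopology)
  qed
  have "continuous_map (subtopology (unit_cube half_line) S) (top_of_set X) \<Phi>"
  proof -
    have "continuous_map (subtopology (unit_cube half_line) S) euclidean \<Phi>"
      unfolding euclidean_product_topology[symmetric] continuous_map_componentwise_UNIV \<Phi>_def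
      using proj ext(1) by blast
    then show ?thesis using \<Phi> S_top by (auto simp: continuous_map_in_subtopology)
  qed
  moreover have "continuous_map (top_of_set X) (subtopology (unit_cube half_line) S) \<Psi>"
  proof -
    have "continuous_map (top_of_set X) (top_of_set {0..1}) (\<lambda>x. x (res g))" for g
      unfolding continuous_map_in_subtopology
      using ulim_set_bounds unfolding X_def
      by (auto intro!: continuous_on_subset[OF continuous_on_product_coordinates])
    then have "continuous_map (top_of_set X) (unit_cube half_line) \<Psi>"
      unfolding unit_cube_def continuous_map_componentwise by (auto simp: \<Psi>_def)
    then show ?thesis using \<Psi> by (auto simp: continuous_map_in_subtopology)
  qed
  ultimately have "homeomorphic_maps (subtopology (unit_cube half_line) S) (top_of_set X) \<Phi> \<Psi>"
    unfolding homeomorphic_maps_def using \<Psi>\<Phi> \<Phi>\<Psi> S_top by auto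
  then show ?thesis unfolding top by (rule homeomorphic_maps_imp_homeomorphic_space)
qed

end

lemma discrete_even_intervals:
  "discrete_interval_sequence (\<lambda>n. 2 * real n) (\<lambda>n. 2 * real n + 1)"
  unfolding discrete_interval_sequence_def
proof (intro conjI allI ballI)
  fix x :: real assume x: "x \<in> topspace half_line"
  \<comment> \<open>An open ball of radius 1/2 cannot meet two intervals at distance at least
    1.\<close>
  have uniq: "m = n" if mn: "{0..} \<inter> ball x (1 / 2) \<inter> {2 * real m..2 * real m + 1} \<noteq> {}"
    "{0..} \<inter> ball x (1 / 2) \<inter> {2 * real n..2 * real n + 1} \<noteq> {}" for m n
  proof -
    obtain s t where s: "\<bar>x - s\<bar> < 1 / 2" "2 * real m \<le> s" "s \<le> 2 * real m + 1"
      and t: "\<bar>x - t\<bar> < 1 / 2" "2 * real n \<le> t" "t \<le> 2 * real n + 1"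
      using mn by (auto simp: dist_real_def)
    have "real m < real n + 1" "real n < real m + 1" using s t by linarith+
    then show ?thesis by linarith
  qed
  show "\<exists>W. openin half_line W \<and> x \<in> W \<and>
      (\<forall>m n. W \<inter> {2 * real m..2 * real m + 1} \<noteq> {} \<and> W \<inter> {2 * real n..2 * real n + 1} \<noteq> {} \<longrightarrow> m = n)"
  proof (intro exI[of _ "{0..} \<inter> ball x (1 / 2)"] conjI allI impI)
    show "openin half_line ({0..} \<inter> ball x (1 / 2))" by (simp add: openin_open_Int)
    show "x \<in> {0..} \<inter> ball x (1 / 2)" using x by simp
  qed (elim conjE, rule uniq)
qed auto

theorem theorem3p1:
  shows "Continuum_Hypothesis \<longleftrightarrow>
    (\<forall>S T. standard_subcontinuum S \<and> standard_subcontinuum T \<longrightarrow>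
       subtopology (stone_cech half_line) S homeomorphic_space
       subtopology (stone_cech half_line) T)"
proof
  assume CH: Continuum_Hypothesis
  show "\<forall>S T. standard_subcontinuum S \<and> standard_subcontinuum T \<longrightarrow>
       subtopology (stone_cech half_line) S homeomorphic_space
       subtopology (stone_cech half_line) T"
  proof (intro allI impI)
    fix S T assume "standard_subcontinuum S \<and> standard_subcontinuum T"
    then obtain c d u c' d' v where
      S: "discrete_interval_sequence c d" "nonprincipal_ultrafilter u" "S = interval_ultralimit c d u" and
      T: "discrete_interval_sequence c' d'" "nonprincipal_ultrafilter v" "T = interval_ultralimit c' d' v"
      unfolding standard_subcontinuum_def by (elim conjE exE)
    interpret S: interval_sequence c d u by standard (fact S(1,2))+
    interpret T: interval_sequence c' d' v by standard (fact T(1,2))+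
    have "subtopology (stone_cech half_line) S homeomorphic_space S.X_top"
      using S.S_homeomorphic_X unfolding S.S_def S(3) .
    moreover have "S.X_top homeomorphic_space T.X_top"
      by (rule CH_imp_X_homeomorphic[OF CH S.U T.U])
    moreover have "subtopology (stone_cech half_line) T homeomorphic_space T.X_top"
      using T.S_homeomorphic_X unfolding T.S_def T(3) .
    then have "T.X_top homeomorphic_space subtopology (stone_cech half_line) T"
      by (rule homeomorphic_space_sym[THEN iffD1])
    ultimately show "subtopology (stone_cech half_line) S homeomorphic_space
       subtopology (stone_cech half_line) T"
      by (rule homeomorphic_space_trans[OF homeomorphic_space_trans])
  qed
next
  assume all: "\<forall>S T. standard_subcontinuum S \<and> standard_subcontinuum T \<longrightarrow>
       subtopology (stone_cech half_line) S homeomorphic_space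
       subtopology (stone_cech half_line) T"
  show Continuum_Hypothesis
  proof (rule ccontr)
    assume nCH: "\<not> Continuum_Hypothesis"
    obtain u where u: "nonprincipal_ultrafilter u" "thin_filter (set_filter u)"
      by (rule thin_ultrafilter_exists)
    obtain v where v: "nonprincipal_ultrafilter v" "thick_filter (set_filter v)"
      by (rule thick_ultrafilter_exists[OF nCH])
    \<comment> \<open>One sequence of intervals serves both ultrafilters, so the two subcontinua
      differ by the ultrafilter alone.\<close>
    define c d where "c n = 2 * real n" and "d n = 2 * real n + 1" for n
    have cd: "discrete_interval_sequence c d"
      unfolding c_def d_def by (rule discrete_even_intervals)
    interpret S: interval_sequence c d u by standard (fact cd u(1))+
    interpret T: interval_sequence c d v by standard (fact cd v(1))+
    have "standard_subcontinuum S.S" "standard_subcontinuum T.S"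
      unfolding standard_subcontinuum_def S.S_def T.S_def using cd u(1) v(1) by blast+
    then have "subtopology (stone_cech half_line) S.S homeomorphic_space subtopology (stone_cech half_line) T.S"
      using all by blast
    then have "S.X_top homeomorphic_space T.X_top"
      by (rule homeomorphic_space_trans[OF homeomorphic_space_trans[OF
            S.S_homeomorphic_X[THEN homeomorphic_space_sym[THEN iffD1]]] T.S_homeomorphic_X])
    moreover have "\<not> S.X_top homeomorphic_space T.X_top"
      using S.ultra_interval_axioms u(2) T.ultra_interval_axioms v(2)
      by (rule thin_thick_not_homeomorphic)
    ultimately show False by contradiction
  qed
qed

end
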